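(* Provided $h$ is sufficiently small, the problem $$\text{find } u_h\in W_h^g \text{ such that } a_h(u_h,v)=L_h(v)\quad \forall v\in V_h$$ has a unique solution, where $a_h(w,v)=\int_{\Omega_h}\mathbf{grad}_h w\cdot\mathbf{grad}\,v$ and $L_h(v)=\int_{\Omega_h}f v$.
   Context: Domain and data. $\Omega\subset\mathbb{R}^3$ is a bounded domain with boundary $\Gamma$, which is at least of class $C^1$ and whose principal curvatures are uniquely defined almost everywhere. $k\ge 2$ is a fixed integer, $f\in H^{k-1}(\Omega)$, $g\in H^{k+1/2}(\Gamma)$ (hence $g$ is continuous), and $\Omega$ is smooth enough for the solution $u$ of $-\Delta u=f$ in $\Omega$, $u=g$ on $\Gamma$, and for the harmonic function in $\Omega$ with trace $g$ on $\Gamma$, to belong to $H^{k+1}(\Omega)$. $f$ is extended by zero to $\Omega_h\setminus\Omega$. Meshes. $(\mathcal{T}_h)_h$ is a regular family (in Ciarlet's sense: uniformly shape-regular with $h\to0$; not necessarily quasi-uniform) of meshes consisting of closed straight-edged tetrahedra satisfying the usual compatibility (conformity) conditions. $\Omega_h$ is the interior of $\bigcup_{T\in\mathcal{T}_h}T$, with boundary $\Gamma_h$; all vertices of this polyhedron lie on $\Gamma$. $h_T$ is the diameter of $T$, $h=\max_T h_T$. Every element has at most either one edge or one face contained in $\Gamma_h$. $\mathcal{S}_h$ is the set of tetrahedra having one face on $\Gamma_h$ (this face is denoted $F_T$); $\mathcal{R}_h$ is the set of tetrahedra in $\mathcal{T}_h\setminus\mathcal{S}_h$ having exactly one edge on $\Gamma_h$;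 $\mathcal{O}_h=\mathcal{S}_h\cup\mathcal{R}_h$. For $T\in\mathcal{S}_h$, $O_T$ is the vertex of $T$ not belonging to $\Gamma$. Plane sets. With every edge $e$ of $\Gamma_h$ is associated a plane set $\delta_e$ containing $e$ and delimited by $\Gamma$ and $e$ itself, whose plane is close to the bisector of the faces of the pair of elements of $\mathcal{S}_h$ intersecting at $e$ (it can be a face shared by both), and does not lie in the plane of a face common to a tetrahedron in $\mathcal{S}_h$ and a tetrahedron in $\mathcal{R}_h$. Spaces. $\mathcal{P}_k(D)$ is the space of polynomials of degree $\le k$ on $D$. The Lagrangian nodes (of order $k$) of $T$ are the vertices of the partition of $T$ into $k^3$ equal tetrahedra. $V_h$ is the space of continuous functions on $\Omega_h$ vanishing on $\Gamma_h$ whose restriction to every $T\in\mathcal{T}_h$ is in $\mathcal{P}_k(T)$. $W_h^g$ is the set of functions $w$ such that (polynomials on $T$ being evaluated outside $T$ by their natural extension): 1. $w_{|T}\in\mathcal{P}_k(T)$ for all $T\in\mathcal{T}_h$; 2. $w$ is single-valued at all Lagrangian nodes of the mesh except those located on $\Gamma_h$ which are not vertices of $\Omega_h$; 3. $w(S)=g(S)$ at every vertex $S$ of $\Gamma_h$; 4. for all $T\in\mathcal{S}_h$, $w_{|T}(P)=g(P)$ at every $P$ among the $(k-1)(k-2)/2$ nearest intersections with $\Gamma$ of the lines through $O_T$ and the $(k-1)(k-2)/2$ points $M$ not belonging to any edge of $F_T$ among the $(k+2)(k+1)/2$ points of $F_T$ that subdivide this face into $k^2$ equal triangles; 5. for all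 $T\in\mathcal{O}_h$ and every edge $e$ of $T$ contained in $\Gamma_h$, $w_{|T}(Q)=g(Q)$ at every $Q$ among the $k-1$ nearest intersections with $\Gamma$ of the lines orthogonal to $e$ in $\delta_e$ passing through the $k-1$ interior points $M$ of $e$ subdividing $e$ into $k$ equal segments. $\mathbf{grad}_h$ is the broken gradient, $(\mathbf{grad}_h w)_{|T}=\mathbf{grad}\,(w_{|T})$ for all $T\in\mathcal{T}_h$. *)

theory Defs
  imports "HOL-Analysis.Analysis"
begin

section \<open>Domain and data\<close>

definition grad :: "('a::real_inner \<Rightarrow> real) \<Rightarrow> 'a \<Rightarrow> 'a" where
  "grad f x = (THE D. GDERIV f x :> D)"

definition horizontal :: "real^3 \<Rightarrow> real^2" where
  "horizontal x = vector [x $ 1, x $ 2]"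

text \<open>After the orthogonal change of coordinates \<open>A\<close>, the part of \<open>\<Omega>\<close> in the open set \<open>U\<close> lies
  strictly above the graph of the \<open>C\<^sup>1\<close> function \<open>\<phi>\<close>, whose gradient is \<open>G\<close>. Then
  \<open>frontier \<Omega> \<inter> U\<close> is the part of the graph in \<open>U\<close>.\<close>

definition boundary_graph ::
  "(real^3) set \<Rightarrow> (real^3) set \<Rightarrow> (real^3 \<Rightarrow> real^3) \<Rightarrow> (real^2 \<Rightarrow> real) \<Rightarrow> (real^2 \<Rightarrow> real^2) \<Rightarrow> bool"
where
  "boundary_graph \<Omega> U A \<phi> G \<longleftrightarrow>
     open U \<and> orthogonal_transformation A \<and>
     (\<forall>y \<in> (horizontal \<circ> A) ` U. GDERIV \<phi> y :> G y) \<and>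
     continuous_on ((horizontal \<circ> A) ` U) G \<and>
     \<Omega> \<inter> U = {x \<in> U. \<phi> (horizontal (A x)) < A x $ 3}"

text \<open>Eigenvalues of the second fundamental form of the graph with respect to the first one.
  They depend on the second derivative of \<open>\<phi>\<close> only, so they are uniquely defined at \<open>y\<close>
  exactly when \<open>G\<close> is differentiable there; otherwise no \<open>\<kappa>\<close> qualifies.\<close>

definition principal_curvature :: "(real^2 \<Rightarrow> real^2) \<Rightarrow> real^2 \<Rightarrow> real \<Rightarrow> bool" where
  "principal_curvature G y \<kappa> \<longleftrightarrow>
     (\<exists>H. (G has_derivative H) (at y) \<and>
       (\<exists>v. v \<noteq> 0 \<and> (\<forall>w. (H v \<bullet> w) / sqrt (1 + (norm (G y))\<^sup>2)
              = \<kappa> * (v \<bullet> w + (G y \<bullet> v) * (G y \<bullet> w)))))"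

text \<open>Class \<open>C\<^sup>1\<close>, with principal curvatures at almost every boundary point; surface-null sets are
  the images under the \<open>C\<^sup>1\<close> charts of null sets of the plane.\<close>

definition C1_boundary_with_curvatures :: "(real^3) set \<Rightarrow> bool" where
  "C1_boundary_with_curvatures \<Omega> \<longleftrightarrow>
     (\<forall>x \<in> frontier \<Omega>. \<exists>U A \<phi> G. x \<in> U \<and> boundary_graph \<Omega> U A \<phi> G \<and>
        negligible {y \<in> (horizontal \<circ> A) ` U. \<not> (\<exists>\<kappa>. principal_curvature G y \<kappa>)})"

primrec iter_partial :: "3 list \<Rightarrow> (real^3 \<Rightarrow> real) \<Rightarrow> real^3 \<Rightarrow> real" where
  "iter_partial [] f = f"
| "iter_partial (i # is) f = (\<lambda>x. grad (iter_partial is f) x $ i)"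

definition test_function :: "(real^3) set \<Rightarrow> (real^3 \<Rightarrow> real) \<Rightarrow> bool" where
  "test_function \<Omega> \<phi> \<longleftrightarrow>
     (\<forall>is x. iter_partial is \<phi> differentiable (at x)) \<and>
     compact (closure {x. \<phi> x \<noteq> 0}) \<and> closure {x. \<phi> x \<noteq> 0} \<subseteq> \<Omega>"

definition square_integrable :: "(real^3) set \<Rightarrow> (real^3 \<Rightarrow> real) \<Rightarrow> bool" where
  "square_integrable \<Omega> f \<longleftrightarrow>
     f \<in> borel_measurable (lebesgue_on \<Omega>) \<and> integrable (lebesgue_on \<Omega>) (\<lambda>x. (f x)\<^sup>2)"

definition weak_derivative ::
  "(real^3) set \<Rightarrow> 3 list \<Rightarrow> (real^3 \<Rightarrow> real) \<Rightarrow> (real^3 \<Rightarrow> real) \<Rightarrow> bool" where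
  "weak_derivative \<Omega> is f d \<longleftrightarrow>
     (\<forall>\<phi>. test_function \<Omega> \<phi> \<longrightarrow>
        (LINT x|lebesgue_on \<Omega>. f x * iter_partial is \<phi> x)
          = (-1) ^ length is * (LINT x|lebesgue_on \<Omega>. d x * \<phi> x))"

definition sobolev :: "nat \<Rightarrow> (real^3) set \<Rightarrow> (real^3 \<Rightarrow> real) \<Rightarrow> bool" where
  "sobolev m \<Omega> f \<longleftrightarrow>
     square_integrable \<Omega> f \<and>
     (\<forall>is. length is \<le> m \<longrightarrow> (\<exists>d. square_integrable \<Omega> d \<and> weak_derivative \<Omega> is f d))"

text \<open>\<open>sobolev_boundary k\<close> is the space of order \<open>k + 1/2\<close> on the boundary, as the space of traces of
  functions of order \<open>k + 1\<close>. For \<open>k \<ge> 1\<close> these are continuous up to the boundary (dimension 3), and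
  the trace is the restriction of the continuous representative.\<close>

definition sobolev_boundary :: "nat \<Rightarrow> (real^3) set \<Rightarrow> (real^3 \<Rightarrow> real) \<Rightarrow> bool" where
  "sobolev_boundary k \<Omega> g \<longleftrightarrow>
     (\<exists>G. sobolev (Suc k) \<Omega> G \<and> continuous_on (closure \<Omega>) G \<and> (\<forall>x \<in> frontier \<Omega>. G x = g x))"

text \<open>\<open>-\<Delta>u = f\<close> in the sense of distributions, with continuous boundary values \<open>g\<close>; such
  a \<open>u\<close> is unique on \<open>closure \<Omega>\<close>.\<close>

definition dirichlet_solution ::
  "(real^3) set \<Rightarrow> (real^3 \<Rightarrow> real) \<Rightarrow> (real^3 \<Rightarrow> real) \<Rightarrow> (real^3 \<Rightarrow> real) \<Rightarrow> bool" where
  "dirichlet_solution \<Omega> f g u \<longleftrightarrow>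
     continuous_on (closure \<Omega>) u \<and> (\<forall>x \<in> frontier \<Omega>. u x = g x) \<and>
     (\<forall>\<phi>. test_function \<Omega> \<phi> \<longrightarrow>
        - (LINT x|lebesgue_on \<Omega>. u x * (\<Sum>i\<in>UNIV. iter_partial [i, i] \<phi> x))
          = (LINT x|lebesgue_on \<Omega>. f x * \<phi> x))"


section \<open>Meshes\<close>

definition vertices :: "(real^3) set \<Rightarrow> (real^3) set" where
  "vertices T = {v. v extreme_point_of T}"

definition mesh_domain :: "(real^3) set set \<Rightarrow> (real^3) set" where
  "mesh_domain M = interior (\<Union>M)"

definition mesh_boundary :: "(real^3) set set \<Rightarrow> (real^3) set" where
  "mesh_boundary M = frontier (mesh_domain M)"

definition mesh_size :: "(real^3) set set \<Rightarrow> real" where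
  "mesh_size M = Max (diameter ` M)"

definition S_elements :: "(real^3) set set \<Rightarrow> (real^3) set set" where
  "S_elements M = {T \<in> M. \<exists>F. F facet_of T \<and> F \<subseteq> mesh_boundary M}"

definition R_elements :: "(real^3) set set \<Rightarrow> (real^3) set set" where
  "R_elements M = {T \<in> M - S_elements M. card {e. e edge_of T \<and> e \<subseteq> mesh_boundary M} = 1}"

definition O_elements :: "(real^3) set set \<Rightarrow> (real^3) set set" where
  "O_elements M = S_elements M \<union> R_elements M"

text \<open>A conforming mesh of tetrahedra fitting \<open>\<Omega>\<close>: the mesh vertices on the boundary of the polyhedron
  lie on the boundary of \<open>\<Omega>\<close>, the other ones in \<open>\<Omega>\<close>.\<close>

definition fitted_mesh :: "(real^3) set \<Rightarrow> (real^3) set set \<Rightarrow> bool" where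
  "fitted_mesh \<Omega> M \<longleftrightarrow>
     finite M \<and> M \<noteq> {} \<and>
     (\<forall>T \<in> M. 3 simplex T) \<and>
     (\<forall>T \<in> M. \<forall>T' \<in> M. T \<inter> T' face_of T \<and> T \<inter> T' face_of T') \<and>
     (\<forall>T \<in> M. \<forall>v \<in> vertices T. if v \<in> mesh_boundary M then v \<in> frontier \<Omega> else v \<in> \<Omega>) \<and>
     (\<forall>T \<in> M.
        {F. F facet_of T \<and> F \<subseteq> mesh_boundary M} = {}
          \<and> card {e. e edge_of T \<and> e \<subseteq> mesh_boundary M} \<le> 1
      \<or> (\<exists>F. {F. F facet_of T \<and> F \<subseteq> mesh_boundary M} = {F}
          \<and> (\<forall>e. e edge_of T \<and> e \<subseteq> mesh_boundary M \<longrightarrow> e \<subseteq> F))) \<and>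
     (\<forall>T \<in> S_elements M. \<exists>!v. v \<in> vertices T \<and> v \<notin> frontier \<Omega>)"

definition boundary_face :: "(real^3) set set \<Rightarrow> (real^3) set \<Rightarrow> (real^3) set" where
  "boundary_face M T = (THE F. F facet_of T \<and> F \<subseteq> mesh_boundary M)"

definition apex :: "(real^3) set \<Rightarrow> (real^3) set \<Rightarrow> real^3" where
  "apex \<Omega> T = (THE v. v \<in> vertices T \<and> v \<notin> frontier \<Omega>)"

definition inball_diameter :: "(real^3) set \<Rightarrow> real" where
  "inball_diameter T = Sup {2 * r | r. 0 \<le> r \<and> (\<exists>c. cball c r \<subseteq> T)}"

definition regular_family :: "('i \<Rightarrow> (real^3) set set) \<Rightarrow> bool" where
  "regular_family M \<longleftrightarrow>
     (\<exists>\<sigma>>0. \<forall>i. \<forall>T \<in> M i. diameter T \<le> \<sigma> * inball_diameter T) \<and>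
     (\<forall>\<epsilon>>0. \<exists>i. mesh_size (M i) < \<epsilon>)"


section \<open>The planes attached to the boundary edges\<close>

definition mesh_boundary_edges :: "(real^3) set set \<Rightarrow> (real^3) set set" where
  "mesh_boundary_edges M = {e. (\<exists>T \<in> M. e edge_of T) \<and> e \<subseteq> mesh_boundary M}"

text \<open>\<open>u\<close> is the unit vector in the plane of \<open>F\<close> that is orthogonal to its edge \<open>e\<close> and points into
  \<open>F\<close>.\<close>

definition conormal :: "(real^3) set \<Rightarrow> (real^3) set \<Rightarrow> real^3 \<Rightarrow> bool" where
  "conormal e F u \<longleftrightarrow>
     norm u = 1 \<and> (\<forall>y \<in> e. \<forall>z \<in> e. u \<bullet> (y - z) = 0) \<and> (\<exists>y \<in> e. \<exists>t>0. y + t *\<^sub>R u \<in> F)"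

text \<open>The plane bisecting the dihedral angle formed at \<open>e\<close> by two faces with conormals \<open>u1\<close> and \<open>u2\<close>
  contains \<open>e\<close> and is normal to \<open>u1 - u2\<close>. So the plane \<open>P\<close> through \<open>e\<close>, with unit normal \<open>n\<close>, makes an
  angle of at most \<open>\<theta>\<close> with it iff the last inequality holds.\<close>

definition near_bisector ::
  "real \<Rightarrow> (real^3) set \<Rightarrow> (real^3) set \<Rightarrow> (real^3) set \<Rightarrow> (real^3) set \<Rightarrow> bool" where
  "near_bisector \<theta> e F1 F2 P \<longleftrightarrow>
     (\<exists>u1 u2 n. conormal e F1 u1 \<and> conormal e F2 u2 \<and>
        norm n = 1 \<and> (\<forall>x \<in> P. \<forall>y \<in> P. n \<bullet> (x - y) = 0) \<and>
        \<bar>n \<bullet> (u1 - u2)\<bar> \<ge> cos \<theta> * norm (u1 - u2))"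

text \<open>\<open>Pl e\<close> is the plane of the set \<open>\<delta>\<^sub>e\<close>. The set itself is the part of \<open>Pl e\<close> between \<open>e\<close> and
  the boundary of \<open>\<Omega>\<close>; it may degenerate to \<open>e\<close>, and then it does not determine its plane.
  Its plane being close to the bisector means that their angle is at most \<open>\<theta>\<close>.\<close>

definition edge_planes ::
  "real \<Rightarrow> (real^3) set set \<Rightarrow> ((real^3) set \<Rightarrow> (real^3) set) \<Rightarrow> bool" where
  "edge_planes \<theta> M Pl \<longleftrightarrow>
     (\<forall>e \<in> mesh_boundary_edges M.
        affine (Pl e) \<and> aff_dim (Pl e) = 2 \<and> e \<subseteq> Pl e \<and>
        (\<exists>T1 \<in> S_elements M. \<exists>T2 \<in> S_elements M. T1 \<noteq> T2 \<and>
           e edge_of boundary_face M T1 \<and> e edge_of boundary_face M T2 \<and>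
           near_bisector \<theta> e (boundary_face M T1) (boundary_face M T2) (Pl e)) \<and>
        (\<forall>T \<in> S_elements M. \<forall>T' \<in> R_elements M. \<forall>F.
           F facet_of T \<and> F facet_of T' \<longrightarrow> Pl e \<noteq> affine hull F))"

text \<open>The tolerance is uniform in the family. Any \<open>\<theta> < \<pi>/2\<close> is admitted, since a face
  shared by the two elements of \<open>S_elements M\<close> at \<open>e\<close> must qualify.\<close>

definition edge_planes_family ::
  "('i \<Rightarrow> (real^3) set set) \<Rightarrow> ('i \<Rightarrow> (real^3) set \<Rightarrow> (real^3) set) \<Rightarrow> bool" where
  "edge_planes_family M Pl \<longleftrightarrow> (\<exists>\<theta>. 0 \<le> \<theta> \<and> \<theta> < pi / 2 \<and> (\<forall>i. edge_planes \<theta> (M i) (Pl i)))"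


section \<open>Discrete spaces\<close>

text \<open>Polynomial functions of total degree at most \<open>k\<close>, on the whole space.\<close>

definition polys :: "nat \<Rightarrow> (real^3 \<Rightarrow> real) set" where
  "polys k = {p. \<exists>c :: (3 \<Rightarrow> nat) \<Rightarrow> real.
     p = (\<lambda>x. \<Sum>\<alpha> | (\<Sum>i\<in>UNIV. \<alpha> i) \<le> k. c \<alpha> * (\<Prod>i\<in>UNIV. x $ i ^ \<alpha> i))}"

lemma finite_multi_indices: "finite {\<alpha> :: 3 \<Rightarrow> nat. (\<Sum>i\<in>UNIV. \<alpha> i) \<le> k}"
proof (rule finite_subset)
  show "{\<alpha> :: 3 \<Rightarrow> nat. (\<Sum>i\<in>UNIV. \<alpha> i) \<le> k} \<subseteq> UNIV \<rightarrow>\<^sub>E {..k}"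
  proof (clarsimp simp: PiE_def)
    fix \<alpha> :: "3 \<Rightarrow> nat" and i
    assume "(\<Sum>i\<in>UNIV. \<alpha> i) \<le> k"
    then show "\<alpha> i \<le> k"
      using member_le_sum[of i UNIV \<alpha>] by simp
  qed
qed (simp add: finite_PiE)

text \<open>The points of a simplex \<open>S\<close> of dimension 1, 2 or 3 with barycentric coordinates in
  \<open>{0, 1/k, \<dots>, 1}\<close>, that is, the vertices of its subdivision into \<open>k\<close> equal segments, \<open>k\<^sup>2\<close> equal
  triangles or \<open>k\<^sup>3\<close> tetrahedra of equal volume.\<close>

definition lattice_points :: "nat \<Rightarrow> (real^3) set \<Rightarrow> (real^3) set" where
  "lattice_points k S =
     {\<Sum>v\<in>vertices S. (real (m v) / real k) *\<^sub>R v | m. (\<Sum>v\<in>vertices S. m v) = k}"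

text \<open>The intersection points of the line \<open>L\<close> with the boundary that are nearest to \<open>x\<close>.\<close>

definition nearest_intersections :: "(real^3) set \<Rightarrow> (real^3) set \<Rightarrow> real^3 \<Rightarrow> (real^3) set" where
  "nearest_intersections \<Omega> L x = {Q. is_arg_min (dist x) (\<lambda>Q. Q \<in> L \<inter> frontier \<Omega>) Q}"

definition orthogonal_line :: "(real^3) set \<Rightarrow> (real^3) set \<Rightarrow> real^3 \<Rightarrow> (real^3) set" where
  "orthogonal_line P e x = {y \<in> P. \<forall>a \<in> e. \<forall>b \<in> e. (y - x) \<bullet> (a - b) = 0}"

definition V_space :: "nat \<Rightarrow> (real^3) set set \<Rightarrow> (real^3 \<Rightarrow> real) set" where
  "V_space k M = {v. continuous_on (closure (mesh_domain M)) v \<and>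
     (\<forall>x \<in> mesh_boundary M. v x = 0) \<and>
     (\<forall>T \<in> M. \<exists>p \<in> polys k. \<forall>x \<in> T. v x = p x)}"

text \<open>An element \<open>w\<close> maps each tetrahedron \<open>T\<close> to the polynomial \<open>w T\<close>, defined on the whole space,
  which extends the restriction of \<open>w\<close> to \<open>T\<close>.\<close>

definition W_space ::
  "nat \<Rightarrow> (real^3) set \<Rightarrow> (real^3) set set \<Rightarrow> ((real^3) set \<Rightarrow> (real^3) set) \<Rightarrow> (real^3 \<Rightarrow> real) \<Rightarrow>
   ((real^3) set \<Rightarrow> real^3 \<Rightarrow> real) set" where
  "W_space k \<Omega> M Pl g = {w \<in> M \<rightarrow>\<^sub>E polys k.
     (\<forall>T \<in> M. \<forall>T' \<in> M. \<forall>x \<in> lattice_points k T \<inter> lattice_points k T'.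
        x \<notin> mesh_boundary M \<or> x \<in> vertices T \<longrightarrow> w T x = w T' x) \<and>
     (\<forall>T \<in> M. \<forall>x \<in> vertices T \<inter> mesh_boundary M. w T x = g x) \<and>
     (\<forall>T \<in> S_elements M. \<forall>x \<in> lattice_points k (boundary_face M T).
        (\<forall>e. e edge_of boundary_face M T \<longrightarrow> x \<notin> e) \<longrightarrow>
        (\<forall>P \<in> nearest_intersections \<Omega> (affine hull {apex \<Omega> T, x}) x. w T P = g P)) \<and>
     (\<forall>T \<in> O_elements M. \<forall>e. e edge_of T \<and> e \<subseteq> mesh_boundary M \<longrightarrow>
        (\<forall>x \<in> lattice_points k e - vertices e.
           \<forall>Q \<in> nearest_intersections \<Omega> (orthogonal_line (Pl e) e x) x. w T Q = g Q))}"

text \<open>The faces of the elements form a null set, on which the value 0 is taken.\<close>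

definition broken_grad ::
  "(real^3) set set \<Rightarrow> ((real^3) set \<Rightarrow> real^3 \<Rightarrow> real) \<Rightarrow> real^3 \<Rightarrow> real^3" where
  "broken_grad M w x = (\<Sum>T | T \<in> M \<and> x \<in> interior T. grad (w T) x)"

definition a_form ::
  "(real^3) set set \<Rightarrow> ((real^3) set \<Rightarrow> real^3 \<Rightarrow> real) \<Rightarrow> (real^3 \<Rightarrow> real) \<Rightarrow> real" where
  "a_form M w v = (LINT x:mesh_domain M|lebesgue. broken_grad M w x \<bullet> grad v x)"

definition L_form ::
  "(real^3) set \<Rightarrow> (real^3) set set \<Rightarrow> (real^3 \<Rightarrow> real) \<Rightarrow> (real^3 \<Rightarrow> real) \<Rightarrow> real" where
  "L_form \<Omega> M f v = (LINT x:mesh_domain M|lebesgue. (if x \<in> \<Omega> then f x else 0) * v x)"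

end

theory Submission
  imports Defs
begin

text \<open>The elements of the trial set and of the test space have the same free parameters, namely their
  values at the lattice points that do not lie on the boundary of the polyhedron. A test function
  vanishes at the remaining lattice points, whereas a trial function takes prescribed values at
  displaced points, which lie on \<open>frontier \<Omega>\<close>. The problem is therefore a square linear system, and it is
  uniquely solvable as soon as the bilinear form, with both arguments expressed through the
  parameters \<open>c\<close>, is positive definite (\<open>pos_def_solvable\<close>).

  On a fine mesh the displacements are small relative to the diameters of the elements. At a scale
  that is uniform by compactness, the \<open>C\<^sup>1\<close> boundary is a nearly flat graph (\<open>uniformly_flat\<close>); a line
  that crosses it at a fixed angle meets it exactly once near a given point, at a small
  distance (\<open>transversal_line\<close>). The lines through the apex of an element are transversal by shape
  regularity (\<open>face_node_displacement\<close>). The lines attached to the edges are transversal because their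
  planes make an angle bounded away from \<open>\<pi>/2\<close> with the bisecting plane
  (\<open>edge_node_displacement\<close>). That plane can be far from the normal of the boundary only if the
  two faces at the edge are folded on each other; but then the elements above them
  overlap (\<open>thin_dihedral_overlap\<close>).

  Positivity is a local matter. Let \<open>w\<close> be the polynomial on \<open>T\<close> whose value at each displaced node is the
  value of \<open>v\<close> at the node itself. The nodal values of \<open>e = w - v\<close> are the differences of \<open>w\<close> between
  nodes and displaced nodes, hence small compared with the gradient of \<open>v\<close>. An inverse inequality
  then shows that \<open>\<integral> grad w \<bullet> grad v\<close> is bounded below by a positive multiple of the squared
  oscillation of the nodal values of \<open>v\<close> (\<open>energy_lower_bound\<close>). If the sum over all elements is zero, \<open>v\<close>
  is constant on each element and zero on the boundary, hence zero (\<open>locally_constant_nodal_zero\<close>).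

  All constants of the polynomial estimates are explicit functions of the degree \<open>k\<close> and of the shape
  parameter \<open>\<sigma>\<close>, since the Lagrange basis functions are products of \<open>k\<close> affine functions in the barycentric
  coordinates, whose gradients are at most \<open>\<sigma> / diameter T\<close>.\<close>

section \<open>Polynomial functions and their gradients\<close>

definition monomial :: "(3 \<Rightarrow> nat) \<Rightarrow> real^3 \<Rightarrow> real" where
  "monomial \<alpha> x = (\<Prod>i\<in>UNIV. x $ i ^ \<alpha> i)"

lemma polysE:
  assumes "p \<in> polys k"
  obtains c where "p = (\<lambda>x. \<Sum>\<alpha> | (\<Sum>i\<in>UNIV. \<alpha> i) \<le> k. c \<alpha> * monomial \<alpha> x)"
  using assms unfolding polys_def monomial_def by blast

lemma polysI:
  assumes "p = (\<lambda>x. \<Sum>\<alpha> | (\<Sum>i\<in>UNIV. \<alpha> i) \<le> k. c \<alpha> * (\<Prod>i\<in>UNIV. x $ i ^ \<alpha> i))"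
  shows "p \<in> polys k"
  using assms unfolding polys_def by blast

lemma monomial_in_polys:
  assumes "(\<Sum>i\<in>UNIV. \<alpha> i) \<le> k"
  shows "monomial \<alpha> \<in> polys k"
proof -
  have "monomial \<alpha> = (\<lambda>x. \<Sum>\<beta> | (\<Sum>i\<in>UNIV. \<beta> i) \<le> k.
          (if \<beta> = \<alpha> then 1 else 0) * (\<Prod>i\<in>UNIV. x $ i ^ \<beta> i))"
  proof
    fix x :: "real^3"
    have "(\<Sum>\<beta> | (\<Sum>i\<in>UNIV. \<beta> i) \<le> k. (if \<beta> = \<alpha> then 1 else 0) * (\<Prod>i\<in>UNIV. x $ i ^ \<beta> i))
        = (\<Sum>\<beta> | (\<Sum>i\<in>UNIV. \<beta> i) \<le> k. if \<beta> = \<alpha> then \<Prod>i\<in>UNIV. x $ i ^ \<beta> i else 0)"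
      by (rule sum.cong) auto
    also have "\<dots> = monomial \<alpha> x"
      using assms by (simp only: sum.delta[OF finite_multi_indices[of k]]) (simp add: monomial_def)
    finally show "monomial \<alpha> x = (\<Sum>\<beta> | (\<Sum>i\<in>UNIV. \<beta> i) \<le> k.
        (if \<beta> = \<alpha> then 1 else 0) * (\<Prod>i\<in>UNIV. x $ i ^ \<beta> i))" ..
  qed
  then show ?thesis
    by (rule polysI)
qed

lemma polys_add:
  assumes "p \<in> polys k" "q \<in> polys k"
  shows "(\<lambda>x. p x + q x) \<in> polys k"
proof -
  obtain c d where "p = (\<lambda>x. \<Sum>\<alpha> | (\<Sum>i\<in>UNIV. \<alpha> i) \<le> k. c \<alpha> * (\<Prod>i\<in>UNIV. x $ i ^ \<alpha> i))"
    and "q = (\<lambda>x. \<Sum>\<alpha> | (\<Sum>i\<in>UNIV. \<alpha> i) \<le> k. d \<alpha> * (\<Prod>i\<in>UNIV. x $ i ^ \<alpha> i))"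
    using assms unfolding polys_def by blast
  then have "(\<lambda>x. p x + q x) = (\<lambda>x. \<Sum>\<alpha> | (\<Sum>i\<in>UNIV. \<alpha> i) \<le> k. (c \<alpha> + d \<alpha>) * (\<Prod>i\<in>UNIV. x $ i ^ \<alpha> i))"
    by (simp add: sum.distrib distrib_right)
  then show ?thesis
    by (rule polysI)
qed

lemma polys_scale:
  assumes "p \<in> polys k"
  shows "(\<lambda>x. r * p x) \<in> polys k"
proof -
  obtain c where "p = (\<lambda>x. \<Sum>\<alpha> | (\<Sum>i\<in>UNIV. \<alpha> i) \<le> k. c \<alpha> * (\<Prod>i\<in>UNIV. x $ i ^ \<alpha> i))"
    using assms unfolding polys_def by blast
  then have "(\<lambda>x. r * p x) = (\<lambda>x. \<Sum>\<alpha> | (\<Sum>i\<in>UNIV. \<alpha> i) \<le> k. (r * c \<alpha>) * (\<Prod>i\<in>UNIV. x $ i ^ \<alpha> i))"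
    by (simp add: sum_distrib_left mult.assoc)
  then show ?thesis
    by (rule polysI)
qed

lemma polys_const: "(\<lambda>x. r) \<in> polys k"
  using polys_scale[OF monomial_in_polys[of "\<lambda>i. 0" k], of r] by (simp add: monomial_def)

lemma polys_sum:
  assumes "\<And>i. i \<in> I \<Longrightarrow> p i \<in> polys k"
  shows "(\<lambda>x. \<Sum>i\<in>I. c i * p i x) \<in> polys k"
  using assms
  by (induction I rule: infinite_finite_induct) (auto intro!: polys_const polys_add polys_scale)

lemma polys_diff:
  assumes "p \<in> polys k" "q \<in> polys k"
  shows "(\<lambda>x. p x - q x) \<in> polys k"
  using polys_add[OF assms(1) polys_scale[OF assms(2), of "-1"]] by simp

lemma monomial_upd: "monomial (\<alpha>(i := Suc (\<alpha> i))) x = x $ i * monomial \<alpha> x"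
  unfolding monomial_def
  by (subst (1 2) prod.remove[where x=i]) (auto intro!: prod.cong)

lemma sum_upd: "(\<Sum>j\<in>UNIV. (\<alpha>(i := Suc (\<alpha> i))) (j::3)) = Suc (\<Sum>j\<in>UNIV. \<alpha> j)"
  by (subst (1 2) sum.remove[where x=i]) (auto intro!: sum.cong)

lemma polys_affine_mult:
  assumes "p \<in> polys k"
  shows "(\<lambda>x. (a \<bullet> x + b) * p x) \<in> polys (Suc k)"
proof -
  obtain c where c: "p = (\<lambda>x. \<Sum>\<alpha> | (\<Sum>i\<in>UNIV. \<alpha> i) \<le> k. c \<alpha> * monomial \<alpha> x)"
    using assms by (rule polysE)
  have "(\<lambda>x. x $ i * p x) \<in> polys (Suc k)" for i
  proof -
    have "(\<lambda>x. x $ i * p x) = (\<lambda>x. \<Sum>\<alpha> | (\<Sum>i\<in>UNIV. \<alpha> i) \<le> k. c \<alpha> * monomial (\<alpha>(i := Suc (\<alpha> i))) x)"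
      unfolding c by (simp add: sum_distrib_left monomial_upd mult_ac)
    then show ?thesis
      by (auto intro!: polys_sum monomial_in_polys simp: sum_upd simp del: fun_upd_apply)
  qed
  then have "(\<lambda>x. \<Sum>i\<in>UNIV. a $ i * (x $ i * p x)) \<in> polys (Suc k)"
    by (intro polys_sum)
  moreover have "p \<in> polys (Suc k)"
    unfolding c by (rule polys_sum) (auto intro: monomial_in_polys)
  then have "(\<lambda>x. b * p x) \<in> polys (Suc k)"
    by (rule polys_scale)
  ultimately have "(\<lambda>x. (\<Sum>i\<in>UNIV. a $ i * (x $ i * p x)) + b * p x) \<in> polys (Suc k)"
    by (rule polys_add)
  then show ?thesis
    by (simp add: inner_vec_def sum_distrib_right distrib_right mult.assoc)
qed

lemma polys_prod_affine:
  assumes "finite I"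
  shows "(\<lambda>x. \<Prod>i\<in>I. a i \<bullet> x + b i) \<in> polys (card I)"
  using assms by induction (auto intro: polys_const polys_affine_mult)

lemma grad_eqI: "GDERIV p x :> D \<Longrightarrow> grad p x = D"
proof -
  assume a: "GDERIV p x :> D"
  have "D' = D" if "GDERIV p x :> D'" for D'
    using has_derivative_unique[OF a[unfolded gderiv_def] that[unfolded gderiv_def]]
    by (metis vector_eq_ldot)
  with a show ?thesis unfolding grad_def by blast
qed

text \<open>Everywhere differentiable with a continuous gradient: the property of polynomials that makes
  \<^const>\<open>grad\<close> linear and the energies integrable.\<close>

definition C1_fun :: "('a::real_inner \<Rightarrow> real) \<Rightarrow> bool" where
  "C1_fun p \<longleftrightarrow> (\<forall>x. GDERIV p x :> grad p x) \<and> continuous_on UNIV (grad p)"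

lemma C1_funI:
  assumes "\<And>x. GDERIV p x :> D x" "continuous_on UNIV D"
  shows "C1_fun p" "grad p = D"
proof -
  show "grad p = D" using grad_eqI[OF assms(1)] by blast
  then show "C1_fun p" using assms by (simp add: C1_fun_def)
qed

lemma C1_fun_gderiv: "C1_fun p \<Longrightarrow> GDERIV p x :> grad p x"
  by (simp add: C1_fun_def)

lemma C1_fun_const: "C1_fun (\<lambda>x. c)"
  by (rule C1_funI[where D="\<lambda>x. 0"]) (auto intro: GDERIV_const)

lemma C1_fun_affine:
  shows "C1_fun (\<lambda>x. a \<bullet> x + b)" and "grad (\<lambda>x. a \<bullet> x + b) = (\<lambda>x. a)"
proof -
  have *: "GDERIV (\<lambda>x. a \<bullet> x + b) x :> a" for x
    unfolding gderiv_def by (auto intro!: derivative_eq_intros simp: inner_commute)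
  show "C1_fun (\<lambda>x. a \<bullet> x + b)" and "grad (\<lambda>x. a \<bullet> x + b) = (\<lambda>x. a)"
    by (rule C1_funI[where D="\<lambda>x. a"], auto intro: *)+
qed

lemma C1_fun_add:
  assumes "C1_fun p" "C1_fun q"
  shows "C1_fun (\<lambda>x. p x + q x)" and "grad (\<lambda>x. p x + q x) = (\<lambda>x. grad p x + grad q x)"
  by (rule C1_funI[where D="\<lambda>x. grad p x + grad q x"], 
      use assms in \<open>auto intro!: GDERIV_add continuous_intros simp: C1_fun_def\<close>)+

lemma C1_fun_mult:
  assumes "C1_fun p" "C1_fun q"
  shows "C1_fun (\<lambda>x. p x * q x)" and "grad (\<lambda>x. p x * q x) = (\<lambda>x. p x *\<^sub>R grad q x + q x *\<^sub>R grad p x)"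
proof -
  have "continuous_on UNIV f" if "C1_fun f" for f :: "'a \<Rightarrow> real"
    using that unfolding C1_fun_def gderiv_def
    by (meson has_derivative_continuous continuous_at_imp_continuous_on)
  then show "C1_fun (\<lambda>x. p x * q x)" and "grad (\<lambda>x. p x * q x) = (\<lambda>x. p x *\<^sub>R grad q x + q x *\<^sub>R grad p x)"
    by -(rule C1_funI[where D="\<lambda>x. p x *\<^sub>R grad q x + q x *\<^sub>R grad p x"],
      use assms in \<open>auto intro!: GDERIV_mult continuous_intros simp: C1_fun_def\<close>)+
qed

lemma C1_fun_scale:
  assumes "C1_fun p"
  shows "C1_fun (\<lambda>x. c * p x)" and "grad (\<lambda>x. c * p x) = (\<lambda>x. c *\<^sub>R grad p x)"
proof -
  have [simp]: "grad (\<lambda>x::'a. c) = (\<lambda>x. 0)"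
    by (rule ext, rule grad_eqI, rule GDERIV_const)
  show "C1_fun (\<lambda>x. c * p x)" and "grad (\<lambda>x. c * p x) = (\<lambda>x. c *\<^sub>R grad p x)"
    using C1_fun_mult[OF C1_fun_const assms, of c] by simp_all
qed

lemma C1_fun_sum:
  fixes p :: "'i \<Rightarrow> 'a::real_inner \<Rightarrow> real"
  assumes "\<And>i. i \<in> I \<Longrightarrow> C1_fun (p i)"
  shows "C1_fun (\<lambda>x. \<Sum>i\<in>I. c i * p i x)
    \<and> grad (\<lambda>x. \<Sum>i\<in>I. c i * p i x) = (\<lambda>x. \<Sum>i\<in>I. c i *\<^sub>R grad (p i) x)"
proof -
  have z: "grad (\<lambda>x::'a. 0::real) = (\<lambda>x. 0)"
    by (rule ext, rule grad_eqI, rule GDERIV_const)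
  show ?thesis
    using assms
  proof (induction I rule: infinite_finite_induct)
    case (insert i I)
    then have "C1_fun (\<lambda>x. c i * p i x)" "C1_fun (\<lambda>x. \<Sum>i\<in>I. c i * p i x)"
      by (auto intro: C1_fun_scale(1))
    from C1_fun_add[OF this] show ?case
      using insert C1_fun_scale(2)[of "p i" "c i"] by simp
  qed (simp_all add: C1_fun_const z)
qed

lemma C1_fun_polys: "p \<in> polys k \<Longrightarrow> C1_fun p"
proof -
  assume "p \<in> polys k"
  then obtain c where c: "p = (\<lambda>x. \<Sum>\<alpha> | (\<Sum>i\<in>UNIV. \<alpha> i) \<le> k. c \<alpha> * monomial \<alpha> x)"
    by (rule polysE)
  have coord: "C1_fun (\<lambda>x::real^3. x $ i)" for i
    using C1_fun_affine(1)[of "axis i (1::real)" 0] by (simp add: inner_axis' inner_real_def)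
  have pow: "C1_fun (\<lambda>x::real^3. x $ i ^ n)" for i n
    by (induction n) (simp_all add: C1_fun_const C1_fun_mult(1)[OF coord])
  have "C1_fun (\<lambda>x::real^3. \<Prod>i\<in>I. x $ i ^ \<alpha> i)" for I \<alpha>
    by (induction I rule: infinite_finite_induct) (simp_all add: C1_fun_const C1_fun_mult(1)[OF pow])
  then have "C1_fun (monomial \<alpha>)" for \<alpha>
    unfolding monomial_def .
  then show ?thesis
    unfolding c using C1_fun_sum[of "{\<alpha>. (\<Sum>i\<in>UNIV. \<alpha> i) \<le> k}" monomial c] by simp
qed

lemma grad_diff_polys:
  assumes "p \<in> polys k" "q \<in> polys k"
  shows "grad (\<lambda>x. p x - q x) x = grad p x - grad q x"
  by (rule grad_eqI) (intro GDERIV_diff C1_fun_gderiv C1_fun_polys[OF assms(1)] C1_fun_polys[OF assms(2)])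

text \<open>The estimates on a product of affine functions hold with constants that depend on the number
  of factors and on bounds of the factors only.\<close>

lemma prod_lipschitz:
  fixes u v :: "'i \<Rightarrow> real" and B d :: real
  assumes "finite I" "1 \<le> B" "\<And>i. i \<in> I \<Longrightarrow> \<bar>u i\<bar> \<le> B" "\<And>i. i \<in> I \<Longrightarrow> \<bar>v i\<bar> \<le> B"
    and "\<And>i. i \<in> I \<Longrightarrow> \<bar>u i - v i\<bar> \<le> d" "0 \<le> d"
  shows "\<bar>(\<Prod>i\<in>I. u i) - (\<Prod>i\<in>I. v i)\<bar> \<le> card I * B ^ card I * d"
  using assms(1,3-5)
proof (induction I)
  case (insert j I)
  have B0: "0 \<le> B" using assms(2) by simp
  have a: "\<bar>\<Prod>i\<in>I. v i\<bar> \<le> B ^ card I"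
    unfolding abs_prod using prod_mono[of I "\<lambda>i. \<bar>v i\<bar>" "\<lambda>i. B"] insert by simp
  have "(\<Prod>i\<in>insert j I. u i) - (\<Prod>i\<in>insert j I. v i)
      = u j * ((\<Prod>i\<in>I. u i) - (\<Prod>i\<in>I. v i)) + (u j - v j) * (\<Prod>i\<in>I. v i)"
    using insert by (simp add: algebra_simps)
  also have "\<bar>\<dots>\<bar> \<le> \<bar>u j\<bar> * \<bar>(\<Prod>i\<in>I. u i) - (\<Prod>i\<in>I. v i)\<bar> + \<bar>u j - v j\<bar> * \<bar>\<Prod>i\<in>I. v i\<bar>"
    by (metis abs_mult abs_triangle_ineq)
  also have "\<dots> \<le> B * (card I * B ^ card I * d) + d * B ^ card I"
    using insert.prems insert.IH a B0 assms(6) by (intro add_mono mult_mono) auto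
  also have "d * B ^ card I \<le> d * B ^ Suc (card I)"
    using assms(2,6) by (intro mult_left_mono power_increasing) auto
  finally show ?case
    using insert by (simp add: algebra_simps)
qed simp

lemma prod_affine_grad:
  fixes a :: "'i \<Rightarrow> 'a::real_inner"
  assumes "finite I"
  shows "grad (\<lambda>x. \<Prod>i\<in>I. a i \<bullet> x + b i) x = (\<Sum>i\<in>I. (\<Prod>j\<in>I - {i}. a j \<bullet> x + b j) *\<^sub>R a i)"
proof -
  have "C1_fun (\<lambda>x. \<Prod>i\<in>I. a i \<bullet> x + b i) \<and> grad (\<lambda>x. \<Prod>i\<in>I. a i \<bullet> x + b i)
     = (\<lambda>x. (\<Sum>i\<in>I. (\<Prod>j\<in>I - {i}. a j \<bullet> x + b j) *\<^sub>R a i))"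
    using assms
  proof induction
    case empty
    have "grad (\<lambda>x::'a. 1::real) = (\<lambda>x. 0)"
      by (rule ext, rule grad_eqI, rule GDERIV_const)
    then show ?case by (simp add: C1_fun_const)
  next
    case (insert j I)
    have 1: "C1_fun (\<lambda>x. (a j \<bullet> x + b j) * (\<Prod>i\<in>I. a i \<bullet> x + b i))"
      using insert by (intro C1_fun_mult C1_fun_affine) auto
    have 2: "(\<Prod>l\<in>insert j I - {i}. a l \<bullet> x + b l) = (a j \<bullet> x + b j) * (\<Prod>l\<in>I - {i}. a l \<bullet> x + b l)"
      if "i \<in> I" for i x
  proof -
      have "insert j I - {i} = insert j (I - {i})" "j \<notin> I - {i}"
        using insert that by auto
      then show ?thesis
        using insert by simp
    qed
    have 3: "grad (\<lambda>x. (a j \<bullet> x + b j) * (\<Prod>i\<in>I. a i \<bullet> x + b i))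
        = (\<lambda>x. \<Sum>i\<in>insert j I. (\<Prod>l\<in>insert j I - {i}. a l \<bullet> x + b l) *\<^sub>R a i)"
      using insert C1_fun_mult(2)[of "\<lambda>x. a j \<bullet> x + b j" "\<lambda>x. \<Prod>i\<in>I. a i \<bullet> x + b i"]
      by (simp add: C1_fun_affine 2 scaleR_sum_right) (simp add: add.commute)
    show ?case
      using 1 3 insert by simp
  qed
  then show ?thesis by simp
qed

lemma prod_affine_bounds:
  fixes a :: "'i \<Rightarrow> 'a::real_inner" and B K :: real
  assumes "finite I" "card I = n" "1 \<le> B" "0 \<le> K" "\<And>i. i \<in> I \<Longrightarrow> norm (a i) \<le> K"
    and "\<And>i. i \<in> I \<Longrightarrow> \<bar>a i \<bullet> x + b i\<bar> \<le> B" "\<And>i. i \<in> I \<Longrightarrow> \<bar>a i \<bullet> y + b i\<bar> \<le> B"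
  shows "\<bar>(\<Prod>i\<in>I. a i \<bullet> x + b i) - (\<Prod>i\<in>I. a i \<bullet> y + b i)\<bar> \<le> real n * B ^ n * (K * norm (x - y))"
    and "norm (grad (\<lambda>x. \<Prod>i\<in>I. a i \<bullet> x + b i) x) \<le> real n * B ^ n * K"
    and "norm (grad (\<lambda>x. \<Prod>i\<in>I. a i \<bullet> x + b i) x - grad (\<lambda>x. \<Prod>i\<in>I. a i \<bullet> x + b i) y)
           \<le> real n * real n * B ^ n * K\<^sup>2 * norm (x - y)"
proof -
  have d: "\<bar>(a i \<bullet> x + b i) - (a i \<bullet> y + b i)\<bar> \<le> K * norm (x - y)" if "i \<in> I" for i
  proof -
    have "\<bar>(a i \<bullet> x + b i) - (a i \<bullet> y + b i)\<bar> = \<bar>a i \<bullet> (x - y)\<bar>"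
      by (simp add: inner_diff_right)
    also have "\<dots> \<le> norm (a i) * norm (x - y)"
      by (rule Cauchy_Schwarz_ineq2)
    finally show ?thesis
      using assms(5)[OF that] by (meson mult_right_mono norm_ge_zero order_trans)
  qed
  then show "\<bar>(\<Prod>i\<in>I. a i \<bullet> x + b i) - (\<Prod>i\<in>I. a i \<bullet> y + b i)\<bar> \<le> real n * B ^ n * (K * norm (x - y))"
    using prod_lipschitz[of I B "\<lambda>i. a i \<bullet> x + b i" "\<lambda>i. a i \<bullet> y + b i"] assms by simp
  have Bp: "B ^ card (I - {i}) \<le> B ^ n" for i
    using assms(1-3) by (intro power_increasing) (auto simp: card_Diff1_le)
  have "norm (grad (\<lambda>x. \<Prod>i\<in>I. a i \<bullet> x + b i) x) \<le> (\<Sum>i\<in>I. B ^ n * K)"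
    unfolding prod_affine_grad[OF assms(1)]
  proof (rule sum_norm_le)
    fix i assume i: "i \<in> I"
    have "\<bar>\<Prod>j\<in>I - {i}. a j \<bullet> x + b j\<bar> \<le> B ^ card (I - {i})"
      unfolding abs_prod using prod_mono[of "I - {i}" "\<lambda>i. \<bar>a i \<bullet> x + b i\<bar>" "\<lambda>i. B"] assms by simp
    then have "\<bar>\<Prod>j\<in>I - {i}. a j \<bullet> x + b j\<bar> \<le> B ^ n"
      using Bp[of i] by linarith
    then show "norm ((\<Prod>j\<in>I - {i}. a j \<bullet> x + b j) *\<^sub>R a i) \<le> B ^ n * K"
      using assms i by (simp add: mult_mono)
  qed
  then show "norm (grad (\<lambda>x. \<Prod>i\<in>I. a i \<bullet> x + b i) x) \<le> real n * B ^ n * K"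
    using assms by simp
  have "norm (grad (\<lambda>x. \<Prod>i\<in>I. a i \<bullet> x + b i) x - grad (\<lambda>x. \<Prod>i\<in>I. a i \<bullet> x + b i) y)
     \<le> (\<Sum>i\<in>I. real n * B ^ n * (K * norm (x - y)) * K)"
    unfolding prod_affine_grad[OF assms(1)] sum_subtractf[symmetric] scaleR_diff_left[symmetric]
  proof (rule sum_norm_le)
    fix i assume i: "i \<in> I"
    have c: "card (I - {i}) \<le> n"
      using assms by (metis card_Diff1_le)
    have "\<bar>(\<Prod>j\<in>I - {i}. a j \<bullet> x + b j) - (\<Prod>j\<in>I - {i}. a j \<bullet> y + b j)\<bar>
        \<le> card (I - {i}) * B ^ card (I - {i}) * (K * norm (x - y))"
      using assms d by (intro prod_lipschitz) auto
    also have "\<dots> \<le> real n * B ^ n * (K * norm (x - y))"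
      using c Bp[of i] assms(3,4) by (intro mult_right_mono mult_mono) auto
    finally show "norm (((\<Prod>j\<in>I - {i}. a j \<bullet> x + b j) - (\<Prod>j\<in>I - {i}. a j \<bullet> y + b j)) *\<^sub>R a i)
        \<le> real n * B ^ n * (K * norm (x - y)) * K"
      using assms(5)[OF i] assms(3,4) by (simp add: mult_mono)
  qed
  then show "norm (grad (\<lambda>x. \<Prod>i\<in>I. a i \<bullet> x + b i) x - grad (\<lambda>x. \<Prod>i\<in>I. a i \<bullet> x + b i) y)
           \<le> real n * real n * B ^ n * K\<^sup>2 * norm (x - y)"
    using assms(2) by (simp add: power2_eq_square mult_ac)
qed

section \<open>Linear systems with a positive definite matrix\<close>

text \<open>Elimination of one unknown \<open>n\<close> replaces the matrix, which may be nonsymmetric, by its Schur complement.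
  This is positive definite again: complete a vector on \<open>N\<close> by the value that annihilates row \<open>n\<close>; the
  quadratic form of the completed vector is that of the Schur complement.\<close>

lemma pos_def_solvable:
  fixes A :: "'n \<Rightarrow> 'n \<Rightarrow> real"
  assumes "finite N"
    and "\<And>c. \<exists>x\<in>N. c x \<noteq> 0 \<Longrightarrow> (\<Sum>x\<in>N. c x * (\<Sum>y\<in>N. A x y * c y)) > 0"
  shows "\<exists>c. \<forall>x\<in>N. (\<Sum>y\<in>N. A x y * c y) = b x"
  using assms
proof (induction N arbitrary: A b)
  case (insert n N)
  have "(\<Sum>x\<in>insert n N. (if x = n then 1 else 0) * (\<Sum>y\<in>insert n N. A x y * (if y = n then 1 else 0))) > 0"
    by (rule insert.prems) auto
  then have Ann: "A n n > 0"
    using insert.hyps by (simp add: if_distrib[of "\<lambda>t. _ * t"] if_distrib[of "\<lambda>t. t * _"] cong: if_cong)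
  define A' where "A' x y = A x y - A x n * A n y / A n n" for x y
  have split: "(\<Sum>y\<in>insert n N. A x y * (c(n := t)) y) = A x n * t + (\<Sum>y\<in>N. A x y * c y)" for x t and c :: "'n \<Rightarrow> real"
  proof -
    have "(\<Sum>y\<in>N. A x y * (c(n := t)) y) = (\<Sum>y\<in>N. A x y * c y)"
      using insert.hyps by (intro sum.cong) auto
    then show ?thesis using insert.hyps by simp
  qed
  have A': "(\<Sum>y\<in>N. A' x y * c y) = (\<Sum>y\<in>N. A x y * c y) - A x n / A n n * (\<Sum>y\<in>N. A n y * c y)" for x and c :: "'n \<Rightarrow> real"
    by (simp add: A'_def left_diff_distrib sum_subtractf sum_distrib_left mult.assoc)
  have "(\<Sum>x\<in>N. c x * (\<Sum>y\<in>N. A' x y * c y)) > 0" if c: "\<exists>x\<in>N. c x \<noteq> 0" for c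
  proof -
    define t where "t = - (\<Sum>y\<in>N. A n y * c y) / A n n"
    have *: "(\<Sum>y\<in>insert n N. A x y * (c(n := t)) y) = (\<Sum>y\<in>N. A' x y * c y)" for x
      unfolding split A' by (simp add: t_def)
    have "(\<Sum>y\<in>insert n N. A n y * (c(n := t)) y) = 0"
      unfolding split using Ann by (simp add: t_def)
    then have "(\<Sum>x\<in>insert n N. (c(n := t)) x * (\<Sum>y\<in>insert n N. A x y * (c(n := t)) y))
        = (\<Sum>x\<in>N. (c(n := t)) x * (\<Sum>y\<in>insert n N. A x y * (c(n := t)) y))"
      using insert.hyps by simp
    also have "\<dots> = (\<Sum>x\<in>N. c x * (\<Sum>y\<in>N. A' x y * c y))"
      unfolding * using insert.hyps by (intro sum.cong) auto
    finally have **: "(\<Sum>x\<in>insert n N. (c(n := t)) x * (\<Sum>y\<in>insert n N. A x y * (c(n := t)) y))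
        = (\<Sum>x\<in>N. c x * (\<Sum>y\<in>N. A' x y * c y))" .
    have "\<exists>x\<in>insert n N. (c(n := t)) x \<noteq> 0"
      using c insert.hyps by auto
    from insert.prems[OF this] show ?thesis
      unfolding ** .
  qed
  from insert.IH[OF this, of "\<lambda>x. b x - A x n * b n / A n n"]
  obtain c where c: "\<And>x. x \<in> N \<Longrightarrow> (\<Sum>y\<in>N. A' x y * c y) = b x - A x n * b n / A n n"
    by blast
  define t where "t = (b n - (\<Sum>y\<in>N. A n y * c y)) / A n n"
  have "(\<Sum>y\<in>insert n N. A x y * (c(n := t)) y) = b x" if "x \<in> insert n N" for x
  proof (cases "x = n")
    case True
    then show ?thesis unfolding split using Ann by (simp add: t_def)
  next
    case False
    with that c[of x] have "(\<Sum>y\<in>N. A x y * c y) = b x - A x n * b n / A n n + A x n / A n n * (\<Sum>y\<in>N. A n y * c y)"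
      by (simp add: A')
    then show ?thesis unfolding split using Ann by (simp add: t_def diff_divide_distrib right_diff_distrib)
  qed
  then show ?case by blast
qed simp

section \<open>Barycentric coordinates of a tetrahedron\<close>

text \<open>Gradient and constant term of the affine function that is 1 at the vertex \<open>v\<close> and 0 at the other
  vertices.\<close>

definition bary_coeffs :: "(real^3) set \<Rightarrow> real^3 \<Rightarrow> (real^3) \<times> real" where
  "bary_coeffs T v = (SOME gb. \<forall>u \<in> vertices T. fst gb \<bullet> u + snd gb = (if u = v then 1 else 0))"

definition bgrad :: "(real^3) set \<Rightarrow> real^3 \<Rightarrow> real^3" where
  "bgrad T v = fst (bary_coeffs T v)"

definition bary :: "(real^3) set \<Rightarrow> real^3 \<Rightarrow> real^3 \<Rightarrow> real" where
  "bary T v x = bgrad T v \<bullet> x + snd (bary_coeffs T v)"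

lemma bary_diff: "bary T v x - bary T v y = bgrad T v \<bullet> (x - y)"
  by (simp add: bary_def inner_diff_right)

lemma vertices_convex_hull: "\<not> affine_dependent c \<Longrightarrow> vertices (convex hull c) = c"
  by (auto simp: vertices_def extreme_point_of_convex_hull_affine_independent)

locale tetrahedron =
  fixes T :: "(real^3) set"
  assumes simplex: "3 simplex T"
begin

abbreviation "C \<equiv> vertices T"

lemma vertices_props:
  "\<not> affine_dependent C" "finite C" "card C = 4" "convex hull C = T" "C \<subseteq> T"
proof -
  obtain c where c: "\<not> affine_dependent c" "int (card c) = 3 + 1" "T = convex hull c"
    using simplex unfolding simplex_def by blast
  then have "C = c" by (simp add: vertices_convex_hull)
  with c show "\<not> affine_dependent C" "finite C" "card C = 4" "convex hull C = T"
    by (auto intro: aff_independent_finite)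
  then show "C \<subseteq> T" by (metis hull_subset)
qed

lemma convex_T: "convex T" and compact_T: "compact T" and T_nonempty: "T \<noteq> {}"
proof -
  show "convex T" using vertices_props(4) by (metis convex_convex_hull)
  show "compact T" using vertices_props(2,4) by (metis finite_imp_compact_convex_hull)
  show "T \<noteq> {}" using vertices_props(3,4) by auto
qed

text \<open>The functional that is 1 on \<open>v - v0\<close> and 0 on the other edge vectors issuing from a vertex \<open>v0\<close> exists
  because these vectors are linearly independent.\<close>

lemma bary_vertex:
  assumes v: "v \<in> C" and u: "u \<in> C"
  shows "bary T v u = (if u = v then 1 else 0)"
proof -
  have "C - {v} \<noteq> {}"
    using vertices_props(3) card_le_Suc0_iff_eq[OF vertices_props(2)] by auto
  then obtain v0 where v0: "v0 \<in> C" "v0 \<noteq> v" by blast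
  define B where "B = (\<lambda>x. - v0 + x) ` (C - {v0})"
  have "independent B"
    unfolding B_def using vertices_props(1) affine_dependent_iff_dependent2[OF v0(1)] by simp
  from linear_independent_extend[OF this, of "\<lambda>x. if x = v - v0 then 1 else (0::real)"]
  obtain f where f: "linear f" "\<And>x. x \<in> B \<Longrightarrow> f x = (if x = v - v0 then 1 else (0::real))"
    by auto
  have ff: "f x = adjoint f 1 \<bullet> x" for x
    using adjoint_works[OF f(1), of x 1] by (simp add: inner_commute)
  have "adjoint f 1 \<bullet> w + - (adjoint f 1 \<bullet> v0) = (if w = v then 1 else 0)" if "w \<in> C" for w
  proof (cases "w = v0")
    case True then show ?thesis using v0 by simp
  next
    case False
    then have "f (w - v0) = (if w - v0 = v - v0 then 1 else 0)"
      using that by (intro f(2)) (auto simp: B_def)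
    then show ?thesis using ff[of "w - v0"] by (simp add: inner_diff_right)
  qed
  then have "\<exists>gb. \<forall>u \<in> vertices T. fst gb \<bullet> u + snd gb = (if u = v then 1 else 0)"
    by (intro exI[of _ "(adjoint f 1, - (adjoint f 1 \<bullet> v0))"]) simp
  then have "\<forall>u \<in> vertices T. fst (bary_coeffs T v) \<bullet> u + snd (bary_coeffs T v) = (if u = v then 1 else 0)"
    unfolding bary_coeffs_def by (rule someI_ex)
  with u show ?thesis
    unfolding bary_def bgrad_def by (rule bspec[rotated])
qed

lemma bary_combination:
  assumes "v \<in> C" "sum c C = 1"
  shows "bary T v (\<Sum>u\<in>C. c u *\<^sub>R u) = c v"
proof -
  have "bary T v (\<Sum>u\<in>C. c u *\<^sub>R u) = (\<Sum>u\<in>C. c u * (bgrad T v \<bullet> u)) + (\<Sum>u\<in>C. c u) * snd (bary_coeffs T v)"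
    using assms(2) by (simp add: bary_def inner_sum_right)
  also have "\<dots> = (\<Sum>u\<in>C. c u * bary T v u)"
    by (simp add: bary_def sum_distrib_right sum.distrib distrib_left)
  also have "\<dots> = (\<Sum>u\<in>C. if u = v then c u else 0)"
    using assms(1) by (intro sum.cong) (auto simp: bary_vertex)
  finally show ?thesis
    using assms(1) vertices_props(2) by simp
qed

lemma bary_expansion: "(\<Sum>v\<in>C. bary T v x) = 1" "(\<Sum>v\<in>C. bary T v x *\<^sub>R v) = x"
proof -
  have "aff_dim C = 3"
    using aff_dim_affine_independent[OF vertices_props(1)] vertices_props(3) by simp
  then have "affine hull C = UNIV"
    using aff_dim_eq_full[of C] by simp
  then have "x \<in> affine hull C" by simp
  then have "\<exists>c. sum c C = 1 \<and> (\<Sum>v\<in>C. c v *\<^sub>R v) = x"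
    unfolding affine_hull_finite[OF vertices_props(2)] by simp
  then obtain c where c: "sum c C = 1" "(\<Sum>v\<in>C. c v *\<^sub>R v) = x"
    by metis
  then have "bary T v x = c v" if "v \<in> C" for v
    using bary_combination[OF that c(1)] by simp
  with c show "(\<Sum>v\<in>C. bary T v x) = 1" "(\<Sum>v\<in>C. bary T v x *\<^sub>R v) = x"
    by simp_all
qed

lemma mem_iff_combination:
  "x \<in> T \<longleftrightarrow> (\<exists>c. (\<forall>v\<in>C. 0 \<le> c v) \<and> sum c C = 1 \<and> (\<Sum>v\<in>C. c v *\<^sub>R v) = x)"
proof -
  have "T = {y. \<exists>c. (\<forall>v\<in>C. 0 \<le> c v) \<and> sum c C = 1 \<and> (\<Sum>v\<in>C. c v *\<^sub>R v) = y}"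
    using convex_hull_finite[OF vertices_props(2)] by (simp add: vertices_props(4))
  then show ?thesis by blast
qed

lemma mem_iff_bary: "x \<in> T \<longleftrightarrow> (\<forall>v\<in>C. 0 \<le> bary T v x)"
proof
  assume "x \<in> T"
  then obtain c where c: "\<And>v. v \<in> C \<Longrightarrow> 0 \<le> c v" "sum c C = 1" "(\<Sum>v\<in>C. c v *\<^sub>R v) = x"
    unfolding mem_iff_combination by blast
  then show "\<forall>v\<in>C. 0 \<le> bary T v x"
    using bary_combination[OF _ c(2)] by auto
next
  assume "\<forall>v\<in>C. 0 \<le> bary T v x"
  then show "x \<in> T"
    unfolding mem_iff_combination using bary_expansion[of x] by (intro exI[of _ "\<lambda>v. bary T v x"]) simp
qed

lemma bary_le_1: "x \<in> T \<Longrightarrow> v \<in> C \<Longrightarrow> bary T v x \<le> 1"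
  using bary_expansion(1)[of x] member_le_sum[of v C "\<lambda>v. bary T v x"] vertices_props(2) mem_iff_bary
  by auto

lemma interior_if_bary_pos:
  assumes "\<forall>v\<in>C. 0 < bary T v x"
  shows "x \<in> interior T"
proof (rule interiorI)
  have "open {y. 0 < bary T v y}" for v
    unfolding bary_def by (intro open_Collect_less continuous_intros)
  then show "open (\<Inter>v\<in>C. {y. 0 < bary T v y})"
    using vertices_props(2) by blast
  show "x \<in> (\<Inter>v\<in>C. {y. 0 < bary T v y})" using assms by simp
  show "(\<Inter>v\<in>C. {y. 0 < bary T v y}) \<subseteq> T"
    using mem_iff_bary by (force intro: less_imp_le)
qed

lemma interior_nonempty: "interior T \<noteq> {}"
proof -
  have "\<forall>v\<in>C. 0 < bary T v (\<Sum>u\<in>C. (1/4) *\<^sub>R u)"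
  proof
    fix v assume v: "v \<in> C"
    have "bary T v (\<Sum>u\<in>C. (1/4) *\<^sub>R u) = 1/4"
      using bary_combination[OF v, of "\<lambda>_. 1/4"] vertices_props(3) by simp
    then show "0 < bary T v (\<Sum>u\<in>C. (1/4) *\<^sub>R u)"
      by linarith
  qed
  from interior_if_bary_pos[OF this] show ?thesis
    by blast
qed

lemma bgrad_expansion: "(\<Sum>v\<in>C. (bgrad T v \<bullet> d) *\<^sub>R (v - a)) = d"
proof -
  have "d = (\<Sum>v\<in>C. bary T v d *\<^sub>R v) - (\<Sum>v\<in>C. bary T v 0 *\<^sub>R v)"
    by (simp add: bary_expansion)
  also have "\<dots> = (\<Sum>v\<in>C. (bgrad T v \<bullet> d) *\<^sub>R v)"
    by (simp add: sum_subtractf[symmetric] scaleR_diff_left[symmetric] bary_diff)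
  finally have 1: "d = (\<Sum>v\<in>C. (bgrad T v \<bullet> d) *\<^sub>R v)" .
  have "(\<Sum>v\<in>C. bgrad T v \<bullet> d) = (\<Sum>v\<in>C. bary T v d) - (\<Sum>v\<in>C. bary T v 0)"
    by (simp add: sum_subtractf[symmetric] bary_diff)
  then have 2: "(\<Sum>v\<in>C. bgrad T v \<bullet> d) = 0"
    by (simp add: bary_expansion)
  show ?thesis
    using 1 2 by (simp add: scaleR_diff_right sum_subtractf scaleR_sum_left[symmetric])
qed

text \<open>The gradients of the barycentric coordinates and the edge vectors issuing from \<open>a\<close> are dual bases.
  Therefore a vector that is almost orthogonal to the edges of a face is almost parallel to the gradient
  attached to the opposite vertex; this is how a boundary face is compared with the normal of the
  boundary.\<close>

lemma dual_expansion: "(\<Sum>v\<in>C. (n \<bullet> (v - a)) *\<^sub>R bgrad T v) = n"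
proof (rule vector_eq_ldot[THEN iffD1], rule allI)
  fix d
  have "n \<bullet> d = n \<bullet> (\<Sum>v\<in>C. (bgrad T v \<bullet> d) *\<^sub>R (v - a))"
    by (simp only: bgrad_expansion)
  also have "\<dots> = (\<Sum>v\<in>C. (n \<bullet> (v - a)) *\<^sub>R bgrad T v) \<bullet> d"
    by (simp add: inner_sum_right inner_sum_left mult.commute)
  finally show "d \<bullet> (\<Sum>v\<in>C. (n \<bullet> (v - a)) *\<^sub>R bgrad T v) = d \<bullet> n"
    by (simp add: inner_commute)
qed

lemma diameter_pos: "0 < diameter T"
proof -
  obtain a b where ab: "a \<in> C" "b \<in> C" "a \<noteq> b"
    using vertices_props(3) card_le_Suc0_iff_eq[OF vertices_props(2)] by auto
  then have "dist a b \<le> diameter T"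
    using vertices_props(5) compact_T by (intro diameter_bounded_bound compact_imp_bounded) auto
  with ab show ?thesis by (metis dist_pos_lt order_less_le_trans)
qed

lemma dist_le_diameter: "x \<in> T \<Longrightarrow> y \<in> T \<Longrightarrow> norm (x - y) \<le> diameter T"
  using diameter_bounded_bound[OF compact_imp_bounded[OF compact_T], of x y] by (simp add: dist_norm)

lemma face_subset_vertices:
  assumes "s face_of T"
  obtains c where "c \<subseteq> C" "s = convex hull c" "vertices s = c" "\<not> affine_dependent c"
proof -
  obtain c where c: "c \<subseteq> C" "s = convex hull c"
    using face_of_convex_hull_affine_independent[OF vertices_props(1), of s] assms vertices_props(4) by auto
  moreover have "\<not> affine_dependent c"
    using c(1) vertices_props(1) affine_independent_subset by blast
  ultimately show ?thesis
    using that vertices_convex_hull by blast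
qed

lemma face_of_iff: "s face_of T \<longleftrightarrow> (\<exists>c\<subseteq>C. s = convex hull c)"
  using face_of_convex_hull_affine_independent[OF vertices_props(1), of s] vertices_props(4) by auto

lemma mem_hull_iff_bary:
  assumes "c \<subseteq> C"
  shows "x \<in> convex hull c \<longleftrightarrow> x \<in> T \<and> (\<forall>v\<in>C - c. bary T v x = 0)"
proof
  have fc: "finite c" using assms vertices_props(2) by (rule finite_subset)
  assume "x \<in> convex hull c"
  then obtain u where u: "\<And>v. v \<in> c \<Longrightarrow> 0 \<le> u v" "sum u c = 1" "(\<Sum>v\<in>c. u v *\<^sub>R v) = x"
    unfolding convex_hull_finite[OF fc] by blast
  define w where "w v = (if v \<in> c then u v else 0)" for v
  have w0: "w v = 0" if "v \<in> C - c" for v using that by (simp add: w_def)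
  have "sum w C = sum w c" "(\<Sum>v\<in>C. w v *\<^sub>R v) = (\<Sum>v\<in>c. w v *\<^sub>R v)"
    using assms vertices_props(2) by (auto intro!: sum.mono_neutral_right simp: w0)
  then have "sum w C = 1" "(\<Sum>v\<in>C. w v *\<^sub>R v) = x"
    using u by (simp_all add: w_def)
  then have "bary T v x = w v" if "v \<in> C" for v
    using bary_combination[OF that] by blast
  then show "x \<in> T \<and> (\<forall>v\<in>C - c. bary T v x = 0)"
    using mem_iff_bary u(1) by (auto simp: w_def)
next
  have fc: "finite c" using assms vertices_props(2) by (rule finite_subset)
  assume a: "x \<in> T \<and> (\<forall>v\<in>C - c. bary T v x = 0)"
  have "sum (\<lambda>v. bary T v x) C = sum (\<lambda>v. bary T v x) c" "(\<Sum>v\<in>C. bary T v x *\<^sub>R v) = (\<Sum>v\<in>c. bary T v x *\<^sub>R v)"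
    using assms vertices_props(2) a by (auto intro!: sum.mono_neutral_right)
  then show "x \<in> convex hull c"
    unfolding convex_hull_finite[OF fc] using bary_expansion[of x] a mem_iff_bary assms
    by (intro CollectI exI[of _ "\<lambda>v. bary T v x"]) auto
qed

end

section \<open>Lagrange interpolation on a tetrahedron\<close>

context tetrahedron begin

text \<open>The factor of \<open>v\<close> vanishes at the nodes whose index at \<open>v\<close> is less than \<open>m v\<close>. If \<open>m\<close> is the index of
  a node, this is a multiple of the Lagrange basis function of that node; the other \<open>m\<close> serve to show
  that interpolation is exact.\<close>

definition falling :: "nat \<Rightarrow> (real^3 \<Rightarrow> nat) \<Rightarrow> real^3 \<Rightarrow> real" where
  "falling k m z = (\<Prod>v\<in>C. \<Prod>j<m v. real k * bary T v z - real j)"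

text \<open>The floor is only there to obtain a natural number: at lattice points \<open>k * bary T v x\<close> is one.\<close>

definition node_index :: "nat \<Rightarrow> real^3 \<Rightarrow> real^3 \<Rightarrow> nat" where
  "node_index k x v = nat \<lfloor>real k * bary T v x\<rfloor>"

definition lagrange :: "nat \<Rightarrow> real^3 \<Rightarrow> real^3 \<Rightarrow> real" where
  "lagrange k x z = falling k (node_index k x) z / falling k (node_index k x) x"

lemma lattice_iff:
  assumes "k > 0"
  shows "x \<in> lattice_points k T \<longleftrightarrow> (\<exists>m. sum m C = k \<and> (\<forall>v\<in>C. real k * bary T v x = real (m v)))"
proof
  assume "x \<in> lattice_points k T"
  then obtain m where m: "x = (\<Sum>v\<in>C. (real (m v) / real k) *\<^sub>R v)" "sum m C = k"
    unfolding lattice_points_def by blast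
  have "(\<Sum>v\<in>C. real (m v) / real k) = 1"
    using m(2) assms by (simp add: sum_divide_distrib[symmetric] of_nat_sum[symmetric] del: of_nat_sum)
  then have "\<forall>v\<in>C. real k * bary T v x = real (m v)"
    using bary_combination assms m(1) by simp
  with m(2) show "\<exists>m. sum m C = k \<and> (\<forall>v\<in>C. real k * bary T v x = real (m v))"
    by blast
next
  assume "\<exists>m. sum m C = k \<and> (\<forall>v\<in>C. real k * bary T v x = real (m v))"
  then obtain m where m: "sum m C = k" "\<forall>v\<in>C. real k * bary T v x = real (m v)"
    by blast
  have "x = (\<Sum>v\<in>C. bary T v x *\<^sub>R v)"
    by (simp add: bary_expansion)
  also have "\<dots> = (\<Sum>v\<in>C. (real (m v) / real k) *\<^sub>R v)"
    using m(2) assms by (intro sum.cong) (auto simp: field_simps)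
  finally show "x \<in> lattice_points k T"
    unfolding lattice_points_def using m(1) by blast
qed

lemma node_index_props:
  assumes "k > 0" "x \<in> lattice_points k T"
  shows "sum (node_index k x) C = k" "\<And>v. v \<in> C \<Longrightarrow> real k * bary T v x = real (node_index k x v)"
    "\<And>v. v \<in> C \<Longrightarrow> node_index k x v \<le> k"
proof -
  obtain m where m: "sum m C = k" "\<forall>v\<in>C. real k * bary T v x = real (m v)"
    using assms lattice_iff by blast
  then have "node_index k x v = m v" if "v \<in> C" for v
    using that by (simp add: node_index_def)
  with m show 1: "sum (node_index k x) C = k" and "\<And>v. v \<in> C \<Longrightarrow> real k * bary T v x = real (node_index k x v)"
    by simp_all
  show "node_index k x v \<le> k" if "v \<in> C" for v
    using member_le_sum[of v C "node_index k x"] 1 that vertices_props(2) by simp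
qed

lemma bary_eqD:
  assumes "\<And>v. v \<in> C \<Longrightarrow> bary T v x = bary T v y"
  shows "x = y"
proof -
  have "(\<Sum>v\<in>C. bary T v x *\<^sub>R v) = (\<Sum>v\<in>C. bary T v y *\<^sub>R v)"
    using assms by (intro sum.cong) auto
  then show ?thesis by (simp only: bary_expansion)
qed

lemma lattice_subset: assumes "k > 0" shows "lattice_points k T \<subseteq> T"
proof
  fix x assume x: "x \<in> lattice_points k T"
  have "0 \<le> bary T v x" if "v \<in> C" for v
    using node_index_props(2)[OF assms x that] assms by (metis of_nat_0_le_iff of_nat_0_less_iff zero_le_mult_iff not_less)
  then show "x \<in> T" by (simp add: mem_iff_bary)
qed

lemma lattice_finite: assumes "k > 0"
  shows "finite (lattice_points k T)" and "card (lattice_points k T) \<le> (k + 1) ^ 4"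
proof -
  let ?f = "\<lambda>x. restrict (node_index k x) C"
  have inj: "inj_on ?f (lattice_points k T)"
  proof (rule inj_onI)
    fix x y assume xy: "x \<in> lattice_points k T" "y \<in> lattice_points k T" "?f x = ?f y"
    have "bary T v x = bary T v y" if v: "v \<in> C" for v
    proof -
      have "node_index k x v = node_index k y v"
        using fun_cong[OF xy(3), of v] v by simp
      then have "real k * bary T v x = real k * bary T v y"
        using node_index_props(2)[OF assms xy(1) v] node_index_props(2)[OF assms xy(2) v] by simp
      then show ?thesis using assms by simp
    qed
    then show "x = y" by (rule bary_eqD)
  qed
  have sub: "?f ` lattice_points k T \<subseteq> C \<rightarrow>\<^sub>E {..k}"
    using node_index_props(3)[OF assms] by auto
  have fin: "finite (C \<rightarrow>\<^sub>E {..k})" and card: "card (C \<rightarrow>\<^sub>E {..k}) = (k + 1) ^ 4"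
    using vertices_props by (auto simp: card_PiE intro!: finite_PiE)
  show "finite (lattice_points k T)"
    using inj sub fin by (metis finite_imageD finite_subset)
  show "card (lattice_points k T) \<le> (k + 1) ^ 4"
    using card_inj_on_le[OF inj sub fin] card by simp
qed

lemma vertices_lattice: assumes "k > 0" shows "C \<subseteq> lattice_points k T"
proof
  fix u assume u: "u \<in> C"
  have "sum (\<lambda>v. if v = u then k else 0) C = k"
    using u vertices_props(2) by simp
  then show "u \<in> lattice_points k T"
    unfolding lattice_iff[OF assms] using u
    by (intro exI[of _ "\<lambda>v. if v = u then k else 0"]) (auto simp: bary_vertex)
qed

lemma falling_node_pos:
  assumes "k > 0" "x \<in> lattice_points k T"
  shows "falling k (node_index k x) x > 0"
  unfolding falling_def using node_index_props(2)[OF assms] by (intro prod_pos) auto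

lemma falling_zero:
  assumes "k > 0" "y \<in> lattice_points k T" "v \<in> C" "node_index k y v < m v"
  shows "falling k m y = 0"
proof -
  have "(\<Prod>j<m v. real k * bary T v y - real j) = 0"
    using assms node_index_props(2)[OF assms(1-3)] by (auto simp: prod_zero_iff)
  then show ?thesis
    unfolding falling_def using vertices_props(2) assms(3) by (auto simp: prod_zero_iff)
qed

text \<open>Two distinct indices of sum \<open>k\<close> differ, so one of the entries of \<open>node_index k y\<close> is smaller than that
  of \<open>m\<close>.\<close>

lemma falling_other_node:
  assumes "k > 0" "y \<in> lattice_points k T" "sum m C = k" "\<exists>v\<in>C. node_index k y v \<noteq> m v"
  shows "falling k m y = 0"
proof -
  have "\<exists>v\<in>C. node_index k y v < m v"
  proof (rule ccontr)
    assume "\<not> ?thesis"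
    then have ge: "\<forall>v\<in>C. m v \<le> node_index k y v" by auto
    with assms(4) have "\<exists>v\<in>C. m v < node_index k y v" by force
    then have "sum m C < sum (node_index k y) C"
      using ge vertices_props(2) by (intro sum_strict_mono_ex1) auto
    then show False
      using assms(3) node_index_props(1)[OF assms(1,2)] by simp
  qed
  then show ?thesis using falling_zero[OF assms(1,2)] by blast
qed

lemma lagrange_node:
  assumes "k > 0" "x \<in> lattice_points k T" "y \<in> lattice_points k T"
  shows "lagrange k x y = (if x = y then 1 else 0)"
proof (cases "x = y")
  case True
  then show ?thesis using falling_node_pos[OF assms(1,2)] by (simp add: lagrange_def)
next
  case False
  have "\<exists>v\<in>C. node_index k y v \<noteq> node_index k x v"
  proof (rule ccontr)
    assume "\<not> ?thesis"
    then have "real k * bary T v x = real k * bary T v y" if "v \<in> C" for v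
      using node_index_props(2)[OF assms(1,2) that] node_index_props(2)[OF assms(1,3) that] that by simp
    then have "x = y" using assms(1) by (intro bary_eqD) auto
    with False show False by simp
  qed
  with falling_other_node[OF assms(1,3)] node_index_props(1)[OF assms(1,2)] False
  show ?thesis by (simp add: lagrange_def)
qed

text \<open>Indexes the affine factors of a Lagrange basis function; as the indices of a node add up to \<open>k\<close>, there are
  exactly \<open>k\<close> of them.\<close>

definition factors :: "nat \<Rightarrow> real^3 \<Rightarrow> ((real^3) \<times> nat) set" where
  "factors k x = (SIGMA v:C. {..<node_index k x v})"

definition factor_grad :: "nat \<Rightarrow> real^3 \<Rightarrow> ((real^3) \<times> nat) \<Rightarrow> real^3" where
  "factor_grad k x vj = (real k / (real (node_index k x (fst vj)) - real (snd vj))) *\<^sub>R bgrad T (fst vj)"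

definition factor_off :: "nat \<Rightarrow> real^3 \<Rightarrow> ((real^3) \<times> nat) \<Rightarrow> real" where
  "factor_off k x vj = (real k * snd (bary_coeffs T (fst vj)) - real (snd vj))
      / (real (node_index k x (fst vj)) - real (snd vj))"

lemma factors_finite: "finite (factors k x)"
  and factors_card: "k > 0 \<Longrightarrow> x \<in> lattice_points k T \<Longrightarrow> card (factors k x) = k"
  using vertices_props(2) node_index_props(1) by (auto simp: factors_def)

lemma factor_eq:
  "factor_grad k x vj \<bullet> z + factor_off k x vj
     = (real k * bary T (fst vj) z - real (snd vj)) / (real (node_index k x (fst vj)) - real (snd vj))"
  by (simp add: factor_grad_def factor_off_def bary_def add_divide_distrib diff_divide_distrib algebra_simps)

lemma lagrange_eq_prod:
  assumes "k > 0" "x \<in> lattice_points k T"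
  shows "lagrange k x = (\<lambda>z. \<Prod>vj\<in>factors k x. factor_grad k x vj \<bullet> z + factor_off k x vj)"
proof
  fix z
  have "lagrange k x z = (\<Prod>v\<in>C. \<Prod>j<node_index k x v.
      (real k * bary T v z - real j) / (real k * bary T v x - real j))"
    by (simp add: lagrange_def falling_def prod_dividef)
  also have "\<dots> = (\<Prod>v\<in>C. \<Prod>j<node_index k x v.
      factor_grad k x (v, j) \<bullet> z + factor_off k x (v, j))"
    by (intro prod.cong refl) (simp add: factor_eq node_index_props(2)[OF assms])
  also have "\<dots> = (\<Prod>vj\<in>factors k x. factor_grad k x vj \<bullet> z + factor_off k x vj)"
    using vertices_props(2) by (simp add: factors_def prod.Sigma case_prod_beta')
  finally show "lagrange k x z = (\<Prod>vj\<in>factors k x. factor_grad k x vj \<bullet> z + factor_off k x vj)" .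
qed

lemma lagrange_in_polys:
  assumes "k > 0" "x \<in> lattice_points k T"
  shows "lagrange k x \<in> polys k"
  unfolding lagrange_eq_prod[OF assms]
  using polys_prod_affine[OF factors_finite, of "factor_grad k x" "factor_off k x" k x]
  by (simp add: factors_card[OF assms])

text \<open>Lagrange interpolation is exact for \<open>p\<close>.\<close>

definition reproduced :: "nat \<Rightarrow> (real^3 \<Rightarrow> real) \<Rightarrow> bool" where
  "reproduced k p \<longleftrightarrow> (\<forall>z. p z = (\<Sum>x\<in>lattice_points k T. p x * lagrange k x z))"

lemma reproduced_sum:
  assumes "\<And>i. i \<in> I \<Longrightarrow> reproduced k (p i)"
  shows "reproduced k (\<lambda>z. \<Sum>i\<in>I. c i * p i z)"
  unfolding reproduced_def
proof
  fix z
  have "(\<Sum>i\<in>I. c i * p i z) = (\<Sum>i\<in>I. c i * (\<Sum>x\<in>lattice_points k T. p i x * lagrange k x z))"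
    using assms by (intro sum.cong) (auto simp: reproduced_def)
  also have "\<dots> = (\<Sum>x\<in>lattice_points k T. (\<Sum>i\<in>I. c i * p i x) * lagrange k x z)"
    by (simp add: sum_distrib_left sum_distrib_right mult.assoc) (rule sum.swap)
  finally show "(\<Sum>i\<in>I. c i * p i z) = (\<Sum>x\<in>lattice_points k T. (\<Sum>i\<in>I. c i * p i x) * lagrange k x z)" .
qed

lemma reproduced_add:
  assumes "reproduced k p" "reproduced k q"
  shows "reproduced k (\<lambda>z. a * p z + b * q z)"
  using reproduced_sum[of "UNIV::bool set" k "\<lambda>i. if i then p else q" "\<lambda>i. if i then a else b"] assms
  by (simp add: UNIV_bool add.commute)

lemma falling_Suc:
  assumes "v \<in> C"
  shows "falling k (m(v := Suc (m v))) z = (real k * bary T v z - real (m v)) * falling k m z"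
proof -
  have *: "(\<Prod>u\<in>C - {v}. \<Prod>j<(m(v := Suc (m v))) u. real k * bary T u z - real j)
      = (\<Prod>u\<in>C - {v}. \<Prod>j<m u. real k * bary T u z - real j)"
    by (intro prod.cong) auto
  show ?thesis
    unfolding falling_def prod.remove[OF vertices_props(2) assms] * by simp
qed

lemma sum_Suc: "v \<in> C \<Longrightarrow> sum (m(v := Suc (m v))) C = Suc (sum m C)"
  for m :: "real^3 \<Rightarrow> nat"
proof -
  assume v: "v \<in> C"
  have "sum (m(v := Suc (m v))) (C - {v}) = sum m (C - {v})"
    by (intro sum.cong) auto
  then show ?thesis
    unfolding sum.remove[OF vertices_props(2) v] by simp
qed

text \<open>For \<open>sum m C = k\<close> the function is a multiple of a basis function. Since the barycentric coordinates add up
  to 1, the sum over \<open>v\<close> of the functions with \<open>m v\<close> increased by one is \<open>k - sum m C\<close> times the given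
  function, which leads from \<open>sum m C = k\<close> down to all smaller sums.\<close>

lemma falling_reproduced:
  assumes "k > 0" "sum m C \<le> k"
  shows "reproduced k (falling k m)"
  using assms(2)
proof (induction "k - sum m C" arbitrary: m)
  case 0
  then have m: "sum m C = k" by simp
  define x where "x = (\<Sum>v\<in>C. (real (m v) / real k) *\<^sub>R v)"
  have x: "x \<in> lattice_points k T"
    unfolding x_def lattice_points_def using m by blast
  have "(\<Sum>v\<in>C. real (m v) / real k) = 1"
    using m assms(1) by (simp add: sum_divide_distrib[symmetric] of_nat_sum[symmetric] del: of_nat_sum)
  then have ind: "node_index k x v = m v" if "v \<in> C" for v
    using bary_combination[OF that] assms(1) by (simp add: node_index_def x_def)
  have eq: "falling k m = falling k (node_index k x)"
    by (rule ext) (simp add: falling_def ind)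
  show ?case
    unfolding reproduced_def
  proof
    fix z
    have "falling k m y * lagrange k y z = (if y = x then falling k m x * lagrange k x z else 0)"
      if y: "y \<in> lattice_points k T" for y
    proof (cases "y = x")
      case False
      have "lagrange k x y = 0" using lagrange_node[OF assms(1) x y] False by simp
      then have "falling k m y = 0"
        using falling_node_pos[OF assms(1) x] by (simp add: lagrange_def eq)
      then show ?thesis using False by simp
    qed simp
    then have "(\<Sum>y\<in>lattice_points k T. falling k m y * lagrange k y z)
        = (\<Sum>y\<in>lattice_points k T. if y = x then falling k m x * lagrange k x z else 0)"
      by (intro sum.cong refl)
    also have "\<dots> = falling k m x * lagrange k x z"
      using lattice_finite(1)[OF assms(1)] x by simp
    also have "\<dots> = falling k m z"
      using falling_node_pos[OF assms(1) x] by (simp add: lagrange_def eq)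
    finally show "falling k m z = (\<Sum>y\<in>lattice_points k T. falling k m y * lagrange k y z)" ..
  qed
next
  case (Suc n)
  have "reproduced k (falling k (m(v := Suc (m v))))" if "v \<in> C" for v
    using Suc.hyps(2) by (intro Suc.hyps(1)) (auto simp: sum_Suc[OF that] simp del: fun_upd_apply)
  then have 1: "reproduced k (\<lambda>z. \<Sum>v\<in>C. (1 / real (k - sum m C)) * falling k (m(v := Suc (m v))) z)"
    by (rule reproduced_sum)
  have lt: "sum m C < k" using Suc.hyps(2) by simp
  define r where "r = real (k - sum m C)"
  have r: "r \<noteq> 0" using lt unfolding r_def by (metis of_nat_eq_0_iff zero_less_diff less_numeral_extra(3))
  have "(\<Sum>v\<in>C. (1 / r) * falling k (m(v := Suc (m v))) z) = falling k m z" for z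
  proof -
    have "(\<Sum>v\<in>C. real k * bary T v z - real (m v)) = r"
      using lt by (simp add: r_def sum_subtractf sum_distrib_left[symmetric] bary_expansion)
    then have "(1 / r) * ((\<Sum>v\<in>C. real k * bary T v z - real (m v)) * falling k m z) = falling k m z"
      using r by simp
    then show ?thesis
      by (simp only: sum_distrib_left sum_distrib_right falling_Suc cong: sum.cong)
  qed
  with 1 show ?case unfolding r_def by simp
qed

text \<open>A coordinate \<open>z $ i\<close> is a combination of the barycentric coordinates, and the product of a barycentric
  coordinate with \<open>falling k m\<close> is a combination of \<open>falling k m\<close> and of the same function with \<open>m v\<close>
  increased. So a factor of the monomial can be traded for an increment of \<open>m\<close>. With \<open>m = 0\<close> this
  covers all polynomials of degree at most \<open>k\<close>.\<close>

lemma monomial_falling_reproduced: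
  assumes "k > 0" "sum m C + (\<Sum>i\<in>UNIV. \<alpha> i) \<le> k"
  shows "reproduced k (\<lambda>z. monomial \<alpha> z * falling k m z)"
  using assms(2)
proof (induction "\<Sum>i\<in>UNIV. \<alpha> i" arbitrary: \<alpha> m)
  case 0
  then have "monomial \<alpha> z = 1" for z by (simp add: monomial_def)
  then have "(\<lambda>z. monomial \<alpha> z * falling k m z) = falling k m"
    by (intro ext) simp
  then show ?case using falling_reproduced[OF assms(1), of m] 0 by (simp only:)
next
  case (Suc n)
  then obtain i where i: "\<alpha> i > 0"
    by (metis gr0I sum.neutral nat.simps(3))
  define \<beta> where "\<beta> = \<alpha>(i := \<alpha> i - 1)"
  have \<alpha>: "\<alpha> = \<beta>(i := Suc (\<beta> i))"
    using i by (auto simp: \<beta>_def)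
  have s: "Suc (\<Sum>i\<in>UNIV. \<beta> i) = (\<Sum>i\<in>UNIV. \<alpha> i)"
    unfolding \<alpha> by (simp add: sum_upd del: fun_upd_apply)
  have 1: "reproduced k (\<lambda>z. monomial \<beta> z * falling k (m(v := Suc (m v))) z)" if "v \<in> C" for v
    using Suc.hyps(2) Suc.prems s by (intro Suc.hyps(1)) (auto simp: sum_Suc[OF that] simp del: fun_upd_apply)
  have 2: "reproduced k (\<lambda>z. monomial \<beta> z * falling k m z)"
    using Suc.hyps(2) Suc.prems s by (intro Suc.hyps(1)) auto
  have "reproduced k (\<lambda>z. \<Sum>v\<in>C. (v $ i / real k) * (1 * (monomial \<beta> z * falling k (m(v := Suc (m v))) z)
          + real (m v) * (monomial \<beta> z * falling k m z)))"
    using 1 2 by (intro reproduced_sum reproduced_add)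
  moreover have "(\<Sum>v\<in>C. (v $ i / real k) * (1 * (monomial \<beta> z * falling k (m(v := Suc (m v))) z)
          + real (m v) * (monomial \<beta> z * falling k m z))) = monomial \<alpha> z * falling k m z" for z
  proof -
    have "(\<Sum>v\<in>C. (v $ i / real k) * (1 * (monomial \<beta> z * falling k (m(v := Suc (m v))) z)
          + real (m v) * (monomial \<beta> z * falling k m z)))
        = (\<Sum>v\<in>C. (bary T v z * v $ i) * (monomial \<beta> z * falling k m z))"
      using assms(1) by (intro sum.cong refl) (simp add: falling_Suc field_simps del: fun_upd_apply)
    also have "\<dots> = (\<Sum>v\<in>C. bary T v z *\<^sub>R v) $ i * (monomial \<beta> z * falling k m z)"
      by (simp add: sum_distrib_right)
    also have "\<dots> = monomial \<alpha> z * falling k m z"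
      unfolding \<alpha> monomial_upd by (simp add: bary_expansion)
    finally show ?thesis .
  qed
  ultimately show ?case by simp
qed

theorem polys_reproduced:
  assumes "k > 0" "p \<in> polys k"
  shows "p z = (\<Sum>x\<in>lattice_points k T. p x * lagrange k x z)"
proof -
  obtain c where c: "p = (\<lambda>x. \<Sum>\<alpha> | (\<Sum>i\<in>UNIV. \<alpha> i) \<le> k. c \<alpha> * monomial \<alpha> x)"
    using assms(2) by (rule polysE)
  have f0: "falling k (\<lambda>v. 0) z = 1" for z by (simp add: falling_def)
  have "reproduced k (monomial \<alpha>)" if "(\<Sum>i\<in>UNIV. \<alpha> i) \<le> k" for \<alpha>
    using monomial_falling_reproduced[OF assms(1), of "\<lambda>v. 0" \<alpha>] that by (simp add: f0)
  then have "reproduced k p"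
    unfolding c by (intro reproduced_sum) simp
  then show ?thesis unfolding reproduced_def by (rule spec)
qed

lemma lattice_face:
  assumes "k > 0" "s face_of T"
  shows "lattice_points k s = lattice_points k T \<inter> s"
proof -
  obtain c where c: "c \<subseteq> C" "s = convex hull c" "vertices s = c"
    using face_subset_vertices[OF assms(2)] by metis
  have fc: "finite c" using c(1) vertices_props(2) by (rule finite_subset)
  have mem: "x \<in> s \<longleftrightarrow> x \<in> T \<and> (\<forall>v\<in>C - c. bary T v x = 0)" for x
    unfolding c(2) by (rule mem_hull_iff_bary[OF c(1)])
  show ?thesis
  proof (intro set_eqI iffI)
    fix x assume "x \<in> lattice_points k s"
    then obtain m where m: "x = (\<Sum>v\<in>c. (real (m v) / real k) *\<^sub>R v)" "sum m c = k"
      unfolding lattice_points_def c(3) by blast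
    define m' where "m' v = (if v \<in> c then m v else 0)" for v
    have m'0: "m' v = 0" if "v \<in> C - c" for v using that by (simp add: m'_def)
    have "(\<Sum>v\<in>C. (real (m' v) / real k) *\<^sub>R v) = (\<Sum>v\<in>c. (real (m' v) / real k) *\<^sub>R v)" "sum m' C = sum m' c"
      using c(1) vertices_props(2) by (auto intro!: sum.mono_neutral_right simp: m'0)
    then have x: "x = (\<Sum>v\<in>C. (real (m' v) / real k) *\<^sub>R v)" and s: "sum m' C = k"
      using m by (simp_all add: m'_def)
    then have xl: "x \<in> lattice_points k T"
      unfolding lattice_points_def by blast
    have "(\<Sum>v\<in>C. real (m' v) / real k) = 1"
      using s assms(1) by (simp add: sum_divide_distrib[symmetric] of_nat_sum[symmetric] del: of_nat_sum)
    then have "bary T v x = 0" if "v \<in> C - c" for v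
      using bary_combination[of v "\<lambda>v. real (m' v) / real k"] that x m'0 by simp
    then show "x \<in> lattice_points k T \<inter> s"
      using xl mem lattice_subset[OF assms(1)] by auto
  next
    fix x assume x: "x \<in> lattice_points k T \<inter> s"
    let ?m = "node_index k x"
    have z: "?m v = 0" if "v \<in> C - c" for v
      using node_index_props(2)[OF assms(1), of x v] x mem that by auto
    have "x = (\<Sum>v\<in>C. bary T v x *\<^sub>R v)" by (simp add: bary_expansion)
    also have "\<dots> = (\<Sum>v\<in>C. (real (?m v) / real k) *\<^sub>R v)"
      using node_index_props(2)[OF assms(1), of x] x assms(1) by (intro sum.cong) (auto simp: field_simps)
    also have "\<dots> = (\<Sum>v\<in>c. (real (?m v) / real k) *\<^sub>R v)"
      using c(1) vertices_props(2) by (intro sum.mono_neutral_right) (auto simp: z)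
    finally have "x = (\<Sum>v\<in>c. (real (?m v) / real k) *\<^sub>R v)" .
    moreover have "sum ?m c = k"
      using node_index_props(1)[OF assms(1), of x] x sum.mono_neutral_right[OF vertices_props(2) c(1), of ?m] z by auto
    ultimately show "x \<in> lattice_points k s"
      unfolding lattice_points_def c(3) by blast
  qed
qed

text \<open>A node outside of the face has a positive index at some vertex \<open>v\<close> outside of the face, so its basis
  function contains the factor \<open>bary T v\<close>, which is zero on the face.\<close>

lemma vanish_on_face:
  assumes "k > 0" "p \<in> polys k" "s face_of T" "\<And>x. x \<in> lattice_points k s \<Longrightarrow> p x = 0" "z \<in> s"
  shows "p z = 0"
proof -
  obtain c where c: "c \<subseteq> C" "s = convex hull c"
    using face_subset_vertices[OF assms(3)] by metis
  have mem: "x \<in> s \<longleftrightarrow> x \<in> T \<and> (\<forall>v\<in>C - c. bary T v x = 0)" for x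
    unfolding c(2) by (rule mem_hull_iff_bary[OF c(1)])
  have "p x * lagrange k x z = 0" if x: "x \<in> lattice_points k T" for x
  proof (cases "x \<in> s")
    case True
    then show ?thesis using assms(4)[of x] x lattice_face[OF assms(1,3)] by simp
  next
    case False
    then obtain v where v: "v \<in> C - c" "bary T v x \<noteq> 0"
      using mem x lattice_subset[OF assms(1)] by blast
    then have "real (node_index k x v) \<noteq> 0"
      using node_index_props(2)[OF assms(1) x, of v] assms(1) by (metis DiffD1 less_numeral_extra(3) mult_eq_0_iff of_nat_eq_0_iff)
    moreover have "bary T v z = 0" using v assms(5) mem by blast
    ultimately have "(\<Prod>j<node_index k x v. real k * bary T v z - real j) = 0"
      by (auto simp: prod_zero_iff intro!: bexI[of _ 0])
    then have "falling k (node_index k x) z = 0"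
      unfolding falling_def using vertices_props(2) v(1) by (auto simp: prod_zero_iff)
    then show ?thesis by (simp add: lagrange_def)
  qed
  then show ?thesis
    unfolding polys_reproduced[OF assms(1,2), of z] by (rule sum.neutral[OF ballI])
qed

end

section \<open>Stability of interpolation at displaced nodes\<close>

text \<open>The basis of the polynomials of degree \<open>k\<close> that is dual to the evaluations at the displaced nodes
  \<open>pt x\<close>; it is indexed by the nodes \<open>x\<close> themselves.\<close>

definition nodal_basis ::
  "nat \<Rightarrow> (real^3) set \<Rightarrow> (real^3 \<Rightarrow> real^3) \<Rightarrow> (real^3 \<Rightarrow> real^3 \<Rightarrow> real) \<Rightarrow> bool" where
  "nodal_basis k X pt B \<longleftrightarrow>
     (\<forall>x\<in>X. B x \<in> polys k \<and> (\<forall>y\<in>X. B x (pt y) = (if x = y then 1 else 0))) \<and>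
     (\<forall>p\<in>polys k. p = (\<lambda>z. \<Sum>x\<in>X. p (pt x) * B x z))"

definition energy :: "(real^3) set \<Rightarrow> (real^3 \<Rightarrow> real) \<Rightarrow> (real^3 \<Rightarrow> real) \<Rightarrow> real" where
  "energy T p q = (LINT z:interior T|lebesgue. grad p z \<bullet> grad q z)"

text \<open>An upper bound of the number of lattice points of a tetrahedron.\<close>

definition node_count :: "nat \<Rightarrow> real" where
  "node_count k = real ((k + 1) ^ 4)"

text \<open>For an element of diameter \<open>h\<close>, this constant divided by \<open>h\<close> bounds the gradients of the basis functions,
  and divided by \<open>h\<^sup>2\<close> the Lipschitz constants of these gradients.\<close>

definition basis_lip :: "nat \<Rightarrow> real \<Rightarrow> real" where
  "basis_lip k \<sigma> = real k ^ 4 * (real k * (1 + \<sigma>)) ^ k * (1 + \<sigma>)\<^sup>2"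

text \<open>Over this fraction of the diameter \<open>h\<close>, the gradient of a polynomial changes by at most half of \<open>D / h\<close>, where
  \<open>D\<close> is the oscillation of the nodal values.\<close>

definition shrink_ratio :: "nat \<Rightarrow> real \<Rightarrow> real" where
  "shrink_ratio k \<sigma> = 1 / (2 * node_count k * basis_lip k \<sigma>)"

text \<open>The displacement of the nodes, relative to the diameter, that interpolation and energy tolerate. The
  powers make the error terms in \<open>displaced_nodal_basis\<close> and in \<open>energy_lower_bound\<close> at most half of the leading
  terms.\<close>

definition node_tol :: "nat \<Rightarrow> real \<Rightarrow> real" where
  "node_tol k \<sigma> = shrink_ratio k \<sigma> ^ 3 / (16 * (node_count k * basis_lip k \<sigma>) ^ 3)"

lemma tolerance_bounds:
  assumes "k > 0" "0 < \<sigma>"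
  shows "1 \<le> node_count k" "1 \<le> basis_lip k \<sigma>" "0 < shrink_ratio k \<sigma>" "shrink_ratio k \<sigma> \<le> 1"
    "0 < node_tol k \<sigma>" "node_tol k \<sigma> \<le> 1"
    "node_count k * (node_count k * basis_lip k \<sigma> * node_tol k \<sigma>) \<le> 1 / 2"
    "node_count k * basis_lip k \<sigma> * node_tol k \<sigma> \<le> 1 / 2"
    "2 * (node_count k * basis_lip k \<sigma>) ^ 3 * node_tol k \<sigma> = shrink_ratio k \<sigma> ^ 3 / 8"
proof -
  show n: "1 \<le> node_count k" by (simp add: node_count_def)
  have k: "1 \<le> real k" using assms(1) by simp
  have ks: "1 \<le> real k * (1 + \<sigma>)"
    using k assms(2) mult_mono[of 1 "real k" 1 "1 + \<sigma>"] by simp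
  have "1 * 1 * 1 \<le> real k ^ 4 * (real k * (1 + \<sigma>)) ^ k * (1 + \<sigma>)\<^sup>2"
    using k ks assms(2) by (intro mult_mono one_le_power) auto
  then show l: "1 \<le> basis_lip k \<sigma>" by (simp add: basis_lip_def)
  define a where "a = node_count k * basis_lip k \<sigma>"
  have a: "1 \<le> a" unfolding a_def using n l mult_mono[of 1 "node_count k" 1 "basis_lip k \<sigma>"] by simp
  have s: "shrink_ratio k \<sigma> = 1 / (2 * a)" by (simp add: shrink_ratio_def a_def mult.assoc)
  show s0: "0 < shrink_ratio k \<sigma>" and s1: "shrink_ratio k \<sigma> \<le> 1"
    using a by (simp_all add: s divide_simps)
  have t: "node_tol k \<sigma> = shrink_ratio k \<sigma> ^ 3 / (16 * a ^ 3)" by (simp add: node_tol_def a_def)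
  show t0: "0 < node_tol k \<sigma>" using s0 a by (simp add: t)
  have a3: "1 \<le> a ^ 3" using a by (rule one_le_power)
  have s3: "shrink_ratio k \<sigma> ^ 3 \<le> 1" using s0 s1 by (intro power_le_one) auto
  have ta: "a ^ 3 * node_tol k \<sigma> = shrink_ratio k \<sigma> ^ 3 / 16"
    using a by (simp add: t)
  have le: "a ^ 3 * node_tol k \<sigma> \<le> 1 / 2" using ta s3 by simp
  have "node_tol k \<sigma> \<le> a ^ 3 * node_tol k \<sigma>" using a3 t0 by simp
  then show "node_tol k \<sigma> \<le> 1" using le by linarith
  have "node_count k \<le> a" using n l unfolding a_def by simp
  then have "node_count k * a \<le> a * a" using a by simp
  also have "\<dots> \<le> a ^ 3" using a by (simp add: power3_eq_cube)
  finally have "node_count k * a * node_tol k \<sigma> \<le> a ^ 3 * node_tol k \<sigma>"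
    using t0 by (intro mult_right_mono) auto
  then show 7: "node_count k * (node_count k * basis_lip k \<sigma> * node_tol k \<sigma>) \<le> 1 / 2"
    using le by (simp add: a_def mult.assoc)
  have "1 * (node_count k * basis_lip k \<sigma> * node_tol k \<sigma>) \<le> node_count k * (node_count k * basis_lip k \<sigma> * node_tol k \<sigma>)"
    using n l t0 by (intro mult_right_mono) auto
  then show "node_count k * basis_lip k \<sigma> * node_tol k \<sigma> \<le> 1 / 2"
    using 7 by linarith
  show "2 * (node_count k * basis_lip k \<sigma>) ^ 3 * node_tol k \<sigma> = shrink_ratio k \<sigma> ^ 3 / 8"
    using ta by (simp add: a_def)
qed

lemma finite_max_attained:
  fixes f :: "'a \<Rightarrow> real"
  assumes "finite X" "X \<noteq> {}"
  obtains x where "x \<in> X" "\<And>y. y \<in> X \<Longrightarrow> f y \<le> f x"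
proof -
  have "Max (f ` X) \<in> f ` X" using assms by (intro Max_in) auto
  then obtain x where "x \<in> X" "f x = Max (f ` X)" by auto
  then show ?thesis using that assms by (metis Max_ge finite_imageI imageI)
qed

locale shape_regular_tetrahedron = tetrahedron +
  fixes \<sigma> :: real
  assumes \<sigma>_ge_1: "1 \<le> \<sigma>" and shape_regular: "diameter T \<le> \<sigma> * inball_diameter T"
begin

lemma \<sigma>_pos: "0 < \<sigma>"
  using \<sigma>_ge_1 by linarith

abbreviation "h \<equiv> diameter T"

text \<open>A barycentric coordinate has its values on \<open>T\<close> between 0 and 1, hence increases by at most 1 along the
  diameter, in the direction of its gradient, of an inscribed ball.\<close>

lemma bgrad_bound:
  assumes v: "v \<in> C"
  shows "norm (bgrad T v) \<le> \<sigma> / h"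
proof -
  let ?g = "bgrad T v" and ?S = "{2 * r | r. 0 \<le> r \<and> (\<exists>c. cball c r \<subseteq> T)}"
  have g: "norm ?g > 0"
  proof (rule ccontr)
    assume "\<not> ?thesis"
    then have eq: "bary T v x = bary T v y" for x y using bary_diff[of T v x y] by simp
    obtain u where "u \<in> C" "u \<noteq> v"
      using vertices_props(3) card_le_Suc0_iff_eq[OF vertices_props(2)] by auto
    then show False using bary_vertex[OF v v] bary_vertex[OF v, of u] eq[of u v] by simp
  qed
  have "s \<le> 1 / norm ?g" if s: "s \<in> ?S" for s
  proof -
    obtain r c where r: "s = 2 * r" "0 \<le> r" "cball c r \<subseteq> T" using s by blast
    let ?d = "(r / norm ?g) *\<^sub>R ?g"
    have "norm ?d \<le> r" using r g by simp
    then have "c + ?d \<in> T" "c - ?d \<in> T"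
      using r(3) by (auto simp: dist_norm)
    then have "bary T v (c + ?d) \<le> 1" "0 \<le> bary T v (c - ?d)"
      using v bary_le_1 mem_iff_bary by auto
    then have "?g \<bullet> (c + ?d - (c - ?d)) \<le> 1"
      using bary_diff[of T v "c + ?d" "c - ?d"] by linarith
    moreover have "c + ?d - (c - ?d) = (2 * r / norm ?g) *\<^sub>R ?g"
      by (simp add: scaleR_add_left[symmetric])
    then have "?g \<bullet> (c + ?d - (c - ?d)) = 2 * r * norm ?g"
      using g by (simp add: power2_norm_eq_inner[symmetric] power2_eq_square)
    ultimately show ?thesis using r(1) g by (simp add: divide_simps)
  qed
  moreover have "?S \<noteq> {}"
  proof -
    obtain c where "c \<in> T" using T_nonempty by blast
    then have "cball c 0 \<subseteq> T" by simp
    then have "2 * 0 \<in> ?S" by blast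
    then show ?thesis by blast
  qed
  ultimately have "inball_diameter T \<le> 1 / norm ?g"
    unfolding inball_diameter_def by (intro cSup_least) auto
  then have "h \<le> \<sigma> * (1 / norm ?g)"
    using shape_regular \<sigma>_pos by (meson mult_left_mono less_imp_le order_trans)
  then show ?thesis
    using g diameter_pos by (simp add: field_simps)
qed

text \<open>Displaced nodes may leave \<open>T\<close>, so the polynomial estimates are needed on a neighbourhood of comparable
  size.\<close>

definition near :: "(real^3) set" where
  "near = {z. \<exists>y\<in>T. norm (z - y) \<le> h}"

lemma T_near: "z \<in> T \<Longrightarrow> z \<in> near"
  unfolding near_def using diameter_pos by (auto intro!: bexI[of _ z])

lemma displaced_near:
  assumes "k > 0" "x \<in> lattice_points k T" "norm (z - x) \<le> node_tol k \<sigma> * h"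
  shows "z \<in> near"
proof -
  have "node_tol k \<sigma> * h \<le> 1 * h"
    using tolerance_bounds(6)[OF assms(1) \<sigma>_pos] diameter_pos by (intro mult_right_mono) auto
  then show ?thesis
    unfolding near_def using assms lattice_subset by (auto intro!: bexI[of _ x])
qed

lemma bary_near:
  assumes "z \<in> near" "v \<in> C"
  shows "-\<sigma> \<le> bary T v z" and "bary T v z \<le> 1 + \<sigma>"
proof -
  obtain y where y: "y \<in> T" "norm (z - y) \<le> h" using assms(1) by (auto simp: near_def)
  have "\<bar>bary T v z - bary T v y\<bar> \<le> norm (bgrad T v) * norm (z - y)"
    unfolding bary_diff by (rule Cauchy_Schwarz_ineq2)
  also have "\<dots> \<le> (\<sigma> / h) * h"
    using bgrad_bound[OF assms(2)] y(2) \<sigma>_pos diameter_pos by (intro mult_mono) auto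
  finally have "\<bar>bary T v z - bary T v y\<bar> \<le> \<sigma>" using diameter_pos by simp
  moreover have "0 \<le> bary T v y" "bary T v y \<le> 1"
    using y(1) mem_iff_bary bary_le_1[OF y(1) assms(2)] assms(2) by auto
  ultimately show "-\<sigma> \<le> bary T v z" "bary T v z \<le> 1 + \<sigma>" by linarith+
qed

lemma lagrange_bounds:
  assumes k: "k > 0" and x: "x \<in> lattice_points k T" and z: "z \<in> near" and z': "z' \<in> near"
  defines "\<Lambda> \<equiv> basis_lip k \<sigma>"
  shows "\<bar>lagrange k x z - lagrange k x z'\<bar> \<le> \<Lambda> / h * norm (z - z')"
    and "norm (grad (lagrange k x) z) \<le> \<Lambda> / h"
    and "norm (grad (lagrange k x) z - grad (lagrange k x) z') \<le> \<Lambda> / h\<^sup>2 * norm (z - z')"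
proof -
  define K where "K = real k * \<sigma> / h"
  define B where "B = real k * (1 + \<sigma>)"
  have k1: "1 \<le> real k" using k by simp
  have K: "0 \<le> K" using \<sigma>_pos diameter_pos by (simp add: K_def)
  have B: "1 \<le> B" unfolding B_def using k1 \<sigma>_pos mult_mono[of 1 "real k" 1 "1 + \<sigma>"] by simp
  have den: "1 \<le> real (node_index k x (fst i)) - real (snd i)" "fst i \<in> C" if "i \<in> factors k x" for i
    using that by (auto simp: factors_def)
  have g: "norm (factor_grad k x i) \<le> K" if i: "i \<in> factors k x" for i
  proof -
    have "norm (factor_grad k x i) = real k / (real (node_index k x (fst i)) - real (snd i)) * norm (bgrad T (fst i))"
      using den(1)[OF i] by (simp add: factor_grad_def)
    also have "\<dots> \<le> real k / 1 * (\<sigma> / h)"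
      using den(1)[OF i] bgrad_bound[OF den(2)[OF i]] by (intro mult_mono divide_left_mono) auto
    finally show ?thesis by (simp add: K_def)
  qed
  have b: "\<bar>factor_grad k x i \<bullet> y + factor_off k x i\<bar> \<le> B" if i: "i \<in> factors k x" and y: "y \<in> near" for i y
  proof -
    let ?d = "real (node_index k x (fst i)) - real (snd i)"
    have "real (snd i) \<le> real k"
      using den(1)[OF i] node_index_props(3)[OF k x den(2)[OF i]] by linarith
    have "\<bar>real k * bary T (fst i) y - real (snd i)\<bar> \<le> B"
    proof -
      have "-\<sigma> \<le> bary T (fst i) y" "bary T (fst i) y \<le> 1 + \<sigma>"
        by (rule bary_near[OF y den(2)[OF i]])+
      then have "real k * (-\<sigma>) \<le> real k * bary T (fst i) y" "real k * bary T (fst i) y \<le> real k * (1 + \<sigma>)"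
        using mult_left_mono[of "-\<sigma>" "bary T (fst i) y" "real k"] mult_left_mono[of "bary T (fst i) y" "1 + \<sigma>" "real k"]
        by auto
      then show ?thesis
        using \<open>real (snd i) \<le> real k\<close> by (simp add: B_def algebra_simps)
    qed
    moreover have "\<bar>factor_grad k x i \<bullet> y + factor_off k x i\<bar> = \<bar>real k * bary T (fst i) y - real (snd i)\<bar> / ?d"
      using den(1)[OF i] by (simp add: factor_eq)
    moreover have "\<bar>real k * bary T (fst i) y - real (snd i)\<bar> / ?d \<le> \<bar>real k * bary T (fst i) y - real (snd i)\<bar>"
      using den(1)[OF i] by (simp add: divide_simps mult_left_le mult_le_cancel_left1)
    ultimately show ?thesis by linarith
  qed
  note bnd = prod_affine_bounds[where I = "factors k x" and a = "factor_grad k x" and b = "factor_off k x",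
      OF factors_finite factors_card[OF k x] B K g b[OF _ z] b[OF _ z'], folded lagrange_eq_prod[OF k x]]
  have B0: "0 \<le> B ^ k" using B by simp
  have le1: "real k * B ^ k * K \<le> \<Lambda> / h"
  proof -
    have "real k * B ^ k * (real k * \<sigma>) \<le> real k ^ 4 * B ^ k * (1 + \<sigma>)\<^sup>2"
    proof -
      have "real k * real k \<le> real k ^ 4"
        using k1 power_increasing[of 2 4 "real k"] by (simp add: power2_eq_square)
      moreover have "\<sigma> \<le> (1 + \<sigma>)\<^sup>2" using \<sigma>_pos by (simp add: power2_eq_square algebra_simps)
      ultimately have "(real k * real k) * B ^ k * \<sigma> \<le> real k ^ 4 * B ^ k * (1 + \<sigma>)\<^sup>2"
        using B0 \<sigma>_pos by (intro mult_mono) auto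
      then show ?thesis by (simp add: mult_ac)
    qed
    then show ?thesis
      using diameter_pos by (simp add: \<Lambda>_def basis_lip_def K_def B_def divide_right_mono)
  qed
  have le2: "real k * real k * B ^ k * K\<^sup>2 \<le> \<Lambda> / h\<^sup>2"
  proof -
    have "\<sigma>\<^sup>2 \<le> (1 + \<sigma>)\<^sup>2" using \<sigma>_pos by (simp add: power_mono)
    then have "real k ^ 4 * B ^ k * \<sigma>\<^sup>2 \<le> real k ^ 4 * B ^ k * (1 + \<sigma>)\<^sup>2"
      using B0 by (intro mult_left_mono) auto
    then have "real k ^ 4 * B ^ k * \<sigma>\<^sup>2 / h\<^sup>2 \<le> \<Lambda> / h\<^sup>2"
      by (simp add: \<Lambda>_def basis_lip_def B_def divide_right_mono)
    moreover have "real k * real k * B ^ k * K\<^sup>2 = real k ^ 4 * B ^ k * \<sigma>\<^sup>2 / h\<^sup>2"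
      by (simp add: K_def power_divide power_mult_distrib power2_eq_square power4_eq_xxxx mult_ac)
    ultimately show ?thesis by simp
  qed
  show "\<bar>lagrange k x z - lagrange k x z'\<bar> \<le> \<Lambda> / h * norm (z - z')"
    using bnd(1) mult_right_mono[OF le1 norm_ge_zero[of "z - z'"]]
    by (simp add: lagrange_eq_prod[OF k x] mult_ac)
  show "norm (grad (lagrange k x) z) \<le> \<Lambda> / h"
    using bnd(2) le1 by simp
  show "norm (grad (lagrange k x) z - grad (lagrange k x) z') \<le> \<Lambda> / h\<^sup>2 * norm (z - z')"
    using bnd(3) mult_right_mono[OF le2 norm_ge_zero[of "z - z'"]] by simp
qed

text \<open>Subtracting the constant \<open>c\<close> changes no difference and no gradient, so the bounds only involve the
  deviation \<open>D\<close> of the nodal values from a constant.\<close>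

lemma poly_bounds:
  assumes k: "k > 0" and p: "p \<in> polys k" and D: "\<And>x. x \<in> lattice_points k T \<Longrightarrow> \<bar>p x - c\<bar> \<le> D"
    and z: "z \<in> near" and z': "z' \<in> near"
  defines "A \<equiv> node_count k * basis_lip k \<sigma>"
  shows "\<bar>p z - p z'\<bar> \<le> A * D / h * norm (z - z')"
    and "norm (grad p z) \<le> A * D / h"
    and "norm (grad p z - grad p z') \<le> A * D / h\<^sup>2 * norm (z - z')"
proof -
  let ?X = "lattice_points k T" and ?\<Lambda> = "basis_lip k \<sigma>"
  have \<Lambda>: "0 \<le> ?\<Lambda>" using tolerance_bounds(2)[OF k \<sigma>_pos] by simp
  obtain x0 where "x0 \<in> ?X" using vertices_lattice[OF k] vertices_props(3) by fastforce
  then have D0: "0 \<le> D" using D[of x0] by linarith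
  have q: "(\<lambda>z. p z - c) \<in> polys k" by (intro polys_diff p polys_const)
  have rep: "p z = c + (\<Sum>x\<in>?X. (p x - c) * lagrange k x z)" for z
    using polys_reproduced[OF k q, of z] by simp
  have gr: "grad p z = (\<Sum>x\<in>?X. (p x - c) *\<^sub>R grad (lagrange k x) z)" for z
  proof -
    have "grad (\<lambda>z. p z - c) z = grad p z"
      using grad_diff_polys[OF p polys_const[of c k], of z] grad_eqI[OF GDERIV_const[of c z]] by simp
    moreover have "(\<lambda>z. p z - c) = (\<lambda>z. \<Sum>x\<in>?X. (p x - c) * lagrange k x z)"
      by (rule ext) (rule polys_reproduced[OF k q])
    then have "grad (\<lambda>z. p z - c) = grad (\<lambda>z. \<Sum>x\<in>?X. (p x - c) * lagrange k x z)"
      by (rule arg_cong)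
    moreover have "\<dots> = (\<lambda>z. \<Sum>x\<in>?X. (p x - c) *\<^sub>R grad (lagrange k x) z)"
      using C1_fun_sum[of ?X "lagrange k" "\<lambda>x. p x - c"] C1_fun_polys lagrange_in_polys[OF k] by blast
    ultimately show ?thesis by simp
  qed
  have card: "real (card ?X) \<le> node_count k"
    unfolding node_count_def using lattice_finite(2)[OF k] of_nat_mono by blast
  have cnt: "real (card ?X) * (D * (?\<Lambda> * r)) \<le> A * D * r" if "0 \<le> r" for r
    using mult_right_mono[OF card, of "D * (?\<Lambda> * r)"] that D0 \<Lambda> by (simp add: A_def mult_ac)
  have "\<bar>p z - p z'\<bar> = \<bar>\<Sum>x\<in>?X. (p x - c) * (lagrange k x z - lagrange k x z')\<bar>"
    unfolding rep[of z] rep[of z'] by (simp add: sum_subtractf right_diff_distrib)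
  also have "\<dots> \<le> (\<Sum>x\<in>?X. D * (?\<Lambda> * (1 / h * norm (z - z'))))"
  proof (rule order_trans[OF sum_abs], rule sum_mono)
    fix x assume x: "x \<in> ?X"
    have "\<bar>(p x - c) * (lagrange k x z - lagrange k x z')\<bar> \<le> D * (?\<Lambda> / h * norm (z - z'))"
      unfolding abs_mult using D[OF x] lagrange_bounds(1)[OF k x z z'] D0 by (intro mult_mono) auto
    then show "\<bar>(p x - c) * (lagrange k x z - lagrange k x z')\<bar> \<le> D * (?\<Lambda> * (1 / h * norm (z - z')))"
      by simp
  qed
  also have "\<dots> \<le> A * D * (1 / h * norm (z - z'))"
    using cnt[of "1 / h * norm (z - z')"] diameter_pos by simp
  finally show "\<bar>p z - p z'\<bar> \<le> A * D / h * norm (z - z')" by simp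
  have "norm (grad p z) \<le> (\<Sum>x\<in>?X. D * (?\<Lambda> * (1 / h)))"
    unfolding gr
  proof (rule sum_norm_le)
    fix x assume x: "x \<in> ?X"
    have "\<bar>p x - c\<bar> * norm (grad (lagrange k x) z) \<le> D * (?\<Lambda> / h)"
      using D[OF x] lagrange_bounds(2)[OF k x z z'] D0 by (intro mult_mono) auto
    then show "norm ((p x - c) *\<^sub>R grad (lagrange k x) z) \<le> D * (?\<Lambda> * (1 / h))"
      by simp
  qed
  also have "\<dots> \<le> A * D * (1 / h)"
    using cnt[of "1 / h"] diameter_pos by simp
  finally show "norm (grad p z) \<le> A * D / h" by simp
  have "norm (grad p z - grad p z') \<le> (\<Sum>x\<in>?X. D * (?\<Lambda> * (1 / h\<^sup>2 * norm (z - z'))))"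
    unfolding gr sum_subtractf[symmetric] scaleR_diff_right[symmetric]
  proof (rule sum_norm_le)
    fix x assume x: "x \<in> ?X"
    have "\<bar>p x - c\<bar> * norm (grad (lagrange k x) z - grad (lagrange k x) z') \<le> D * (?\<Lambda> / h\<^sup>2 * norm (z - z'))"
      using D[OF x] lagrange_bounds(3)[OF k x z z'] D0 by (intro mult_mono) auto
    then show "norm ((p x - c) *\<^sub>R (grad (lagrange k x) z - grad (lagrange k x) z')) \<le> D * (?\<Lambda> * (1 / h\<^sup>2 * norm (z - z')))"
      by simp
  qed
  also have "\<dots> \<le> A * D * (1 / h\<^sup>2 * norm (z - z'))"
    using cnt[of "1 / h\<^sup>2 * norm (z - z')"] by simp
  finally show "norm (grad p z - grad p z') \<le> A * D / h\<^sup>2 * norm (z - z')" by simp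
qed

text \<open>The matrix of the values of the Lagrange basis functions at the displaced nodes is a small perturbation of
  the identity, hence positive definite.\<close>

lemma displaced_nodal_basis:
  assumes k: "k > 0" and pt: "\<And>x. x \<in> lattice_points k T \<Longrightarrow> norm (pt x - x) \<le> node_tol k \<sigma> * h"
  shows "\<exists>B. nodal_basis k (lattice_points k T) pt B"
proof -
  let ?X = "lattice_points k T"
  have fin: "finite ?X" by (rule lattice_finite(1)[OF k])
  have X0: "?X \<noteq> {}" using vertices_lattice[OF k] vertices_props(3) by fastforce
  define comb where "comb c z = (\<Sum>y\<in>?X. c y * lagrange k y z)" for c z
  have comb: "comb c \<in> polys k" for c
    unfolding comb_def[abs_def] by (intro polys_sum lagrange_in_polys[OF k])
  have comb_node: "comb c x = c x" if "x \<in> ?X" for c x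
  proof -
    have "comb c x = (\<Sum>y\<in>?X. if y = x then c y else 0)"
      unfolding comb_def using lagrange_node[OF k _ that] by (intro sum.cong) auto
    then show ?thesis using that fin by simp
  qed
  have pd: "(\<Sum>x\<in>?X. c x * comb c (pt x)) > 0" if c: "\<exists>x\<in>?X. c x \<noteq> 0" for c
  proof -
    obtain x0 where x0: "x0 \<in> ?X" "\<And>y. y \<in> ?X \<Longrightarrow> \<bar>c y\<bar> \<le> \<bar>c x0\<bar>"
      using finite_max_attained[OF fin X0, of "\<lambda>x. \<bar>c x\<bar>"] by metis
    let ?D = "\<bar>c x0\<bar>" and ?a = "node_count k * basis_lip k \<sigma> * node_tol k \<sigma>"
    have D: "0 < ?D" using c x0(2) by fastforce
    have a0: "0 \<le> ?a" using tolerance_bounds[OF k \<sigma>_pos] by simp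
    have r: "\<bar>comb c (pt x) - c x\<bar> \<le> ?a * ?D" if x: "x \<in> ?X" for x
    proof -
      have "\<bar>comb c (pt x) - comb c x\<bar> \<le> node_count k * basis_lip k \<sigma> * ?D / h * norm (pt x - x)"
        by (rule poly_bounds(1)[OF k comb, of c 0])
           (use x0(2) comb_node displaced_near[OF k x pt[OF x]] T_near lattice_subset[OF k] x in auto)
      also have "\<dots> \<le> node_count k * basis_lip k \<sigma> * ?D / h * (node_tol k \<sigma> * h)"
        using pt[OF x] tolerance_bounds[OF k \<sigma>_pos] diameter_pos D by (intro mult_left_mono) auto
      finally show ?thesis using diameter_pos comb_node[OF x] by (simp add: mult_ac)
    qed
    have "(\<Sum>x\<in>?X. c x * comb c (pt x)) = (\<Sum>x\<in>?X. c x * c x) + (\<Sum>x\<in>?X. c x * (comb c (pt x) - c x))"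
      by (simp add: sum.distrib[symmetric] algebra_simps)
    moreover have "c x0 * c x0 \<le> (\<Sum>x\<in>?X. c x * c x)"
      using x0(1) fin by (intro member_le_sum) auto
    moreover have "\<bar>\<Sum>x\<in>?X. c x * (comb c (pt x) - c x)\<bar> \<le> real (card ?X) * (?D * (?a * ?D))"
    proof (rule order_trans[OF sum_abs sum_bounded_above])
      fix x assume x: "x \<in> ?X"
      then show "\<bar>c x * (comb c (pt x) - c x)\<bar> \<le> ?D * (?a * ?D)"
        unfolding abs_mult using x0(2)[OF x] r[OF x] by (intro mult_mono) auto
    qed
    moreover have "real (card ?X) * (?D * (?a * ?D)) \<le> (1/2) * (?D * ?D)"
    proof -
      have "real (card ?X) * ?a \<le> node_count k * ?a"
        using lattice_finite(2)[OF k] a0 unfolding node_count_def by (intro mult_right_mono of_nat_mono) auto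
      then have "real (card ?X) * ?a \<le> 1 / 2"
        using tolerance_bounds(7)[OF k \<sigma>_pos] by linarith
      then have "real (card ?X) * ?a * (?D * ?D) \<le> 1 / 2 * (?D * ?D)"
        by (intro mult_right_mono) auto
      then show ?thesis by (simp add: mult_ac)
    qed
    moreover have "c x0 * c x0 = ?D * ?D" by simp
    moreover have "0 < ?D * ?D" using mult_pos_pos[OF D D] .
    ultimately show ?thesis by linarith
  qed
  have "\<exists>c. \<forall>x\<in>?X. comb c (pt x) = b x" for b
    using pos_def_solvable[OF fin, of "\<lambda>x y. lagrange k y (pt x)" b] pd
    unfolding comb_def by (simp add: mult.commute)
  then have "\<forall>y. \<exists>c. \<forall>x\<in>?X. comb c (pt x) = (if y = x then 1 else 0)"
    by simp
  then obtain c where c: "\<And>x y. x \<in> ?X \<Longrightarrow> comb (c y) (pt x) = (if y = x then 1 else 0)"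
    by metis
  have "p = (\<lambda>z. \<Sum>x\<in>?X. p (pt x) * comb (c x) z)" if p: "p \<in> polys k" for p
  proof -
    define q where "q z = p z - (\<Sum>x\<in>?X. p (pt x) * comb (c x) z)" for z
    have q: "q \<in> polys k" unfolding q_def[abs_def] by (intro polys_diff p polys_sum comb)
    have qc: "q z = comb q z" for z unfolding comb_def by (rule polys_reproduced[OF k q])
    have "comb q (pt x) = 0" if x: "x \<in> ?X" for x
    proof -
      have "(\<Sum>y\<in>?X. p (pt y) * comb (c y) (pt x)) = (\<Sum>y\<in>?X. if y = x then p (pt y) else 0)"
        using c[OF x] by (intro sum.cong) auto
      then show ?thesis using x fin by (simp add: qc[symmetric]) (simp add: q_def)
    qed
    then have "(\<Sum>x\<in>?X. q x * comb q (pt x)) = 0"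
      by simp
    then have "\<forall>x\<in>?X. q x = 0" using pd[of q] by fastforce
    then have "comb q z = 0" for z unfolding comb_def by simp
    then have q0: "q z = 0" for z by (simp add: qc)
    show ?thesis
    proof
      fix z
      show "p z = (\<Sum>x\<in>?X. p (pt x) * comb (c x) z)"
        using q0[of z] unfolding q_def by linarith
    qed
  qed
  then have "nodal_basis k ?X pt (\<lambda>y. comb (c y))"
    unfolding nodal_basis_def using comb c by auto
  then show ?thesis by blast
qed

end

section \<open>Positivity of the local energy\<close>

lemma set_integrable_interior:
  fixes F :: "real^3 \<Rightarrow> real"
  assumes "compact T" "continuous_on UNIV F"
  shows "set_integrable lebesgue (interior T) F"
proof (rule set_integrable_subset)
  have "integrable lborel (\<lambda>x. indicator T x *\<^sub>R F x)"
    using assms continuous_on_subset by (intro borel_integrable_compact) auto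
  then show "set_integrable lebesgue T F"
    unfolding set_integrable_def
    using integrable_completion[OF borel_measurable_integrable] by blast
qed (auto simp: interior_subset)

lemma energy_integrable:
  fixes p q :: "real^3 \<Rightarrow> real"
  assumes "compact T" "C1_fun p" "C1_fun q"
  shows "set_integrable lebesgue (interior T) (\<lambda>z. grad p z \<bullet> grad q z)"
  using assms by (intro set_integrable_interior continuous_intros) (auto simp: C1_fun_def)

text \<open>The differentiability is only required on the segment, since the function whose graph is the boundary is
  controlled only on a part of the plane.\<close>

lemma mean_value_gderiv:
  fixes p :: "'a::real_inner \<Rightarrow> real"
  assumes "\<And>z. z \<in> closed_segment x y \<Longrightarrow> GDERIV p z :> D z"
  obtains z where "z \<in> closed_segment x y" "p y - p x = D z \<bullet> (y - x)"
proof -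
  have seg: "x + t *\<^sub>R (y - x) \<in> closed_segment x y" if "0 \<le> t" "t \<le> 1" for t
    unfolding closed_segment_def using that by (auto intro!: exI[of _ t] simp: algebra_simps)
  have "((\<lambda>t. p (x + t *\<^sub>R (y - x))) has_real_derivative D (x + t *\<^sub>R (y - x)) \<bullet> (y - x)) (at t)"
    if t: "0 \<le> t" "t \<le> 1" for t
  proof -
    have 1: "((\<lambda>t. x + t *\<^sub>R (y - x)) has_derivative (\<lambda>s. s *\<^sub>R (y - x))) (at t)"
      by (auto intro!: derivative_eq_intros)
    have 2: "(p has_derivative (\<lambda>h. h \<bullet> D (x + t *\<^sub>R (y - x)))) (at (x + t *\<^sub>R (y - x)))"
      using assms[OF seg[OF t]] unfolding gderiv_def .
    have "((\<lambda>t. p (x + t *\<^sub>R (y - x))) has_derivative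
        (\<lambda>s. (s *\<^sub>R (y - x)) \<bullet> D (x + t *\<^sub>R (y - x)))) (at t)"
      using has_derivative_compose[OF 1 2] .
    then show ?thesis
      unfolding has_field_derivative_def by (rule has_derivative_eq_rhs) (auto simp: inner_commute)
  qed
  from MVT2[OF zero_less_one this]
  obtain t where t: "0 < t" "t < 1"
    "p (x + 1 *\<^sub>R (y - x)) - p (x + 0 *\<^sub>R (y - x)) = (1 - 0) * (D (x + t *\<^sub>R (y - x)) \<bullet> (y - x))"
    by blast
  then show ?thesis using seg[of t] by (intro that[of "x + t *\<^sub>R (y - x)"]) auto
qed

context shape_regular_tetrahedron begin

text \<open>Between the two nodes \<open>a\<close> and \<open>b\<close> with the most distant values the norm of the gradient somewhere is at
  least \<open>D / h\<close>; its Lipschitz bound extends this, up to a factor 2, to a neighbourhood.\<close>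

lemma steep_near_point:
  assumes k: "k > 0" and v: "v \<in> polys k"
    and osc: "\<And>x y. x \<in> lattice_points k T \<Longrightarrow> y \<in> lattice_points k T \<Longrightarrow> \<bar>v x - v y\<bar> \<le> D"
    and ab: "a \<in> lattice_points k T" "b \<in> lattice_points k T" "\<bar>v a - v b\<bar> = D"
  obtains z0 where "z0 \<in> T"
    "\<And>z. z \<in> T \<Longrightarrow> norm (z - z0) \<le> shrink_ratio k \<sigma> * h \<Longrightarrow> D / (2 * h) \<le> norm (grad v z)"
proof -
  let ?A = "node_count k * basis_lip k \<sigma>"
  have A: "1 \<le> ?A" using tolerance_bounds(1,2)[OF k \<sigma>_pos] mult_mono[of 1 "node_count k" 1 "basis_lip k \<sigma>"] by simp
  have aT: "a \<in> T" "b \<in> T" using ab lattice_subset[OF k] by auto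
  obtain z0 where z0: "z0 \<in> closed_segment a b" "v b - v a = grad v z0 \<bullet> (b - a)"
    using mean_value_gderiv[of a b v "grad v"] C1_fun_gderiv[OF C1_fun_polys[OF v]] by blast
  have z0T: "z0 \<in> T" using z0(1) aT convex_T by (meson closed_segment_subset subsetD)
  have "D = \<bar>grad v z0 \<bullet> (b - a)\<bar>" using ab(3) z0(2) by linarith
  also have "\<dots> \<le> norm (grad v z0) * norm (b - a)" by (rule Cauchy_Schwarz_ineq2)
  also have "\<dots> \<le> norm (grad v z0) * h" using dist_le_diameter[OF aT(2,1)] by (intro mult_left_mono) auto
  finally have g0: "D / h \<le> norm (grad v z0)" using diameter_pos by (simp add: divide_simps)
  have D0: "0 \<le> D" using ab(3) by linarith
  show ?thesis
  proof (rule that[OF z0T])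
    fix z assume z: "z \<in> T" "norm (z - z0) \<le> shrink_ratio k \<sigma> * h"
    have "norm (grad v z - grad v z0) \<le> ?A * D / h\<^sup>2 * norm (z - z0)"
      by (rule poly_bounds(3)[OF k v, of "v a"]) (use osc ab T_near z z0T in auto)
    also have "\<dots> \<le> ?A * D / h\<^sup>2 * (shrink_ratio k \<sigma> * h)"
      using z(2) D0 A by (intro mult_left_mono) auto
    also have "\<dots> = D / (2 * h)"
      using tolerance_bounds(1,2)[OF k \<sigma>_pos] diameter_pos by (simp add: shrink_ratio_def power2_eq_square field_simps)
    finally have "norm (grad v z - grad v z0) \<le> D / (2 * h)" .
    moreover have "norm (grad v z0) \<le> norm (grad v z) + norm (grad v z - grad v z0)"
      by (metis norm_triangle_sub norm_minus_commute add.commute)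
    moreover have "D / h = D / (2 * h) + D / (2 * h)" by (simp add: field_simps)
    ultimately show "D / (2 * h) \<le> norm (grad v z)" using g0 by linarith
  qed
qed

text \<open>The homothety with centre \<open>z0\<close> and ratio \<open>\<delta>\<close> maps the interior of the convex set \<open>T\<close> into the set of points where
  the better bound holds, and it multiplies volumes by \<open>\<delta> ^ 3\<close>.\<close>

lemma integral_lower_bound:
  assumes "z0 \<in> T" "0 < \<delta>" "\<delta> \<le> 1" "0 \<le> c" "continuous_on UNIV F"
    and lb: "\<And>z. z \<in> T \<Longrightarrow> - d \<le> F z"
    and lb': "\<And>z. z \<in> T \<Longrightarrow> norm (z - z0) \<le> \<delta> * h \<Longrightarrow> c - d \<le> F z"
  shows "measure lebesgue (interior T) * (\<delta> ^ 3 * c - d) \<le> (LINT z:interior T|lebesgue. F z)"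
proof -
  let ?I = "interior T"
  define S where "S = (\<lambda>z. \<delta> *\<^sub>R z + (z0 - \<delta> *\<^sub>R z0)) ` ?I"
  have fin: "?I \<in> lmeasurable"
    using compact_T bounded_subset[OF compact_imp_bounded interior_subset] by (intro lmeasurable_open) auto
  have S_eq: "S = (\<lambda>z. (z0 - \<delta> *\<^sub>R z0) + \<delta> *\<^sub>R z) ` ?I" by (auto simp: S_def add.commute)
  have openS: "open S" unfolding S_eq using assms(2) by (intro open_affinity) auto
  have SI: "S \<subseteq> ?I"
  proof
    fix y assume "y \<in> S"
    then obtain z where z: "z \<in> ?I" "y = \<delta> *\<^sub>R z + (z0 - \<delta> *\<^sub>R z0)" by (auto simp: S_def)
    have "z0 - \<delta> *\<^sub>R (z0 - z) \<in> ?I"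
      by (rule mem_interior_convex_shrink[OF convex_T z(1) assms(1-3)])
    moreover have "y = z0 - \<delta> *\<^sub>R (z0 - z)" using z(2) by (simp add: algebra_simps)
    ultimately show "y \<in> ?I" by simp
  qed
  have nS: "norm (y - z0) \<le> \<delta> * h" if y: "y \<in> S" for y
  proof -
    obtain z where z: "z \<in> ?I" "y = \<delta> *\<^sub>R z + (z0 - \<delta> *\<^sub>R z0)" using y unfolding S_def by blast
    have "y - z0 = \<delta> *\<^sub>R (z - z0)" using z(2) by (simp add: algebra_simps)
    then show ?thesis
      using dist_le_diameter[of z z0] z(1) assms(1,2) interior_subset[of T] by (auto intro: mult_left_mono)
  qed
  have Sm: "S \<in> lmeasurable"
    using openS SI fin by (meson fmeasurableI2 lborelD borel_open sets_completionI_sets  sets_lborel)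
  have "measure lebesgue S = \<delta> ^ 3 * measure lebesgue ?I"
    unfolding S_def using measure_lebesgue_affine[of \<delta> "z0 - \<delta> *\<^sub>R z0" ?I] assms(2) by simp
  then have "measure lebesgue ?I * (\<delta> ^ 3 * c - d) = c * measure lebesgue S - d * measure lebesgue ?I"
    by (simp add: algebra_simps)
  also have "\<dots> = (LINT z|lebesgue. c * indicator S z) - (LINT z|lebesgue. d * indicator ?I z)"
    using fin Sm by (simp add: fmeasurable_def)
  also have "\<dots> = (LINT z|lebesgue. c * indicator S z - d * indicator ?I z)"
    using fin Sm by (intro Bochner_Integration.integral_diff[symmetric]) (auto simp: fmeasurable_def)
  also have "\<dots> \<le> (LINT z|lebesgue. indicator ?I z *\<^sub>R F z)"
  proof (rule integral_mono)
    show "integrable lebesgue (\<lambda>z. c * indicator S z - d * indicator ?I z)"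
      using fin Sm by (intro Bochner_Integration.integrable_diff) (auto simp: fmeasurable_def)
    show "integrable lebesgue (\<lambda>z. indicator ?I z *\<^sub>R F z)"
      using set_integrable_interior[OF compact_T assms(5)] unfolding set_integrable_def .
    fix z
    show "c * indicator S z - d * indicator ?I z \<le> indicator ?I z *\<^sub>R F z"
      using SI nS[of z] lb[of z] lb'[of z] interior_subset[of T] by (auto simp: indicator_def)
  qed
  finally show ?thesis unfolding set_lebesgue_integral_def .
qed

text \<open>With \<open>e = w - v\<close> and \<open>w (pt x) = v x\<close>, the nodal values of \<open>e\<close> are
  \<open>e x = (v x - v (pt x)) + (e x - e (pt x))\<close>. Both differences are at most the tolerance times a constant times
  the oscillation \<open>D\<close> of the nodal values of \<open>v\<close> and the largest nodal value of \<open>e\<close>, respectively; the second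
  contribution is absorbed on the left-hand side. So \<open>grad e\<close> is a small multiple of \<open>D / h\<close>, while \<open>grad v\<close>
  is at least \<open>D / (2 * h)\<close> on a fixed fraction of the element.\<close>

theorem energy_lower_bound:
  assumes k: "k > 0" and pt: "\<And>x. x \<in> lattice_points k T \<Longrightarrow> norm (pt x - x) \<le> node_tol k \<sigma> * h"
    and v: "v \<in> polys k" and w: "w \<in> polys k"
    and wv: "\<And>x. x \<in> lattice_points k T \<Longrightarrow> w (pt x) = v x"
  shows "0 \<le> energy T w v"
    and "\<lbrakk>energy T w v = 0; x \<in> lattice_points k T; y \<in> lattice_points k T\<rbrakk> \<Longrightarrow> v x = v y"
proof -
  let ?X = "lattice_points k T" and ?A = "node_count k * basis_lip k \<sigma>" and ?\<epsilon> = "node_tol k \<sigma>"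
  have fin: "finite ?X" by (rule lattice_finite(1)[OF k])
  have X0: "?X \<noteq> {}" using vertices_lattice[OF k] vertices_props(3) by fastforce
  have A: "1 \<le> ?A" using tolerance_bounds(1,2)[OF k \<sigma>_pos] mult_mono[of 1 "node_count k" 1 "basis_lip k \<sigma>"] by simp
  have \<epsilon>: "0 < ?\<epsilon>" "?A * ?\<epsilon> \<le> 1 / 2" using tolerance_bounds[OF k \<sigma>_pos] by auto
  obtain ab where ab: "ab \<in> ?X \<times> ?X" "\<And>cd. cd \<in> ?X \<times> ?X \<Longrightarrow> \<bar>v (fst cd) - v (snd cd)\<bar> \<le> \<bar>v (fst ab) - v (snd ab)\<bar>"
    using finite_max_attained[of "?X \<times> ?X" "\<lambda>cd. \<bar>v (fst cd) - v (snd cd)\<bar>"] fin X0 by auto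
  define a b D where "a = fst ab" and "b = snd ab" and "D = \<bar>v a - v b\<bar>"
  have aX: "a \<in> ?X" and bX: "b \<in> ?X" using ab(1) by (auto simp: a_def b_def)
  have osc: "\<bar>v x - v y\<bar> \<le> D" if "x \<in> ?X" "y \<in> ?X" for x y
    using ab(2)[of "(x, y)"] that by (simp add: D_def a_def b_def)
  have D0: "0 \<le> D" by (simp add: D_def)
  define e where "e z = w z - v z" for z
  have e: "e \<in> polys k" unfolding e_def[abs_def] by (intro polys_diff v w)
  obtain x0 where x0: "x0 \<in> ?X" "\<And>y. y \<in> ?X \<Longrightarrow> \<bar>e y\<bar> \<le> \<bar>e x0\<bar>"
    using finite_max_attained[OF fin X0, of "\<lambda>x. \<bar>e x\<bar>"] by metis
  define \<mu> where "\<mu> = \<bar>e x0\<bar>"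
  have \<mu>0: "0 \<le> \<mu>" by (simp add: \<mu>_def)
  have near0: "pt x0 \<in> near" "x0 \<in> near"
    using displaced_near[OF k x0(1) pt[OF x0(1)]] T_near lattice_subset[OF k] x0(1) by auto
  have "e x0 = (v x0 - v (pt x0)) + (e x0 - e (pt x0))"
    using wv[OF x0(1)] by (simp add: e_def)
  moreover have "\<bar>v x0 - v (pt x0)\<bar> \<le> ?A * ?\<epsilon> * D"
  proof -
    have "\<bar>v x0 - v (pt x0)\<bar> \<le> ?A * D / h * norm (x0 - pt x0)"
      by (rule poly_bounds(1)[OF k v, of "v a"]) (use osc aX near0 in auto)
    also have "\<dots> \<le> ?A * D / h * (?\<epsilon> * h)"
      using pt[OF x0(1)] A D0 diameter_pos by (intro mult_left_mono) (auto simp: norm_minus_commute)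
    finally show ?thesis using diameter_pos by (simp add: mult_ac)
  qed
  moreover have "\<bar>e x0 - e (pt x0)\<bar> \<le> ?A * ?\<epsilon> * \<mu>"
  proof -
    have "\<bar>e x0 - e (pt x0)\<bar> \<le> ?A * \<mu> / h * norm (x0 - pt x0)"
      by (rule poly_bounds(1)[OF k e, of 0]) (use x0 near0 in \<open>auto simp: \<mu>_def\<close>)
    also have "\<dots> \<le> ?A * \<mu> / h * (?\<epsilon> * h)"
      using pt[OF x0(1)] A \<mu>0 diameter_pos by (intro mult_left_mono) (auto simp: norm_minus_commute)
    finally show ?thesis using diameter_pos by (simp add: mult_ac)
  qed
  moreover have "?A * ?\<epsilon> * \<mu> \<le> 1 / 2 * \<mu>" using \<epsilon>(2) \<mu>0 by (rule mult_right_mono)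
  ultimately have \<mu>: "\<mu> \<le> 2 * ?A * ?\<epsilon> * D" unfolding \<mu>_def by linarith
  define E where "E = 2 * ?A ^ 3 * ?\<epsilon> * D\<^sup>2 / h\<^sup>2"
  have eg: "\<bar>grad e z \<bullet> grad v z\<bar> \<le> E" if z: "z \<in> T" for z
  proof -
    have "norm (grad e z) \<le> ?A * \<mu> / h"
      by (rule poly_bounds(2)[OF k e, of 0 _ _ z]) (use x0 T_near z in \<open>auto simp: \<mu>_def\<close>)
    also have "\<dots> \<le> ?A * (2 * ?A * ?\<epsilon> * D) / h"
      using \<mu> A diameter_pos by (intro divide_right_mono mult_left_mono) auto
    finally have 1: "norm (grad e z) \<le> ?A * (2 * ?A * ?\<epsilon> * D) / h" .
    have 2: "norm (grad v z) \<le> ?A * D / h"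
      by (rule poly_bounds(2)[OF k v, of "v a" _ _ z]) (use osc aX T_near z in auto)
    have "\<bar>grad e z \<bullet> grad v z\<bar> \<le> norm (grad e z) * norm (grad v z)" by (rule Cauchy_Schwarz_ineq2)
    also have "\<dots> \<le> (?A * (2 * ?A * ?\<epsilon> * D) / h) * (?A * D / h)"
      using 1 2 A \<epsilon> D0 diameter_pos by (intro mult_mono) auto
    also have "\<dots> = E"
      by (simp add: E_def power2_eq_square power3_eq_cube)
    finally show ?thesis .
  qed
  obtain z0 where z0: "z0 \<in> T"
    "\<And>z. z \<in> T \<Longrightarrow> norm (z - z0) \<le> shrink_ratio k \<sigma> * h \<Longrightarrow> D / (2 * h) \<le> norm (grad v z)"
    using steep_near_point[OF k v osc aX bX] D_def by metis
  have gw: "grad w z \<bullet> grad v z = (norm (grad v z))\<^sup>2 + grad e z \<bullet> grad v z" for z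
    unfolding e_def[abs_def] grad_diff_polys[OF w v]
    by (simp add: inner_diff_left power2_norm_eq_inner)
  have "measure lebesgue (interior T) * (shrink_ratio k \<sigma> ^ 3 * (D / (2 * h))\<^sup>2 - E) \<le> energy T w v"
    unfolding energy_def
  proof (rule integral_lower_bound[OF z0(1)])
    show "continuous_on UNIV (\<lambda>z. grad w z \<bullet> grad v z)"
      using C1_fun_polys[OF v] C1_fun_polys[OF w] by (intro continuous_intros) (auto simp: C1_fun_def)
    show "- E \<le> grad w z \<bullet> grad v z" if "z \<in> T" for z
      using eg[OF that] zero_le_power2[of "norm (grad v z)"] unfolding gw by linarith
    show "(D / (2 * h))\<^sup>2 - E \<le> grad w z \<bullet> grad v z" if "z \<in> T" "norm (z - z0) \<le> shrink_ratio k \<sigma> * h" for z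
    proof -
      have "(D / (2 * h))\<^sup>2 \<le> (norm (grad v z))\<^sup>2"
        using z0(2)[OF that] D0 diameter_pos by (intro power_mono) auto
      then show ?thesis using eg[OF that(1)] unfolding gw by linarith
    qed
  qed (use tolerance_bounds[OF k \<sigma>_pos] in auto)
  moreover have "shrink_ratio k \<sigma> ^ 3 * (D / (2 * h))\<^sup>2 - E = shrink_ratio k \<sigma> ^ 3 / 8 * (D\<^sup>2 / h\<^sup>2)"
  proof -
    have "E = shrink_ratio k \<sigma> ^ 3 / 8 * (D\<^sup>2 / h\<^sup>2)"
      unfolding E_def using tolerance_bounds(9)[OF k \<sigma>_pos] by (metis times_divide_eq_right)
    then show ?thesis by (simp add: power_divide power_mult_distrib)
  qed
  ultimately have lower: "measure lebesgue (interior T) * (shrink_ratio k \<sigma> ^ 3 / 8 * (D\<^sup>2 / h\<^sup>2)) \<le> energy T w v"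
    by simp
  have s0: "0 < shrink_ratio k \<sigma> ^ 3 / 8" using tolerance_bounds(3)[OF k \<sigma>_pos] by simp
  have "0 \<le> measure lebesgue (interior T) * (shrink_ratio k \<sigma> ^ 3 / 8 * (D\<^sup>2 / h\<^sup>2))"
    using s0 by (intro mult_nonneg_nonneg) auto
  with lower show "0 \<le> energy T w v" by linarith
  assume en: "energy T w v = 0" and xy: "x \<in> ?X" "y \<in> ?X"
  have "0 < measure lebesgue (interior T)"
  proof -
    have "\<not> negligible (interior T)" using interior_nonempty open_not_negligible by blast
    moreover have "interior T \<in> lmeasurable"
      using compact_T bounded_subset[OF compact_imp_bounded interior_subset] by (intro lmeasurable_open) auto
    ultimately show ?thesis
      using negligible_iff_measure by (metis measure_nonneg less_eq_real_def)
  qed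
  then have "D = 0"
    using lower en s0 diameter_pos D0
    by (metis divide_pos_pos less_eq_real_def mult_pos_pos not_less zero_less_power)
  then show "v x = v y" using osc[OF xy] by simp
qed

end

section \<open>Flatness of the boundary at small scales\<close>

text \<open>Up to the slope \<open>\<epsilon>\<close>, the boundary in the ball is a plane with inner normal \<open>n\<close>: seen from any boundary point
  in the ball, the directions that rise by more than \<open>\<epsilon>\<close> along \<open>n\<close> lead into \<open>\<Omega>\<close>, those that descend by
  more than \<open>\<epsilon>\<close> lead out of \<open>closure \<Omega>\<close>.\<close>

definition flat_at :: "(real^3) set \<Rightarrow> real \<Rightarrow> real \<Rightarrow> real^3 \<Rightarrow> real^3 \<Rightarrow> bool" where
  "flat_at \<Omega> \<epsilon> r x n \<longleftrightarrow> norm n = 1 \<and>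
     (\<forall>y\<in>frontier \<Omega> \<inter> ball x r. \<forall>z\<in>ball x r.
        (\<epsilon> * norm (z - y) < n \<bullet> (z - y) \<longrightarrow> z \<in> \<Omega>) \<and>
        (n \<bullet> (z - y) < - (\<epsilon> * norm (z - y)) \<longrightarrow> z \<notin> closure \<Omega>))"

lemma horizontal_linear: "linear horizontal"
  unfolding horizontal_def
  by (rule linearI) (auto simp: vec_eq_iff forall_2 vector_2)

lemma norm_horizontal: "norm (horizontal x) \<le> norm x"
  unfolding norm_le by (simp add: inner_vec_def sum_2 sum_3 horizontal_def vector_2)

text \<open>In the chart, \<open>\<Omega>\<close> is the set where \<open>\<psi> z = A z $ 3 - \<phi> (q z)\<close> is positive, and \<open>\<psi>\<close> is zero on the
  boundary. By the mean value theorem and the continuity of the gradient of \<open>\<phi>\<close>, the increments of \<open>\<psi>\<close> differ from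
  those of its linearization at \<open>x0\<close> by at most \<open>\<epsilon> * norm (z - y)\<close>. The gradient \<open>N\<close> of \<open>\<psi>\<close> has norm at least 1, and normalizing
  it gives \<open>n\<close>.\<close>

lemma flat_near_boundary_point:
  assumes "open \<Omega>" "boundary_graph \<Omega> U A \<phi> G" "x0 \<in> U" "0 < \<epsilon>"
  shows "\<exists>r>0. \<exists>n. flat_at \<Omega> \<epsilon> r x0 n"
proof -
  define q where "q = horizontal \<circ> A"
  note bg = assms(2)[unfolded boundary_graph_def, folded q_def]
  have U: "open U" and A: "orthogonal_transformation A" and G: "\<And>y. y \<in> q ` U \<Longrightarrow> GDERIV \<phi> y :> G y"
    and Gc: "continuous_on (q ` U) G" and \<Omega>U: "\<Omega> \<inter> U = {x \<in> U. \<phi> (q x) < A x $ 3}"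
    using bg by (auto simp: q_def)
  have lA: "linear A" using A by (simp add: orthogonal_transformation)
  have lq: "linear q" unfolding q_def by (intro linear_compose lA horizontal_linear)
  have nq: "norm (q d) \<le> norm d" for d
    using norm_horizontal[of "A d"] orthogonal_transformation_norm[OF A, of d] by (simp add: q_def)
  define \<psi> where "\<psi> z = A z $ 3 - \<phi> (q z)" for z
  have in\<Omega>: "z \<in> \<Omega> \<longleftrightarrow> \<psi> z > 0" if "z \<in> U" for z
    using \<Omega>U that by (auto simp: \<psi>_def)
  have cont: "isCont \<psi> z" if "z \<in> U" for z
  proof -
    have "isCont \<phi> (q z)"
      using G[of "q z"] that unfolding gderiv_def by (blast intro: has_derivative_continuous)
    then have "isCont (\<lambda>z. \<phi> (q z)) z"
      using isCont_o2[of z q \<phi>] linear_continuous_at[of q z] lq by (simp add: linear_conv_bounded_linear)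
    moreover have "isCont (\<lambda>z. A z $ 3) z"
      using linear_continuous_at[of A z] lA by (intro isCont_vec_nth) (simp add: linear_conv_bounded_linear)
    ultimately show ?thesis unfolding \<psi>_def by (intro continuous_diff)
  qed
  have out: "z \<notin> closure \<Omega>" if z: "z \<in> U" "\<psi> z < 0" for z
  proof -
    have "eventually (\<lambda>w. \<psi> w < 0) (nhds z)"
      using cont[OF z(1)] z(2) unfolding isCont_def tendsto_at_iff_tendsto_nhds
      by (rule order_tendstoD(2))
    then obtain S where S: "open S" "z \<in> S" "\<And>w. w \<in> S \<Longrightarrow> \<psi> w < 0"
      unfolding eventually_nhds by blast
    have "(S \<inter> U) \<inter> \<Omega> = {}" using S(3) in\<Omega> by force
    then have "(S \<inter> U) \<inter> closure \<Omega> = {}"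
      using open_Int_closure_eq_empty[of "S \<inter> U" \<Omega>] S(1) U by blast
    then show ?thesis using S(2) z(1) by blast
  qed
  have fr: "\<psi> y = 0" if y: "y \<in> frontier \<Omega>" "y \<in> U" for y
  proof -
    have "y \<in> closure \<Omega>" "y \<notin> \<Omega>" using y(1) assms(1) by (auto simp: frontier_def interior_open)
    then show ?thesis using out[OF y(2)] in\<Omega>[OF y(2)] by force
  qed
  obtain \<delta> where \<delta>: "\<delta> > 0" "\<And>y. y \<in> q ` U \<Longrightarrow> dist y (q x0) < \<delta> \<Longrightarrow> dist (G y) (G (q x0)) < \<epsilon>"
    using Gc assms(3,4) unfolding continuous_on_iff by (metis imageI)
  obtain r0 where r0: "r0 > 0" "ball x0 r0 \<subseteq> U" using U assms(3) openE by blast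
  define r where "r = min r0 \<delta>"
  have r: "r > 0" "ball x0 r \<subseteq> U" using r0 \<delta>(1) by (auto simp: r_def)
  define l where "l d = A d $ 3 - G (q x0) \<bullet> q d" for d
  have ll: "linear l" unfolding l_def
    using lA lq by (intro linearI) (auto simp: linear_add linear_cmul inner_add_right algebra_simps)
  define N where "N = adjoint l 1"
  have lN: "l d = N \<bullet> d" for d
    using adjoint_works[OF ll, of d 1] by (simp add: N_def inner_commute)
  have N1: "1 \<le> norm N"
  proof -
    obtain e where e: "A e = axis 3 1"
      using orthogonal_transformation_surj[OF A] by (metis surjD)
    have "norm e = 1" using orthogonal_transformation_norm[OF A, of e] by (simp add: e)
    moreover have "q e = 0" by (simp add: q_def e horizontal_def vec_eq_iff forall_2 axis_def)
    then have "l e = 1" by (simp add: l_def e)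
    ultimately show ?thesis using Cauchy_Schwarz_ineq2[of N e] lN[of e] by simp
  qed
  define n where "n = N /\<^sub>R norm N"
  have N0: "norm N \<noteq> 0" using N1 by linarith
  then have N: "N = norm N *\<^sub>R n" "norm n = 1" by (auto simp: n_def)
  have near: "\<bar>\<psi> z - \<psi> y - N \<bullet> (z - y)\<bar> \<le> \<epsilon> * norm (z - y)" if yz: "y \<in> ball x0 r" "z \<in> ball x0 r" for y z
  proof -
    have seg: "closed_segment y z \<subseteq> ball x0 r" using yz by (intro closed_segment_subset convex_ball)
    have im: "closed_segment (q y) (q z) = q ` closed_segment y z"
      by (rule closed_segment_linear_image[OF lq])
    have "GDERIV \<phi> w :> G w" if "w \<in> closed_segment (q y) (q z)" for w
      using that G im seg r(2) by blast
    from mean_value_gderiv[OF this]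
    obtain \<xi> where \<xi>: "\<xi> \<in> closed_segment (q y) (q z)" "\<phi> (q z) - \<phi> (q y) = G \<xi> \<bullet> (q z - q y)"
      by blast
    obtain p where p: "p \<in> ball x0 r" "\<xi> = q p" using \<xi>(1) im seg by blast
    have "dist \<xi> (q x0) \<le> dist p x0"
      unfolding p(2) dist_norm using nq[of "p - x0"] by (simp add: linear_diff[OF lq])
    then have "dist \<xi> (q x0) < \<delta>" using p(1) by (auto simp: r_def dist_commute)
    then have g: "norm (G \<xi> - G (q x0)) < \<epsilon>" using \<delta>(2)[of \<xi>] p r(2) by (auto simp: dist_norm)
    have "\<psi> z - \<psi> y - N \<bullet> (z - y) = - ((G \<xi> - G (q x0)) \<bullet> q (z - y))"
      using \<xi>(2) lN[of "z - y"] by (simp add: \<psi>_def l_def linear_diff[OF lA] linear_diff[OF lq] inner_diff_left)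
    then have "\<bar>\<psi> z - \<psi> y - N \<bullet> (z - y)\<bar> \<le> norm (G \<xi> - G (q x0)) * norm (q (z - y))"
      using Cauchy_Schwarz_ineq2[of "G \<xi> - G (q x0)" "q (z - y)"] by simp
    also have "\<dots> \<le> \<epsilon> * norm (z - y)" using g nq[of "z - y"] assms(4) by (intro mult_mono) auto
    finally show ?thesis .
  qed
  have "flat_at \<Omega> \<epsilon> r x0 n"
    unfolding flat_at_def
  proof (intro conjI ballI impI)
    fix y z assume y: "y \<in> frontier \<Omega> \<inter> ball x0 r" and z: "z \<in> ball x0 r"
    have zU: "z \<in> U" and y0: "\<psi> y = 0" using y z r(2) fr by auto
    have Nd: "N \<bullet> (z - y) = norm N * (n \<bullet> (z - y))" using N(1) by (metis inner_scaleR_left)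
    have le: "\<epsilon> * norm (z - y) \<le> norm N * (\<epsilon> * norm (z - y))" using mult_right_mono[OF N1, of "\<epsilon> * norm (z - y)"] assms(4) by simp
    {
      assume "\<epsilon> * norm (z - y) < n \<bullet> (z - y)"
      then have "norm N * (\<epsilon> * norm (z - y)) < N \<bullet> (z - y)" unfolding Nd using N1 by (intro mult_strict_left_mono) auto
      then have "\<psi> z > 0" using near[of y z] y z y0 le by (auto simp: abs_le_iff)
      then show "z \<in> \<Omega>" using in\<Omega>[OF zU] by simp
    }
    {
      assume "n \<bullet> (z - y) < - (\<epsilon> * norm (z - y))"
      then have "norm N * (n \<bullet> (z - y)) < norm N * (- (\<epsilon> * norm (z - y)))" using N1 by (intro mult_strict_left_mono) auto
      then have "N \<bullet> (z - y) < - (norm N * (\<epsilon> * norm (z - y)))" unfolding Nd by simp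
      then have "\<psi> z < 0" using near[of y z] y z y0 le by (auto simp: abs_le_iff)
      then show "z \<notin> closure \<Omega>" using out[OF zU] by simp
    }
  qed (rule N(2))
  then show ?thesis using r(1) by blast
qed

lemma flat_at_subset:
  assumes "flat_at \<Omega> \<epsilon> r x n" "ball x' r' \<subseteq> ball x r"
  shows "flat_at \<Omega> \<epsilon> r' x' n"
  using assms unfolding flat_at_def by blast

text \<open>The frontier is compact, so the radii obtained at its points have a Lebesgue number.\<close>

lemma uniformly_flat:
  assumes "open \<Omega>" "bounded \<Omega>" "C1_boundary_with_curvatures \<Omega>" "0 < \<epsilon>"
  obtains r where "r > 0" "\<And>x. x \<in> frontier \<Omega> \<Longrightarrow> \<exists>n. flat_at \<Omega> \<epsilon> r x n"
proof -
  have "\<exists>r>0. \<exists>n. flat_at \<Omega> \<epsilon> r x n" if "x \<in> frontier \<Omega>" for x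
    using assms(3) that flat_near_boundary_point[OF assms(1) _ _ assms(4)]
    unfolding C1_boundary_with_curvatures_def by metis
  then obtain \<rho> \<nu> where \<rho>: "\<And>x. x \<in> frontier \<Omega> \<Longrightarrow> \<rho> x > 0 \<and> flat_at \<Omega> \<epsilon> (\<rho> x) x (\<nu> x)"
    by metis
  have cpt: "compact (frontier \<Omega>)" using assms(2) by (rule compact_frontier_bounded)
  have cov: "frontier \<Omega> \<subseteq> \<Union>((\<lambda>x. ball x (\<rho> x)) ` frontier \<Omega>)" using \<rho> by force
  obtain r where r: "0 < r" "\<And>x. x \<in> frontier \<Omega> \<Longrightarrow> \<exists>B\<in>(\<lambda>x. ball x (\<rho> x)) ` frontier \<Omega>. ball x r \<subseteq> B"
    using Heine_Borel_lemma[OF cpt cov] by auto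
  show ?thesis
  proof (rule that[OF r(1)])
    fix x assume "x \<in> frontier \<Omega>"
    then obtain x' where x': "x' \<in> frontier \<Omega>" "ball x r \<subseteq> ball x' (\<rho> x')" using r(2) by blast
    then show "\<exists>n. flat_at \<Omega> \<epsilon> r x n"
      using \<rho>[OF x'(1)] flat_at_subset by blast
  qed
qed

lemma flat_atD:
  assumes "flat_at \<Omega> \<epsilon> r x n" "open \<Omega>" "y \<in> frontier \<Omega>" "norm (y - x) < r"
  shows "\<lbrakk>norm (z - x) < r; z \<in> frontier \<Omega>\<rbrakk> \<Longrightarrow> \<bar>n \<bullet> (z - y)\<bar> \<le> \<epsilon> * norm (z - y)"
    and "\<lbrakk>norm (z - x) < r; z \<in> closure \<Omega>\<rbrakk> \<Longrightarrow> - (\<epsilon> * norm (z - y)) \<le> n \<bullet> (z - y)"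
    and "\<lbrakk>norm (z - x) < r; \<epsilon> * norm (z - y) < n \<bullet> (z - y)\<rbrakk> \<Longrightarrow> z \<in> \<Omega>"
    and "\<lbrakk>norm (z - x) < r; n \<bullet> (z - y) < - (\<epsilon> * norm (z - y))\<rbrakk> \<Longrightarrow> z \<notin> closure \<Omega>"
proof -
  have *: "(\<epsilon> * norm (z - y) < n \<bullet> (z - y) \<longrightarrow> z \<in> \<Omega>) \<and> (n \<bullet> (z - y) < - (\<epsilon> * norm (z - y)) \<longrightarrow> z \<notin> closure \<Omega>)"
    if "norm (z - x) < r" for z
    using assms that unfolding flat_at_def by (auto simp: dist_norm norm_minus_commute)
  then show "\<lbrakk>norm (z - x) < r; z \<in> closure \<Omega>\<rbrakk> \<Longrightarrow> - (\<epsilon> * norm (z - y)) \<le> n \<bullet> (z - y)"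
    and "\<lbrakk>norm (z - x) < r; \<epsilon> * norm (z - y) < n \<bullet> (z - y)\<rbrakk> \<Longrightarrow> z \<in> \<Omega>"
    and "\<lbrakk>norm (z - x) < r; n \<bullet> (z - y) < - (\<epsilon> * norm (z - y))\<rbrakk> \<Longrightarrow> z \<notin> closure \<Omega>"
    by (auto simp: not_less[symmetric])
  have "z \<in> closure \<Omega> \<and> z \<notin> \<Omega>" if "z \<in> frontier \<Omega>"
    using that assms(2) by (auto simp: frontier_def interior_open)
  then show "\<lbrakk>norm (z - x) < r; z \<in> frontier \<Omega>\<rbrakk> \<Longrightarrow> \<bar>n \<bullet> (z - y)\<bar> \<le> \<epsilon> * norm (z - y)"
    using *[of z] by (auto simp: abs_le_iff not_less[symmetric])
qed

text \<open>The points of the line at distance \<open>4 * \<epsilon> / c * l\<close> from \<open>x\<close> are seen from \<open>a\<close> under a slope larger than \<open>\<epsilon>\<close>,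
  one of them upwards and hence in \<open>\<Omega>\<close>, the other one downwards and hence not in \<open>closure \<Omega>\<close>; so the line
  meets the boundary in between. Two
  intersections in the ball would span a chord of slope at least \<open>c > \<epsilon>\<close>.\<close>

lemma transversal_line:
  assumes flat: "flat_at \<Omega> \<epsilon> r a n" and op: "open \<Omega>" and a: "a \<in> frontier \<Omega>"
    and d: "norm d = 1" "c \<le> n \<bullet> d" and \<epsilon>: "0 < \<epsilon>" "4 * \<epsilon> \<le> c"
    and l: "0 < l" "2 * l < r" and x: "norm (x - a) \<le> l" "\<bar>n \<bullet> (x - a)\<bar> \<le> \<epsilon> * l"
  shows "\<exists>Q. nearest_intersections \<Omega> {x + t *\<^sub>R d | t. True} x = {Q} \<and> norm (Q - x) \<le> 4 * \<epsilon> / c * l"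
proof -
  let ?L = "{x + t *\<^sub>R d | t. True}"
  define s where "s = 4 * \<epsilon> / c * l"
  have c0: "0 < c" using \<epsilon> by linarith
  have s0: "0 < s" and sl: "s \<le> l"
  proof -
    show "0 < s" unfolding s_def using \<epsilon> c0 l(1) by simp
    have "4 * \<epsilon> / c \<le> 1" using \<epsilon> c0 by simp
    then have "4 * \<epsilon> / c * l \<le> 1 * l" using l(1) by (intro mult_right_mono) auto
    then show "s \<le> l" unfolding s_def by simp
  qed
  have sc: "s * c = 4 * (\<epsilon> * l)" unfolding s_def using c0 by simp
  have near: "norm (x + t *\<^sub>R d - a) \<le> l + \<bar>t\<bar>" for t
    using norm_triangle_ineq[of "x - a" "t *\<^sub>R d"] x(1) d(1) by (simp add: algebra_simps)
  have nn: "n \<bullet> (x + t *\<^sub>R d - a) = n \<bullet> (x - a) + t * (n \<bullet> d)" for t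
    by (simp add: inner_add_right inner_diff_right)
  have el: "\<epsilon> * (l + s) \<le> 2 * (\<epsilon> * l)" using sl \<epsilon>(1) by (simp add: algebra_simps)
  have el0: "0 < \<epsilon> * l" using \<epsilon>(1) l(1) by simp
  have snd: "4 * (\<epsilon> * l) \<le> s * (n \<bullet> d)" using sc mult_left_mono[OF d(2), of s] s0 by simp
  have b: "\<epsilon> * norm (x + t *\<^sub>R d - a) \<le> \<epsilon> * (l + s)" if "\<bar>t\<bar> = s" for t
    using near[of t] that \<epsilon>(1) by (intro mult_left_mono) auto
  have lt: "norm (x + t *\<^sub>R d - a) < r" if "\<bar>t\<bar> \<le> s" for t
    using near[of t] that sl l(2) by linarith
  have r0: "norm (a - a) < r" using l by simp
  have pin: "x + s *\<^sub>R d \<in> \<Omega>"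
  proof (rule flat_atD(3)[OF flat op a r0])
    show "norm (x + s *\<^sub>R d - a) < r" using lt[of s] s0 by simp
    show "\<epsilon> * norm (x + s *\<^sub>R d - a) < n \<bullet> (x + s *\<^sub>R d - a)"
      using b[of s] el el0 snd x(2) s0 unfolding nn[of s] by linarith
  qed
  have pout: "x + (- s) *\<^sub>R d \<notin> closure \<Omega>"
  proof (rule flat_atD(4)[OF flat op a r0])
    show "norm (x + (- s) *\<^sub>R d - a) < r" using lt[of "- s"] s0 by simp
    show "n \<bullet> (x + (- s) *\<^sub>R d - a) < - (\<epsilon> * norm (x + (- s) *\<^sub>R d - a))"
      using b[of "-s"] el el0 snd x(2) s0 unfolding nn[of "-s"] by linarith
  qed
  let ?S = "closed_segment (x + (- s) *\<^sub>R d) (x + s *\<^sub>R d)"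
  have "?S \<inter> frontier \<Omega> \<noteq> {}"
  proof (rule connected_Int_frontier)
    show "connected ?S" by simp
    show "?S \<inter> \<Omega> \<noteq> {}" using pin ends_in_segment by blast
    show "?S - \<Omega> \<noteq> {}" using pout closure_subset ends_in_segment by blast
  qed
  then obtain Q where Q: "Q \<in> ?S" "Q \<in> frontier \<Omega>" by blast
  then obtain u where u: "0 \<le> u" "u \<le> 1" "Q = (1 - u) *\<^sub>R (x + (- s) *\<^sub>R d) + u *\<^sub>R (x + s *\<^sub>R d)"
    by (auto simp: in_segment)
  define t where "t = (2 * u - 1) * s"
  have Qt: "Q = x + t *\<^sub>R d" using u(3) by (simp add: t_def algebra_simps scaleR_2 [symmetric])
  have "\<bar>2 * u - 1\<bar> \<le> 1" using u by (simp add: abs_le_iff)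
  then have ts: "\<bar>t\<bar> \<le> s" unfolding t_def abs_mult using s0 by (simp add: mult_le_cancel_right1)
  have Qx: "norm (Q - x) \<le> s" using ts d(1) by (simp add: Qt)
  have uniq: "y = z" if y: "y \<in> ?L" "y \<in> frontier \<Omega>" "norm (y - x) \<le> s"
      and z: "z \<in> ?L" "z \<in> frontier \<Omega>" "norm (z - x) \<le> s" for y z
  proof -
    obtain ty tz where t: "y = x + ty *\<^sub>R d" "z = x + tz *\<^sub>R d" using y(1) z(1) by blast
    have "norm (y - a) < r" "norm (z - a) < r"
      using y(3) z(3) d(1) lt[of ty] lt[of tz] by (auto simp: t)
    then have "\<bar>n \<bullet> (z - y)\<bar> \<le> \<epsilon> * norm (z - y)"
      using flat_atD(1)[OF flat op y(2)] z(2) by blast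
    moreover have zy: "z - y = (tz - ty) *\<^sub>R d" by (simp add: t algebra_simps)
    ultimately have "\<bar>tz - ty\<bar> * \<bar>n \<bullet> d\<bar> \<le> \<bar>tz - ty\<bar> * \<epsilon>"
      using d(1) by (simp add: abs_mult mult.commute)
    moreover have "\<epsilon> < \<bar>n \<bullet> d\<bar>" using d(2) \<epsilon> by linarith
    ultimately have "\<bar>tz - ty\<bar> \<le> 0"
      by (metis abs_ge_zero less_eq_real_def mult_le_cancel_left_pos not_less)
    then show ?thesis by (simp add: t)
  qed
  have QL: "Q \<in> ?L" using Qt by blast
  have "nearest_intersections \<Omega> ?L x = {Q}"
  proof (intro equalityI subsetI)
    fix y assume y: "y \<in> nearest_intersections \<Omega> ?L x"
    then have yL: "y \<in> ?L" "y \<in> frontier \<Omega>" and "\<not> dist x Q < dist x y"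
      using QL Q(2) unfolding nearest_intersections_def is_arg_min_def by auto
    then have "norm (y - x) \<le> s" using Qx by (simp add: dist_norm norm_minus_commute)
    then show "y \<in> {Q}" using uniq[OF yL _ QL Q(2) Qx] by simp
  next
    fix y assume "y \<in> {Q}"
    moreover have "\<not> dist x y' < dist x Q" if "y' \<in> ?L \<inter> frontier \<Omega>" for y'
    proof
      assume lt: "dist x y' < dist x Q"
      then have "norm (y' - x) \<le> s" using Qx by (simp add: dist_norm norm_minus_commute)
      then have "y' = Q" using uniq[OF _ _ _ QL Q(2) Qx] that by blast
      then show False using lt by simp
    qed
    ultimately show "y \<in> nearest_intersections \<Omega> ?L x"
      using QL Q(2) unfolding nearest_intersections_def is_arg_min_def by auto
  qed
  then show ?thesis using Qx unfolding s_def by blast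
qed

section \<open>Boundary elements\<close>

context shape_regular_tetrahedron begin

lemma bgrad_inner_bound: "v \<in> C \<Longrightarrow> \<bar>bgrad T v \<bullet> w\<bar> \<le> \<sigma> / h * norm w"
  using Cauchy_Schwarz_ineq2[of "bgrad T v" w] mult_right_mono[OF bgrad_bound, of v "norm w"] by simp

text \<open>Apart from the term of the apex \<open>p\<close>, the dual expansion of the normal \<open>n\<close> only contains inner products with
  chords of the boundary, which are small. Hence \<open>n\<close> is nearly a multiple of \<open>bgrad T p\<close>, and the factor
  \<open>n \<bullet> (p - a)\<close> is positive because \<open>p\<close> belongs to \<open>\<Omega>\<close>.\<close>

lemma apex_height:
  assumes flat: "flat_at \<Omega> \<epsilon> r a n" and op: "open \<Omega>" and a: "a \<in> C" and ap: "p \<in> C" "p \<noteq> a" "p \<in> \<Omega>"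
    and fr: "\<And>v. v \<in> C \<Longrightarrow> v \<noteq> p \<Longrightarrow> v \<in> frontier \<Omega>"
    and hr: "h < r" and \<epsilon>: "0 < \<epsilon>" "8 * \<epsilon> * \<sigma> \<le> 1"
  shows "h / (2 * \<sigma>) \<le> n \<bullet> (p - a)" and "1 / (2 * h) \<le> bgrad T p \<bullet> n"
proof -
  have n1: "norm n = 1" using flat by (simp add: flat_at_def)
  have afr: "a \<in> frontier \<Omega>" using fr a ap(2) by blast
  have dT: "norm (v - a) \<le> h" if "v \<in> C" for v
    using dist_le_diameter that a vertices_props(5) by blast
  have aa: "norm (a - a) < r" using hr diameter_pos by simp
  define rest where "rest = (\<Sum>v\<in>C - {p}. (n \<bullet> (v - a)) *\<^sub>R bgrad T v)"
  have n_eq: "n = (n \<bullet> (p - a)) *\<^sub>R bgrad T p + rest"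
    using dual_expansion[of n a] sum.remove[OF vertices_props(2) ap(1), of "\<lambda>v. (n \<bullet> (v - a)) *\<^sub>R bgrad T v"]
    by (simp add: rest_def)
  have "norm rest \<le> (\<Sum>v\<in>C - {p}. \<epsilon> * \<sigma>)"
    unfolding rest_def
  proof (rule sum_norm_le)
    fix v assume v: "v \<in> C - {p}"
    have "\<bar>n \<bullet> (v - a)\<bar> \<le> \<epsilon> * norm (v - a)"
      using flat_atD(1)[OF flat op afr aa, of v] fr[of v] dT[of v] v hr by auto
    also have "\<dots> \<le> \<epsilon> * h" using dT[of v] v \<epsilon>(1) by (intro mult_left_mono) auto
    finally have "\<bar>n \<bullet> (v - a)\<bar> * norm (bgrad T v) \<le> (\<epsilon> * h) * (\<sigma> / h)"
      using bgrad_bound[of v] v diameter_pos \<epsilon>(1) by (intro mult_mono) auto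
    then show "norm ((n \<bullet> (v - a)) *\<^sub>R bgrad T v) \<le> \<epsilon> * \<sigma>"
      using diameter_pos by simp
  qed
  also have "\<dots> = 3 * \<epsilon> * \<sigma>"
    using vertices_props(2,3) ap(1) by simp
  finally have rest: "norm rest \<le> 1 / 2" using \<epsilon>(2) by linarith
  have "1 \<le> norm ((n \<bullet> (p - a)) *\<^sub>R bgrad T p) + norm rest"
    using n1 n_eq norm_triangle_ineq by metis
  then have "1 / 2 \<le> \<bar>n \<bullet> (p - a)\<bar> * norm (bgrad T p)" using rest by simp
  also have "\<dots> \<le> \<bar>n \<bullet> (p - a)\<bar> * (\<sigma> / h)"
    using bgrad_bound[OF ap(1)] by (intro mult_left_mono) auto
  finally have big: "h / (2 * \<sigma>) \<le> \<bar>n \<bullet> (p - a)\<bar>"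
    using diameter_pos \<sigma>_pos by (simp add: field_simps)
  have "- (\<epsilon> * norm (p - a)) \<le> n \<bullet> (p - a)"
    using flat_atD(2)[OF flat op afr aa, of p] dT[OF ap(1)] hr ap(3) closure_subset by (meson le_less_trans subsetD)
  moreover have "\<epsilon> * norm (p - a) \<le> \<epsilon> * h" using dT[OF ap(1)] \<epsilon>(1) by (intro mult_left_mono) auto
  moreover have "\<epsilon> * h < h / (2 * \<sigma>)"
  proof -
    have "\<epsilon> * (2 * \<sigma>) * h < 1 * h" using \<epsilon> diameter_pos by (intro mult_strict_right_mono) auto
    then show ?thesis using \<sigma>_pos by (simp add: field_simps)
  qed
  ultimately show low: "h / (2 * \<sigma>) \<le> n \<bullet> (p - a)" using big by linarith
  have "1 = n \<bullet> n" using n1 by (simp add: power2_norm_eq_inner[symmetric])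
  also have "\<dots> = (n \<bullet> (p - a)) * (bgrad T p \<bullet> n) + rest \<bullet> n"
    by (subst (1) n_eq) (simp add: inner_add_left)
  also have "rest \<bullet> n \<le> 1 / 2"
    using rest n1 norm_cauchy_schwarz[of rest n] by simp
  finally have half: "1 / 2 \<le> (n \<bullet> (p - a)) * (bgrad T p \<bullet> n)" by simp
  have pos: "0 < n \<bullet> (p - a)" using low diameter_pos \<sigma>_pos
    by (meson divide_pos_pos less_le_trans mult_pos_pos zero_less_numeral)
  have g0: "0 \<le> bgrad T p \<bullet> n"
  proof (rule ccontr)
    assume "\<not> ?thesis"
    then have "(n \<bullet> (p - a)) * (bgrad T p \<bullet> n) \<le> 0" using pos by (intro mult_nonneg_nonpos) auto
    with half show False by simp
  qed
  have "n \<bullet> (p - a) \<le> h" using norm_cauchy_schwarz[of n "p - a"] n1 dT[OF ap(1)] by simp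
  then have "(n \<bullet> (p - a)) * (bgrad T p \<bullet> n) \<le> h * (bgrad T p \<bullet> n)" using g0 by (rule mult_right_mono)
  then have "1 / 2 \<le> h * (bgrad T p \<bullet> n)" using half by linarith
  then show "1 / (2 * h) \<le> bgrad T p \<bullet> n" using diameter_pos by (simp add: field_simps)
qed

text \<open>The face lies within \<open>\<epsilon> * h\<close> of the plane through \<open>a\<close> orthogonal to \<open>n\<close>, while the apex is at height at least \<open>h / (2 * \<sigma>)\<close>
  above it. So the lines through the apex have slope at least \<open>1 / (4 * \<sigma>)\<close>.\<close>

lemma face_node_displacement:
  assumes flat: "flat_at \<Omega> \<epsilon> r a n" and op: "open \<Omega>" and a: "a \<in> C" and ap: "p \<in> C" "p \<noteq> a" "p \<in> \<Omega>"
    and fr: "\<And>v. v \<in> C \<Longrightarrow> v \<noteq> p \<Longrightarrow> v \<in> frontier \<Omega>"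
    and hr: "2 * h < r" and \<epsilon>: "0 < \<epsilon>" "16 * \<epsilon> * \<sigma> \<le> 1"
    and x: "x \<in> convex hull (C - {p})"
  shows "\<exists>Q. nearest_intersections \<Omega> (affine hull {p, x}) x = {Q} \<and> norm (Q - x) \<le> 16 * \<sigma> * \<epsilon> * h"
proof -
  have n1: "norm n = 1" using flat by (simp add: flat_at_def)
  have afr: "a \<in> frontier \<Omega>" using fr a ap(2) by blast
  have hr': "h < r" using hr diameter_pos by linarith
  have aa: "norm (a - a) < r" using hr' diameter_pos by simp
  have dT: "norm (v - a) \<le> h" if "v \<in> C" for v
    using dist_le_diameter that a vertices_props(5) by blast
  have v: "\<bar>n \<bullet> (v - a)\<bar> \<le> \<epsilon> * h" if v: "v \<in> C - {p}" for v
  proof -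
    have "\<bar>n \<bullet> (v - a)\<bar> \<le> \<epsilon> * norm (v - a)"
      using flat_atD(1)[OF flat op afr aa, of v] fr[of v] dT[of v] v hr' by auto
    also have "\<dots> \<le> \<epsilon> * h" using dT[of v] v \<epsilon>(1) by (intro mult_left_mono) auto
    finally show ?thesis .
  qed
  have xT: "x \<in> T" using x mem_hull_iff_bary[of "C - {p}"] by blast
  have "convex hull (C - {p}) \<subseteq> {y. n \<bullet> y \<le> n \<bullet> a + \<epsilon> * h} \<inter> {y. n \<bullet> y \<ge> n \<bullet> a - \<epsilon> * h}"
  proof (rule hull_minimal)
    show "C - {p} \<subseteq> {y. n \<bullet> y \<le> n \<bullet> a + \<epsilon> * h} \<inter> {y. n \<bullet> y \<ge> n \<bullet> a - \<epsilon> * h}"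
      using v by (force simp: inner_diff_right abs_le_iff)
    show "convex ({y. n \<bullet> y \<le> n \<bullet> a + \<epsilon> * h} \<inter> {y. n \<bullet> y \<ge> n \<bullet> a - \<epsilon> * h})"
      by (intro convex_Int convex_halfspace_le convex_halfspace_ge)
  qed
  with x have xn: "\<bar>n \<bullet> (x - a)\<bar> \<le> \<epsilon> * h" by (force simp: inner_diff_right abs_le_iff)
  have "h / (2 * \<sigma>) \<le> n \<bullet> (p - a)"
    using apex_height(1)[OF flat op a ap fr hr' \<epsilon>(1)] \<epsilon> \<sigma>_pos by simp
  moreover have "n \<bullet> (p - x) = n \<bullet> (p - a) - n \<bullet> (x - a)" by (simp add: inner_diff_right)
  moreover have "\<epsilon> * h \<le> h / (4 * \<sigma>)"
  proof -
    have "\<epsilon> * (4 * \<sigma>) * h \<le> 1 * h" using \<epsilon> diameter_pos \<sigma>_pos by (intro mult_right_mono) auto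
    then show ?thesis using \<sigma>_pos by (simp add: field_simps)
  qed
  moreover have "h / (2 * \<sigma>) = h / (4 * \<sigma>) + h / (4 * \<sigma>)" using \<sigma>_pos by (simp add: field_simps)
  ultimately have px: "h / (4 * \<sigma>) \<le> n \<bullet> (p - x)" using xn by linarith
  have px0: "0 < h / (4 * \<sigma>)" using diameter_pos \<sigma>_pos by simp
  have pne: "p \<noteq> x" using px px0 by auto
  define d where "d = (p - x) /\<^sub>R norm (p - x)"
  have d1: "norm d = 1" using pne by (simp add: d_def)
  have "norm (p - x) \<le> h" using dist_le_diameter[OF _ xT] ap(1) vertices_props(5) by blast
  then have "1 / (4 * \<sigma>) * norm (p - x) \<le> 1 / (4 * \<sigma>) * h" using \<sigma>_pos by (intro mult_left_mono) auto
  then have "1 / (4 * \<sigma>) * norm (p - x) \<le> n \<bullet> (p - x)" using px by simp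
  then have nd: "1 / (4 * \<sigma>) \<le> n \<bullet> d"
    using pne by (simp add: d_def divide_simps mult.commute)
  have line: "affine hull {p, x} = {x + t *\<^sub>R d | t. True}"
  proof (intro equalityI subsetI)
    fix y assume "y \<in> affine hull {p, x}"
    then obtain u w where "y = u *\<^sub>R p + w *\<^sub>R x" "u + w = 1" unfolding affine_hull_2 by blast
    then have "y = x + u *\<^sub>R (p - x)" by (simp add: algebra_simps scaleR_add_left[symmetric])
    then have "y = x + (u * norm (p - x)) *\<^sub>R d" using pne by (simp add: d_def)
    then show "y \<in> {x + t *\<^sub>R d | t. True}" by blast
  next
    fix y assume "y \<in> {x + t *\<^sub>R d | t. True}"
    then obtain t where "y = x + t *\<^sub>R d" by blast
    then have "y = (t / norm (p - x)) *\<^sub>R p + (1 - t / norm (p - x)) *\<^sub>R x"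
      by (simp add: d_def divide_inverse algebra_simps)
    then show "y \<in> affine hull {p, x}" unfolding affine_hull_2
      by (intro CollectI exI[of _ "t / norm (p - x)"] exI[of _ "1 - t / norm (p - x)"]) simp
  qed
  have "\<exists>Q. nearest_intersections \<Omega> {x + t *\<^sub>R d | t. True} x = {Q} \<and> norm (Q - x) \<le> 4 * \<epsilon> / (1 / (4 * \<sigma>)) * h"
  proof (rule transversal_line[OF flat op afr d1 nd \<epsilon>(1) _ diameter_pos hr _ xn])
    show "4 * \<epsilon> \<le> 1 / (4 * \<sigma>)" using \<epsilon> \<sigma>_pos by (simp add: field_simps)
    show "norm (x - a) \<le> h" using dist_le_diameter xT a vertices_props(5) by blast
  qed
  then show ?thesis unfolding line by (simp add: mult_ac)
qed

text \<open>A conormal is parallel to its face, hence to the boundary up to an error, and enters the element at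
  a definite rate in the coordinate of the third vertex \<open>c\<close>.\<close>

lemma conormal_props:
  assumes C: "C = {a, b, c, p}" and con: "conormal (convex hull {a, b}) (convex hull {a, b, c}) u"
    and flat: "flat_at \<Omega> \<epsilon> r a n" and op: "open \<Omega>" and fr: "{a, b, c} \<subseteq> frontier \<Omega>" and hr: "h < r" and \<epsilon>: "0 < \<epsilon>"
  shows "bgrad T p \<bullet> u = 0" and "1 / h \<le> bgrad T c \<bullet> u" and "\<bar>n \<bullet> u\<bar> \<le> 2 * \<sigma> * \<epsilon>"
    and "u \<bullet> (b - a) = 0" and "norm u = 1"
proof -
  have dist: "a \<noteq> b" "a \<noteq> c" "a \<noteq> p" "b \<noteq> c" "b \<noteq> p" "c \<noteq> p"
    using vertices_props(3) unfolding C by (auto simp: card_insert_if split: if_splits)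
  obtain y t where u1: "norm u = 1" and orth: "\<And>y z. y \<in> convex hull {a, b} \<Longrightarrow> z \<in> convex hull {a, b} \<Longrightarrow> u \<bullet> (y - z) = 0"
    and y: "y \<in> convex hull {a, b}" "0 < t" "y + t *\<^sub>R u \<in> convex hull {a, b, c}"
    using con unfolding conormal_def by blast
  show "norm u = 1" by (rule u1)
  show ub: "u \<bullet> (b - a) = 0" by (intro orth hull_inc) auto
  have y0: "bary T p y = 0" "bary T c y = 0"
    using y(1) mem_hull_iff_bary[of "{a, b}" y] dist unfolding C by auto
  have y1: "bary T p (y + t *\<^sub>R u) = 0" "0 \<le> bary T c (y + t *\<^sub>R u)"
    using y(3) mem_hull_iff_bary[of "{a, b, c}" "y + t *\<^sub>R u"] mem_iff_bary[of "y + t *\<^sub>R u"] dist unfolding C by auto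
  have "t * (bgrad T p \<bullet> u) = 0" using bary_diff[of T p "y + t *\<^sub>R u" y] y0 y1 by simp
  then show gp: "bgrad T p \<bullet> u = 0" using y(2) by simp
  have "0 \<le> t * (bgrad T c \<bullet> u)" using bary_diff[of T c "y + t *\<^sub>R u" y] y0 y1 by simp
  then have gc: "0 \<le> bgrad T c \<bullet> u" using y(2) by (simp add: zero_le_mult_iff)
  have u_eq: "u = (bgrad T b \<bullet> u) *\<^sub>R (b - a) + (bgrad T c \<bullet> u) *\<^sub>R (c - a)"
    using bgrad_expansion[of u a] dist gp unfolding C by (simp add: algebra_simps)
  have dT: "norm (v - a) \<le> h" if "v \<in> C" for v
    using dist_le_diameter that vertices_props(5) C by blast
  have "1 = u \<bullet> u" using u1 by (simp add: power2_norm_eq_inner[symmetric])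
  also have "\<dots> = (bgrad T c \<bullet> u) * (u \<bullet> (c - a))"
    by (subst (2) u_eq) (simp add: inner_add_right ub)
  also have "u \<bullet> (c - a) \<le> h"
    using norm_cauchy_schwarz[of u "c - a"] u1 dT[of c] C by simp
  then have "(bgrad T c \<bullet> u) * (u \<bullet> (c - a)) \<le> (bgrad T c \<bullet> u) * h" using gc by (rule mult_left_mono)
  finally show "1 / h \<le> bgrad T c \<bullet> u" using diameter_pos by (simp add: field_simps)
  have aa: "norm (a - a) < r" using hr diameter_pos by simp
  have nv: "\<bar>n \<bullet> (v - a)\<bar> \<le> \<epsilon> * h" if v: "v \<in> {b, c}" for v
  proof -
    have "\<bar>n \<bullet> (v - a)\<bar> \<le> \<epsilon> * norm (v - a)"
      using flat_atD(1)[OF flat op _ aa, of v] fr dT[of v] v hr C by auto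
    also have "\<dots> \<le> \<epsilon> * h" using dT[of v] v \<epsilon> C by (intro mult_left_mono) auto
    finally show ?thesis .
  qed
  have gu: "\<bar>bgrad T v \<bullet> u\<bar> \<le> \<sigma> / h" if "v \<in> C" for v using bgrad_inner_bound[OF that, of u] u1 by simp
  have prd: "\<bar>(bgrad T v \<bullet> u) * (n \<bullet> (v - a))\<bar> \<le> \<sigma> * \<epsilon>" if v: "v \<in> {b, c}" for v
  proof -
    have "\<bar>bgrad T v \<bullet> u\<bar> * \<bar>n \<bullet> (v - a)\<bar> \<le> (\<sigma> / h) * (\<epsilon> * h)"
      using gu[of v] nv[OF v] v C \<sigma>_pos diameter_pos by (intro mult_mono) auto
    then show ?thesis using diameter_pos by (simp add: abs_mult)
  qed
  have "n \<bullet> u = (bgrad T b \<bullet> u) * (n \<bullet> (b - a)) + (bgrad T c \<bullet> u) * (n \<bullet> (c - a))"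
    by (subst u_eq) (simp add: inner_add_right)
  then show "\<bar>n \<bullet> u\<bar> \<le> 2 * \<sigma> * \<epsilon>" using prd[of b] prd[of c] by simp
qed

lemma wedge_interior:
  assumes C: "C = {a, b, c, p}" and w: "0 < bgrad T c \<bullet> w" "0 < bgrad T p \<bullet> w"
  shows "\<exists>s0>0. \<forall>s. 0 < s \<and> s < s0 \<longrightarrow> midpoint a b + s *\<^sub>R w \<in> interior T"
proof -
  have dist: "a \<noteq> b" "a \<noteq> c" "a \<noteq> p" "b \<noteq> c" "b \<noteq> p" "c \<noteq> p"
    using vertices_props(3) unfolding C by (auto simp: card_insert_if split: if_splits)
  have mid: "bary T v (midpoint a b) = (bary T v a + bary T v b) / 2" for v
    by (simp add: bary_def midpoint_def inner_add_right field_simps)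
  \<comment> \<open>The summand 1 avoids a division by zero.\<close>
  define m where "m = norm w + 1"
  have m: "0 < m" "norm w \<le> m" using norm_ge_zero[of w] by (auto simp: m_def intro: add_nonneg_pos)
  define s0 where "s0 = h / (4 * \<sigma> * m)"
  have s0: "0 < s0" unfolding s0_def using m \<sigma>_pos diameter_pos by simp
  have "midpoint a b + s *\<^sub>R w \<in> interior T" if s: "0 < s" "s < s0" for s
  proof (rule interior_if_bary_pos, rule ballI)
    fix v assume v: "v \<in> C"
    have eq: "bary T v (midpoint a b + s *\<^sub>R w) = (bary T v a + bary T v b) / 2 + s * (bgrad T v \<bullet> w)"
      using bary_diff[of T v "midpoint a b + s *\<^sub>R w" "midpoint a b"] mid[of v] by simp
    show "0 < bary T v (midpoint a b + s *\<^sub>R w)"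
    proof (cases "v = a \<or> v = b")
      case True
      then have "bary T v a + bary T v b = 1"
        using bary_vertex[OF v, of a] bary_vertex[OF v, of b] C dist by auto
      moreover have "s * \<bar>bgrad T v \<bullet> w\<bar> < 1 / 2"
      proof -
        have "\<sigma> / h * norm w \<le> \<sigma> / h * m"
          using m(2) \<sigma>_pos diameter_pos by (intro mult_left_mono) auto
        then have "\<bar>bgrad T v \<bullet> w\<bar> \<le> \<sigma> / h * m"
          using bgrad_inner_bound[OF v, of w] by linarith
        then have "s * \<bar>bgrad T v \<bullet> w\<bar> \<le> s0 * (\<sigma> / h * m)"
          using s s0 by (intro mult_mono) auto
        also have "\<dots> = 1 / 4" unfolding s0_def using m(1) diameter_pos \<sigma>_pos
          by (simp add: field_simps)
        finally show ?thesis by simp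
      qed
      then have "s * (- (bgrad T v \<bullet> w)) < 1 / 2"
        using mult_left_mono[OF abs_ge_minus_self[of "bgrad T v \<bullet> w"], of s] s(1) by linarith
      ultimately show ?thesis unfolding eq by simp
    next
      case False
      then have "v = c \<or> v = p" using v C by auto
      moreover have "bary T v a + bary T v b = 0"
        using bary_vertex[OF v, of a] bary_vertex[OF v, of b] C False by auto
      ultimately show ?thesis unfolding eq using w s(1) by auto
    qed
  qed
  then show ?thesis using s0 by blast
qed

end

text \<open>If the two faces were almost folded on each other, then the direction \<open>u1 + \<kappa> *\<^sub>R n\<close>, with a moderate
  slope \<open>\<kappa>\<close> above the first face, would enter both elements from the midpoint of the common edge.\<close>

lemma thin_dihedral_overlap:
  assumes T1: "shape_regular_tetrahedron T1 \<sigma>" and T2: "shape_regular_tetrahedron T2 \<sigma>"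
    and C1: "vertices T1 = {a, b, c1, p1}" and C2: "vertices T2 = {a, b, c2, p2}"
    and con1: "conormal (convex hull {a, b}) (convex hull {a, b, c1}) u1"
    and con2: "conormal (convex hull {a, b}) (convex hull {a, b, c2}) u2"
    and flat: "flat_at \<Omega> \<epsilon> r a n" and op: "open \<Omega>" and fr: "{a, b, c1, c2} \<subseteq> frontier \<Omega>"
    and ap: "{p1, p2} \<subseteq> \<Omega>" and hr: "diameter T1 < r" "diameter T2 < r" and \<epsilon>: "0 < \<epsilon>" "8 * \<epsilon> * \<sigma> \<le> 1"
    and close: "norm (u1 - u2) < 1 / (8 * \<sigma>\<^sup>2)"
  shows "interior T1 \<inter> interior T2 \<noteq> {}"
proof -
  interpret A1: shape_regular_tetrahedron T1 \<sigma> by (rule T1)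
  interpret A2: shape_regular_tetrahedron T2 \<sigma> by (rule T2)
  have notfr: "v \<notin> frontier \<Omega>" if "v \<in> \<Omega>" for v
    using that op by (simp add: frontier_def interior_open)
  \<comment> \<open>The slope is small enough to keep the rate in the coordinate of the third vertex positive.\<close>
  define \<kappa> where "\<kappa> = 1 / (4 * \<sigma>)"
  define w where "w = u1 + \<kappa> *\<^sub>R n"
  have \<kappa>: "0 < \<kappa>" using A1.\<sigma>_pos by (simp add: \<kappa>_def)
  have n1: "norm n = 1" using flat by (simp add: flat_at_def)
  let ?h1 = "diameter T1" and ?h2 = "diameter T2"
  have p1: "bgrad T1 p1 \<bullet> u1 = 0" "1 / ?h1 \<le> bgrad T1 c1 \<bullet> u1"
    using A1.conormal_props[OF C1 con1 flat op _ hr(1) \<epsilon>(1)] fr by auto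
  have p2: "bgrad T2 p2 \<bullet> u2 = 0" "1 / ?h2 \<le> bgrad T2 c2 \<bullet> u2"
    using A2.conormal_props[OF C2 con2 flat op _ hr(2) \<epsilon>(1)] fr by auto
  have n_1: "1 / (2 * ?h1) \<le> bgrad T1 p1 \<bullet> n"
    by (rule A1.apex_height(2)[OF flat op _ _ _ _ _ hr(1) \<epsilon>]) (use C1 fr ap notfr in auto)
  have n_2: "1 / (2 * ?h2) \<le> bgrad T2 p2 \<bullet> n"
    by (rule A2.apex_height(2)[OF flat op _ _ _ _ _ hr(2) \<epsilon>]) (use C2 fr ap notfr in auto)
  have k1: "\<kappa> * \<bar>bgrad T1 c1 \<bullet> n\<bar> \<le> 1 / 4 * (1 / ?h1)"
  proof -
    have "\<kappa> * \<bar>bgrad T1 c1 \<bullet> n\<bar> \<le> \<kappa> * (\<sigma> / ?h1)"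
      using A1.bgrad_inner_bound[of c1 n] C1 n1 \<kappa> by (intro mult_left_mono) auto
    then show ?thesis using A1.\<sigma>_pos by (simp add: \<kappa>_def)
  qed
  have k2: "\<kappa> * \<bar>bgrad T2 c2 \<bullet> n\<bar> \<le> 1 / 4 * (1 / ?h2)"
  proof -
    have "\<kappa> * \<bar>bgrad T2 c2 \<bullet> n\<bar> \<le> \<kappa> * (\<sigma> / ?h2)"
      using A2.bgrad_inner_bound[of c2 n] C2 n1 \<kappa> by (intro mult_left_mono) auto
    then show ?thesis using A1.\<sigma>_pos by (simp add: \<kappa>_def)
  qed
  have h1: "0 < 1 / ?h1" and h2: "0 < 1 / ?h2" using A1.diameter_pos A2.diameter_pos by auto
  have "0 < bgrad T1 c1 \<bullet> w"
  proof -
    have "- (\<kappa> * \<bar>bgrad T1 c1 \<bullet> n\<bar>) \<le> \<kappa> * (bgrad T1 c1 \<bullet> n)" using \<kappa> by (simp add: abs_if)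
    then show ?thesis unfolding w_def inner_add_right inner_scaleR_right using p1(2) k1 h1 by linarith
  qed
  moreover have "0 < bgrad T1 p1 \<bullet> w"
  proof -
    have "0 < bgrad T1 p1 \<bullet> n" using n_1 h1 by (metis A1.diameter_pos divide_pos_pos less_le_trans mult_pos_pos zero_less_numeral zero_less_one)
    then show ?thesis unfolding w_def inner_add_right inner_scaleR_right using p1(1) \<kappa> by simp
  qed
  ultimately obtain s1 where s1: "0 < s1" "\<And>s. 0 < s \<Longrightarrow> s < s1 \<Longrightarrow> midpoint a b + s *\<^sub>R w \<in> interior T1"
    using A1.wedge_interior[OF C1] by blast
  have w2: "w = u2 + \<kappa> *\<^sub>R n + (u1 - u2)" by (simp add: w_def)
  have d2: "\<bar>bgrad T2 v \<bullet> (u1 - u2)\<bar> < \<kappa> * (1 / (2 * ?h2))" if "v \<in> vertices T2" for v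
  proof -
    have "\<bar>bgrad T2 v \<bullet> (u1 - u2)\<bar> \<le> \<sigma> / ?h2 * norm (u1 - u2)" by (rule A2.bgrad_inner_bound[OF that])
    also have "\<dots> < \<sigma> / ?h2 * (1 / (8 * \<sigma>\<^sup>2))"
      using close A1.\<sigma>_pos A2.diameter_pos by (intro mult_strict_left_mono) auto
    also have "\<dots> = \<kappa> * (1 / (2 * ?h2))"
      using A1.\<sigma>_pos A2.diameter_pos by (simp add: \<kappa>_def power2_eq_square field_simps)
    finally show ?thesis .
  qed
  have "0 < bgrad T2 c2 \<bullet> w"
  proof -
    have "- (\<kappa> * \<bar>bgrad T2 c2 \<bullet> n\<bar>) \<le> \<kappa> * (bgrad T2 c2 \<bullet> n)" using \<kappa> by (simp add: abs_if)
    moreover have "\<kappa> * (1 / (2 * ?h2)) \<le> 1 / 8 * (1 / ?h2)"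
    proof -
      have "\<kappa> \<le> 1 / 4" using A1.\<sigma>_ge_1 by (simp add: \<kappa>_def)
      then have "\<kappa> * (1 / (2 * ?h2)) \<le> 1 / 4 * (1 / (2 * ?h2))" using A2.diameter_pos by (intro mult_right_mono) auto
      then show ?thesis by simp
    qed
    moreover have "\<bar>bgrad T2 c2 \<bullet> (u1 - u2)\<bar> < \<kappa> * (1 / (2 * ?h2))" using d2[of c2] C2 by simp
    ultimately show ?thesis unfolding w2 inner_add_right[of _ _ "u1 - u2"] inner_add_right[of _ u2] inner_scaleR_right
      using p2(2) k2 h2 by linarith
  qed
  moreover have "0 < bgrad T2 p2 \<bullet> w"
  proof -
    have "\<kappa> * (1 / (2 * ?h2)) \<le> \<kappa> * (bgrad T2 p2 \<bullet> n)" using n_2 \<kappa> by (intro mult_left_mono) auto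
    then show ?thesis unfolding w2 inner_add_right[of _ _ "u1 - u2"] inner_add_right[of _ u2] inner_scaleR_right
      using p2(1) d2[of p2] C2 by (simp add: abs_less_iff)
  qed
  ultimately obtain s2 where s2: "0 < s2" "\<And>s. 0 < s \<Longrightarrow> s < s2 \<Longrightarrow> midpoint a b + s *\<^sub>R w \<in> interior T2"
    using A2.wedge_interior[OF C2] by blast
  define s where "s = min s1 s2 / 2"
  have "midpoint a b + s *\<^sub>R w \<in> interior T1" by (rule s1(2)) (use s1(1) s2(1) in \<open>auto simp: s_def min_def\<close>)
  moreover have "midpoint a b + s *\<^sub>R w \<in> interior T2" by (rule s2(2)) (use s1(1) s2(1) in \<open>auto simp: s_def min_def\<close>)
  ultimately show ?thesis by blast
qed

lemma orthonormal_expansion: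
  fixes x p q d :: "real^3"
  assumes "norm p = 1" "norm q = 1" "norm d = 1" "p \<bullet> q = 0" "p \<bullet> d = 0" "q \<bullet> d = 0"
  shows "x = (x \<bullet> p) *\<^sub>R p + (x \<bullet> q) *\<^sub>R q + (x \<bullet> d) *\<^sub>R d"
proof -
  have ne: "p \<noteq> q" "p \<noteq> d" "q \<noteq> d" using assms by (auto simp: power2_norm_eq_inner[symmetric])
  have orth: "pairwise orthogonal {p, q, d}"
    using assms by (auto simp: pairwise_insert orthogonal_def inner_commute)
  have n0: "0 \<notin> {p, q, d}" using assms by auto
  have ind: "independent {p, q, d}" by (rule pairwise_orthogonal_independent[OF orth n0])
  have "card {p, q, d} = DIM(real^3)" using ne by simp
  then have "x \<in> span {p, q, d}"
    using card_ge_dim_independent[of "{p, q, d}" UNIV] ind by auto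
  then have 1: "(\<Sum>v\<in>{p, q, d}. (x \<bullet> v) *\<^sub>R v) = x"
    using assms by (intro orthonormal_basis_expand[OF orth]) auto
  have 2: "(\<Sum>v\<in>{p, q, d}. (x \<bullet> v) *\<^sub>R v) = (x \<bullet> p) *\<^sub>R p + (x \<bullet> q) *\<^sub>R q + (x \<bullet> d) *\<^sub>R d"
    using ne by (simp add: add.assoc)
  show ?thesis by (rule trans[OF 1[symmetric] 2])
qed

lemma orthonormal_inner:
  fixes x y p q d :: "real^3"
  assumes "norm p = 1" "norm q = 1" "norm d = 1" "p \<bullet> q = 0" "p \<bullet> d = 0" "q \<bullet> d = 0"
  shows "x \<bullet> y = (x \<bullet> p) * (y \<bullet> p) + (x \<bullet> q) * (y \<bullet> q) + (x \<bullet> d) * (y \<bullet> d)"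
proof -
  have "x \<bullet> y = ((x \<bullet> p) *\<^sub>R p + (x \<bullet> q) *\<^sub>R q + (x \<bullet> d) *\<^sub>R d) \<bullet> y"
    by (rule arg_cong[where f = "\<lambda>v. v \<bullet> y", OF orthonormal_expansion[OF assms]])
  also have "\<dots> = (x \<bullet> p) * (y \<bullet> p) + (x \<bullet> q) * (y \<bullet> q) + (x \<bullet> d) * (y \<bullet> d)"
    by (simp add: inner_add_left inner_add_right inner_commute)
  finally show ?thesis .
qed

text \<open>In the plane orthogonal to the edge, let \<open>N\<close> be the normal of \<open>P\<close> and let \<open>d\<close> be the direction of the line.
  If \<open>d\<close> were almost tangential to the boundary, \<open>N\<close> would be almost parallel to the normal \<open>n\<close>. Both conormals are
  almost orthogonal to \<open>n\<close>, hence to \<open>N\<close>, and the condition on the bisector would make \<open>u1 - u2\<close> small, so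
  that the elements would overlap.\<close>

lemma edge_node_displacement:
  assumes T1: "shape_regular_tetrahedron T1 \<sigma>" and T2: "shape_regular_tetrahedron T2 \<sigma>"
    and C1: "vertices T1 = {a, b, c1, p1}" and C2: "vertices T2 = {a, b, c2, p2}"
    and bis: "near_bisector \<theta> (convex hull {a, b}) (convex hull {a, b, c1}) (convex hull {a, b, c2}) P"
    and P: "affine P" "aff_dim P = 2" "convex hull {a, b} \<subseteq> P"
    and flat: "flat_at \<Omega> \<epsilon> r a n" and op: "open \<Omega>" and fr: "{a, b, c1, c2} \<subseteq> frontier \<Omega>"
    and ap: "{p1, p2} \<subseteq> \<Omega>" and hr: "2 * diameter T1 < r" "2 * diameter T2 < r"
    and \<theta>: "0 < cos \<theta>" and \<epsilon>: "0 < \<epsilon>" "\<epsilon> \<le> cos \<theta> / (256 * \<sigma> ^ 3)"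
    and disj: "interior T1 \<inter> interior T2 = {}" and x: "x \<in> convex hull {a, b}"
  shows "\<exists>Q. nearest_intersections \<Omega> (orthogonal_line P (convex hull {a, b}) x) x = {Q} \<and>
           norm (Q - x) \<le> 256 * \<sigma>\<^sup>2 / cos \<theta> * \<epsilon> * norm (b - a)"
proof -
  interpret A1: shape_regular_tetrahedron T1 \<sigma> by (rule T1)
  interpret A2: shape_regular_tetrahedron T2 \<sigma> by (rule T2)
  let ?e = "convex hull {a, b}"
  have \<sigma>: "1 \<le> \<sigma>" "0 < \<sigma>" using A1.\<sigma>_ge_1 by auto
  have cos1: "cos \<theta> \<le> 1" by simp
  have \<epsilon>\<sigma>: "256 * (\<epsilon> * \<sigma> ^ 3) \<le> cos \<theta>" using \<epsilon>(2) \<sigma> by (simp add: field_simps)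
  have \<epsilon>2: "256 * (\<epsilon> * \<sigma>\<^sup>2) \<le> cos \<theta>" and \<epsilon>1: "256 * (\<epsilon> * \<sigma>) \<le> cos \<theta>" and \<epsilon>0: "256 * \<epsilon> \<le> cos \<theta>"
  proof -
    have "\<sigma> ^ 2 \<le> \<sigma> ^ 3" "\<sigma> ^ 1 \<le> \<sigma> ^ 3" "\<sigma> ^ 0 \<le> \<sigma> ^ 3" using \<sigma>(1) by (intro power_increasing; simp)+
    then have "\<epsilon> * \<sigma> ^ 2 \<le> \<epsilon> * \<sigma> ^ 3" "\<epsilon> * \<sigma> ^ 1 \<le> \<epsilon> * \<sigma> ^ 3" "\<epsilon> * \<sigma> ^ 0 \<le> \<epsilon> * \<sigma> ^ 3" using \<epsilon>(1) by simp_all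
    then show "256 * (\<epsilon> * \<sigma>\<^sup>2) \<le> cos \<theta>" "256 * (\<epsilon> * \<sigma>) \<le> cos \<theta>" "256 * \<epsilon> \<le> cos \<theta>" using \<epsilon>\<sigma> by auto
  qed
  have e8: "8 * \<epsilon> * \<sigma> \<le> 1"
    using \<epsilon>1 cos1 mult_pos_pos[OF \<epsilon>(1) \<sigma>(2)] unfolding mult.assoc by linarith
  have hr': "diameter T1 < r" "diameter T2 < r" using hr A1.diameter_pos A2.diameter_pos by linarith+
  have ab: "a \<noteq> b"
    using A1.vertices_props(3) unfolding C1 by (auto simp: card_insert_if split: if_splits)
  have afr: "a \<in> frontier \<Omega>" "b \<in> frontier \<Omega>" using fr by auto
  have n1: "norm n = 1" using flat by (simp add: flat_at_def)
  obtain u1 u2 N where con: "conormal ?e (convex hull {a, b, c1}) u1" "conormal ?e (convex hull {a, b, c2}) u2"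
    and N: "norm N = 1" "\<And>x y. x \<in> P \<Longrightarrow> y \<in> P \<Longrightarrow> N \<bullet> (x - y) = 0"
    and near: "cos \<theta> * norm (u1 - u2) \<le> \<bar>N \<bullet> (u1 - u2)\<bar>"
    using bis unfolding near_bisector_def by metis
  have pr1: "\<bar>n \<bullet> u1\<bar> \<le> 2 * \<sigma> * \<epsilon>" "u1 \<bullet> (b - a) = 0" "norm u1 = 1"
    using A1.conormal_props[OF C1 con(1) flat op _ hr'(1) \<epsilon>(1)] fr by auto
  have pr2: "\<bar>n \<bullet> u2\<bar> \<le> 2 * \<sigma> * \<epsilon>" "u2 \<bullet> (b - a) = 0" "norm u2 = 1"
    using A2.conormal_props[OF C2 con(2) flat op _ hr'(2) \<epsilon>(1)] fr by auto
  have apart: "1 / (8 * \<sigma>\<^sup>2) \<le> norm (u1 - u2)"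
  proof (rule ccontr)
    assume "\<not> ?thesis"
    then have "interior T1 \<inter> interior T2 \<noteq> {}"
      by (intro thin_dihedral_overlap[OF T1 T2 C1 C2 con flat op fr ap hr' \<epsilon>(1)])
         (use e8 in auto)
    then show False using disj by simp
  qed
  define \<tau> where "\<tau> = (b - a) /\<^sub>R norm (b - a)"
  have \<tau>1: "norm \<tau> = 1" using ab by (simp add: \<tau>_def)
  have ba: "b - a = norm (b - a) *\<^sub>R \<tau>" using ab by (simp add: \<tau>_def)
  have eP: "a \<in> P" "b \<in> P" using P(3) hull_subset[of "{a, b}" convex] by auto
  have N\<tau>: "N \<bullet> \<tau> = 0" using N(2)[OF eP(2,1)] by (simp add: \<tau>_def)
  have u\<tau>: "u1 \<bullet> \<tau> = 0" "u2 \<bullet> \<tau> = 0" using pr1(2) pr2(2) by (simp_all add: \<tau>_def)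
  have "dim {N, \<tau>} < DIM(real^3)"
    using dim_le_card'[of "{N, \<tau>}"] by (auto simp: card_insert_if split: if_splits)
  then obtain d0 where d0: "d0 \<noteq> 0" "\<And>y. y \<in> span {N, \<tau>} \<Longrightarrow> orthogonal d0 y"
    using orthogonal_to_subspace_exists[of "{N, \<tau>}"] by blast
  define d1 where "d1 = d0 /\<^sub>R norm d0"
  have d1: "norm d1 = 1" "N \<bullet> d1 = 0" "\<tau> \<bullet> d1 = 0"
    using d0(1) d0(2)[of N] d0(2)[of \<tau>] by (auto simp: d1_def orthogonal_def inner_commute span_base)
  \<comment> \<open>The sign of the direction is chosen such that it points to the side of the normal.\<close>
  define d where "d = (if 0 \<le> n \<bullet> d1 then d1 else - d1)"
  have d: "norm d = 1" "N \<bullet> d = 0" "\<tau> \<bullet> d = 0" "0 \<le> n \<bullet> d" using d1 by (auto simp: d_def)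
  have \<tau>N: "\<tau> \<bullet> N = 0" using N\<tau> by (simp add: inner_commute)
  have aa: "norm (a - a) < r" using hr' A1.diameter_pos by simp
  have bal: "norm (b - a) \<le> diameter T1"
    using A1.dist_le_diameter C1 A1.vertices_props(5) by blast
  have nba: "\<bar>n \<bullet> (b - a)\<bar> \<le> \<epsilon> * norm (b - a)"
    using flat_atD(1)[OF flat op afr(1) aa _ afr(2)] bal hr'(1) by simp
  have n\<tau>: "\<bar>n \<bullet> \<tau>\<bar> \<le> \<epsilon>"
  proof -
    have "\<bar>n \<bullet> \<tau>\<bar> = \<bar>n \<bullet> (b - a)\<bar> / norm (b - a)" by (simp add: \<tau>_def abs_mult divide_inverse mult.commute)
    also have "\<dots> \<le> \<epsilon>" using nba ab by (simp add: divide_le_eq)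
    finally show ?thesis .
  qed
  define c where "c = cos \<theta> / (64 * \<sigma>\<^sup>2)"
  have c0: "0 < c" using \<theta> \<sigma> by (simp add: c_def)
  have c64: "64 * (c * \<sigma>\<^sup>2) = cos \<theta>" using \<sigma> by (simp add: c_def)
  have \<sigma>2: "1 \<le> \<sigma>\<^sup>2" using \<sigma>(1) by simp
  have c_le: "64 * c \<le> 1"
    using mult_left_mono[OF \<sigma>2, of c] c0 c64 cos1 by linarith
  \<comment> \<open>With a smaller slope the conormals would be closer to each other than the overlap lemma permits.\<close>
  have cn: "c \<le> n \<bullet> d"
  proof (rule ccontr)
    assume "\<not> ?thesis"
    then have small: "\<bar>n \<bullet> d\<bar> < c" using d(4) by simp
    have "1 = n \<bullet> n" using n1 by (simp add: power2_norm_eq_inner[symmetric])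
    also have "\<dots> = (n \<bullet> \<tau>)\<^sup>2 + (n \<bullet> N)\<^sup>2 + (n \<bullet> d)\<^sup>2"
      using orthonormal_inner[OF \<tau>1 N(1) d(1) \<tau>N d(3) d(2), of n n] by (simp add: power2_eq_square)
    finally have sq: "1 = (n \<bullet> \<tau>)\<^sup>2 + (n \<bullet> N)\<^sup>2 + (n \<bullet> d)\<^sup>2" .
    have s1: "(n \<bullet> \<tau>)\<^sup>2 \<le> (1/4)\<^sup>2" using n\<tau> \<epsilon>0 cos1 by (intro power2_le_iff_abs_le[THEN iffD2]; linarith)
    have s2: "(n \<bullet> d)\<^sup>2 \<le> (1/4)\<^sup>2" using small c_le by (intro power2_le_iff_abs_le[THEN iffD2]) auto
    have "(1/2)\<^sup>2 \<le> (n \<bullet> N)\<^sup>2" using sq s1 s2 by (simp add: power2_eq_square)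
    then have nN: "1 / 2 \<le> \<bar>n \<bullet> N\<bar>" using abs_le_square_iff[of "1/2" "n \<bullet> N"] by simp
    have uN: "\<bar>N \<bullet> u\<bar> \<le> 4 * \<sigma> * \<epsilon> + 2 * c" if u: "\<bar>n \<bullet> u\<bar> \<le> 2 * \<sigma> * \<epsilon>" "u \<bullet> \<tau> = 0" "norm u = 1" for u
    proof -
      have "n \<bullet> u = (n \<bullet> N) * (u \<bullet> N) + (n \<bullet> d) * (u \<bullet> d)"
        using orthonormal_inner[OF \<tau>1 N(1) d(1) \<tau>N d(3) d(2), of n u] u(2) by simp
      moreover have "\<bar>(n \<bullet> d) * (u \<bullet> d)\<bar> \<le> c * 1"
        unfolding abs_mult using small Cauchy_Schwarz_ineq2[of u d] u(3) d(1) by (intro mult_mono) auto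
      ultimately have "\<bar>n \<bullet> N\<bar> * \<bar>u \<bullet> N\<bar> \<le> 2 * \<sigma> * \<epsilon> + c"
        using u(1) unfolding abs_mult[symmetric] by linarith
      moreover have "1 / 2 * \<bar>u \<bullet> N\<bar> \<le> \<bar>n \<bullet> N\<bar> * \<bar>u \<bullet> N\<bar>" using nN by (intro mult_right_mono) auto
      ultimately show ?thesis by (simp add: inner_commute)
    qed
    have "\<bar>N \<bullet> (u1 - u2)\<bar> \<le> 8 * (\<epsilon> * \<sigma>) + 4 * c"
      using uN[OF pr1(1) u\<tau>(1) pr1(3)] uN[OF pr2(1) u\<tau>(2) pr2(3)] by (simp add: inner_diff_right mult_ac)
    then have "cos \<theta> * norm (u1 - u2) \<le> 8 * (\<epsilon> * \<sigma>) + 4 * c" using near by linarith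
    moreover have "cos \<theta> * (1 / (8 * \<sigma>\<^sup>2)) \<le> cos \<theta> * norm (u1 - u2)" using apart \<theta> by (intro mult_left_mono) auto
    moreover have "cos \<theta> * (1 / (8 * \<sigma>\<^sup>2)) = 8 * c" by (simp add: c_def)
    moreover have "8 * (\<epsilon> * \<sigma>) < 4 * c"
    proof -
      have "256 * (\<epsilon> * \<sigma>) * \<sigma>\<^sup>2 \<le> 64 * c * \<sigma>\<^sup>2"
        using \<epsilon>\<sigma> c64 by (simp add: power3_eq_cube power2_eq_square mult_ac)
      then have "256 * (\<epsilon> * \<sigma>) \<le> 64 * c" by (rule mult_right_le_imp_le) (use \<sigma> in simp)
      then show ?thesis using \<epsilon>(1) \<sigma>(2) mult_pos_pos[OF \<epsilon>(1) \<sigma>(2)] by linarith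
    qed
    ultimately show False by linarith
  qed
  have xP: "x \<in> P" using x P(3) by blast
  have Nx: "N \<bullet> x = N \<bullet> a" using N(2)[OF xP eP(1)] by (simp add: inner_diff_right)
  have P_eq: "P = {y. N \<bullet> y = N \<bullet> a}"
  proof (rule affine_dim_equal[OF P(1) affine_hyperplane])
    show "P \<noteq> {}" using eP by blast
    show "P \<subseteq> {y. N \<bullet> y = N \<bullet> a}" using N(2)[OF _ eP(1)] by (auto simp: inner_diff_right)
    have "N \<noteq> 0" using N(1) by auto
    then show "aff_dim P = aff_dim {y. N \<bullet> y = N \<bullet> a}" using P(2) by (simp add: aff_dim_hyperplane)
  qed
  have seg: "\<exists>s. y - z = s *\<^sub>R (b - a)" if yz: "y \<in> ?e" "z \<in> ?e" for y z
  proof -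
    obtain s t where st: "y = (1 - s) *\<^sub>R a + s *\<^sub>R b" "z = (1 - t) *\<^sub>R a + t *\<^sub>R b"
      using yz unfolding segment_convex_hull[symmetric] by (auto simp: in_segment)
    have "y - z = (s - t) *\<^sub>R (b - a)" unfolding st by (simp add: algebra_simps)
    then show ?thesis by blast
  qed
  have line: "orthogonal_line P ?e x = {x + t *\<^sub>R d | t. True}"
  proof (intro equalityI subsetI)
    fix y assume "y \<in> orthogonal_line P ?e x"
    then have y: "N \<bullet> y = N \<bullet> a" "(y - x) \<bullet> (b - a) = 0"
      unfolding orthogonal_line_def P_eq using hull_subset[of "{a, b}" convex] by auto
    have "y - x = ((y - x) \<bullet> \<tau>) *\<^sub>R \<tau> + ((y - x) \<bullet> N) *\<^sub>R N + ((y - x) \<bullet> d) *\<^sub>R d"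
      by (rule orthonormal_expansion[OF \<tau>1 N(1) d(1) \<tau>N d(3) d(2)])
    moreover have "(y - x) \<bullet> \<tau> = 0" using y(2) by (simp add: \<tau>_def)
    moreover have "(y - x) \<bullet> N = 0" using y(1) Nx by (simp add: inner_diff_right inner_commute[of _ N])
    ultimately have "y = x + ((y - x) \<bullet> d) *\<^sub>R d" by (simp add: algebra_simps)
    then show "y \<in> {x + t *\<^sub>R d | t. True}" by blast
  next
    fix y assume "y \<in> {x + t *\<^sub>R d | t. True}"
    then obtain t where y: "y = x + t *\<^sub>R d" by blast
    have "y \<in> P" unfolding P_eq using Nx d(2) by (simp add: y inner_add_right)
    moreover have "(y - x) \<bullet> (p - q) = 0" if "p \<in> ?e" "q \<in> ?e" for p q
    proof -
      have "d \<bullet> (b - a) = 0" using d(3) by (subst ba) (simp add: inner_commute)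
      then show ?thesis using seg[OF that] y by auto
    qed
    ultimately show "y \<in> orthogonal_line P ?e x" unfolding orthogonal_line_def by blast
  qed
  obtain s where s: "0 \<le> s" "s \<le> 1" "x = (1 - s) *\<^sub>R a + s *\<^sub>R b"
    using x unfolding segment_convex_hull[symmetric] by (auto simp: in_segment)
  have xa: "x - a = s *\<^sub>R (b - a)" using s(3) by (simp add: algebra_simps)
  have l0: "0 < norm (b - a)" using ab by simp
  have "\<exists>Q. nearest_intersections \<Omega> {x + t *\<^sub>R d | t. True} x = {Q} \<and> norm (Q - x) \<le> 4 * \<epsilon> / c * norm (b - a)"
  proof (rule transversal_line[OF flat op afr(1) d(1) cn \<epsilon>(1) _ l0])
    have "256 * \<epsilon> * \<sigma>\<^sup>2 \<le> 64 * c * \<sigma>\<^sup>2" using \<epsilon>2 c64 by simp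
    then have "256 * \<epsilon> \<le> 64 * c" by (rule mult_right_le_imp_le) (use \<sigma> in simp)
    then show "4 * \<epsilon> \<le> c" by simp
    show "2 * norm (b - a) < r" using bal hr(1) by linarith
    show "norm (x - a) \<le> norm (b - a)" unfolding xa using s(1,2) by (simp add: mult_left_le_one_le)
    have "\<bar>n \<bullet> (x - a)\<bar> = s * \<bar>n \<bullet> (b - a)\<bar>" unfolding xa using s(1) by (simp add: abs_mult)
    also have "\<dots> \<le> 1 * \<bar>n \<bullet> (b - a)\<bar>" using s(2) by (intro mult_right_mono) auto
    finally show "\<bar>n \<bullet> (x - a)\<bar> \<le> \<epsilon> * norm (b - a)" using nba by linarith
  qed
  moreover have "4 * \<epsilon> / c = 256 * \<sigma>\<^sup>2 / cos \<theta> * \<epsilon>" by (simp add: c_def)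
  ultimately show ?thesis unfolding line by simp
qed

section \<open>Faces of a tetrahedron and nodes\<close>

context tetrahedron begin

text \<open>The vertices of the smallest face that contains \<open>x\<close>.\<close>

definition carrier :: "real^3 \<Rightarrow> (real^3) set" where
  "carrier x = {v\<in>C. 0 < bary T v x}"

lemma carrier_subset: "carrier x \<subseteq> C"
  by (auto simp: carrier_def)

lemma independent_subset: "c \<subseteq> C \<Longrightarrow> \<not> affine_dependent c"
  using vertices_props(1) affine_independent_subset by blast

lemma aff_dim_face: "c \<subseteq> C \<Longrightarrow> aff_dim (convex hull c) = int (card c) - 1"
  using aff_dim_affine_independent[OF independent_subset] by (simp add: aff_dim_convex_hull)

lemma aff_dim_T: "aff_dim T = 3"
  using aff_dim_face[of C] vertices_props(3,4) by simp

lemma carrier_face: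
  assumes "x \<in> T"
  shows "convex hull (carrier x) face_of T" "x \<in> rel_interior (convex hull (carrier x))"
    "carrier x \<noteq> {}"
proof -
  show "convex hull (carrier x) face_of T" using face_of_iff carrier_subset by blast
  have z: "bary T v x = 0" if "v \<in> C - carrier x" for v
  proof -
    have "0 \<le> bary T v x" using that assms mem_iff_bary by blast
    then show ?thesis using that by (auto simp: carrier_def)
  qed
  have "sum (\<lambda>v. bary T v x) C = sum (\<lambda>v. bary T v x) (carrier x)"
    "(\<Sum>v\<in>C. bary T v x *\<^sub>R v) = (\<Sum>v\<in>carrier x. bary T v x *\<^sub>R v)"
    using carrier_subset vertices_props(2) z by (auto intro!: sum.mono_neutral_right)
  then have s: "sum (\<lambda>v. bary T v x) (carrier x) = 1" "(\<Sum>v\<in>carrier x. bary T v x *\<^sub>R v) = x"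
    by (simp_all add: bary_expansion)
  show "x \<in> rel_interior (convex hull (carrier x))"
    unfolding rel_interior_convex_hull_explicit[OF independent_subset[OF carrier_subset]]
    using s by (intro CollectI exI[of _ "\<lambda>v. bary T v x"]) (auto simp: carrier_def)
  show "carrier x \<noteq> {}" using s(1) by auto
qed

lemma carrier_minimal: "c \<subseteq> C \<Longrightarrow> x \<in> convex hull c \<Longrightarrow> carrier x \<subseteq> c"
  using mem_hull_iff_bary[of c x] by (force simp: carrier_def)

lemma mem_carrier_hull: "x \<in> T \<Longrightarrow> x \<in> convex hull (carrier x)"
  using carrier_face(2) rel_interior_subset by blast

lemma carrier_singleton: assumes "x \<in> T" "card (carrier x) = 1" shows "x \<in> C"
proof -
  obtain v where v: "carrier x = {v}" using assms(2) card_1_singletonE by blast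
  then have "x = v" using mem_carrier_hull[OF assms(1)] by simp
  then show ?thesis using v carrier_subset by blast
qed

lemma carrier_vertex: "x \<in> C \<Longrightarrow> carrier x = {x}"
  by (auto simp: carrier_def bary_vertex split: if_splits)

lemma facet_iff: "F facet_of T \<longleftrightarrow> (\<exists>c\<subseteq>C. card c = 3 \<and> F = convex hull c)"
proof
  assume "F facet_of T"
  then obtain c where c: "c \<subseteq> C" "F = convex hull c" "aff_dim F = 2"
    unfolding facet_of_def aff_dim_T face_of_iff by auto
  then show "\<exists>c\<subseteq>C. card c = 3 \<and> F = convex hull c"
    using aff_dim_face[OF c(1)] by (intro exI[of _ c]) auto
next
  assume "\<exists>c\<subseteq>C. card c = 3 \<and> F = convex hull c"
  then obtain c where c: "c \<subseteq> C" "card c = 3" "F = convex hull c" by blast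
  then show "F facet_of T"
    unfolding facet_of_def aff_dim_T face_of_iff using aff_dim_face[OF c(1)] by auto
qed

lemma edge_iff: "e edge_of T \<longleftrightarrow> (\<exists>c\<subseteq>C. card c = 2 \<and> e = convex hull c)"
proof
  assume "e edge_of T"
  then obtain c where c: "c \<subseteq> C" "e = convex hull c" "aff_dim e = 1"
    unfolding edge_of_def face_of_iff by auto
  then show "\<exists>c\<subseteq>C. card c = 2 \<and> e = convex hull c"
    using aff_dim_face[OF c(1)] by (intro exI[of _ c]) auto
next
  assume "\<exists>c\<subseteq>C. card c = 2 \<and> e = convex hull c"
  then obtain c where c: "c \<subseteq> C" "card c = 2" "e = convex hull c" by blast
  then show "e edge_of T"
    unfolding edge_of_def face_of_iff using aff_dim_face[OF c(1)] by auto
qed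

lemma edge_of_face_iff:
  assumes "c \<subseteq> C"
  shows "e edge_of (convex hull c) \<longleftrightarrow> (\<exists>b\<subseteq>c. card b = 2 \<and> e = convex hull b)"
proof
  assume "e edge_of (convex hull c)"
  then obtain b where b: "b \<subseteq> c" "e = convex hull b" "aff_dim e = 1"
    using face_of_convex_hull_affine_independent[OF independent_subset[OF assms], of e]
    unfolding edge_of_def by auto
  then show "\<exists>b\<subseteq>c. card b = 2 \<and> e = convex hull b"
    using aff_dim_face[of b] assms by (intro exI[of _ b]) auto
next
  assume "\<exists>b\<subseteq>c. card b = 2 \<and> e = convex hull b"
  then obtain b where b: "b \<subseteq> c" "card b = 2" "e = convex hull b" by blast
  then show "e edge_of (convex hull c)"
    using face_of_convex_hull_affine_independent[OF independent_subset[OF assms], of e] aff_dim_face[of b] assms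
    unfolding edge_of_def by auto
qed

lemma finite_edges: "finite {e. e edge_of T \<and> P e}"
proof (rule finite_subset)
  show "{e. e edge_of T \<and> P e} \<subseteq> (\<lambda>c. convex hull c) ` Pow C" using edge_iff by auto
qed (simp add: vertices_props(2))

lemma vertices_face: "c \<subseteq> C \<Longrightarrow> vertices (convex hull c) = c"
  using vertices_convex_hull[OF independent_subset] .

lemma lattice_face_hull:
  "k > 0 \<Longrightarrow> c \<subseteq> C \<Longrightarrow> lattice_points k (convex hull c) = lattice_points k T \<inter> convex hull c"
  using lattice_face face_of_iff by blast

end

section \<open>The polyhedron covered by a mesh\<close>

locale mesh_in_domain =
  fixes \<Omega> :: "(real^3) set" and M :: "(real^3) set set"
  assumes op: "open \<Omega>" and fitted: "fitted_mesh \<Omega> M"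
begin

lemma finite_M: "finite M"
  using fitted unfolding fitted_mesh_def by (elim conjE)

lemma simplex_M: "T \<in> M \<Longrightarrow> tetrahedron T"
  unfolding tetrahedron_def using fitted unfolding fitted_mesh_def by (elim conjE) (erule bspec)

lemma conform: "T \<in> M \<Longrightarrow> T' \<in> M \<Longrightarrow> T \<inter> T' face_of T"
proof -
  have "\<forall>T \<in> M. \<forall>T' \<in> M. T \<inter> T' face_of T \<and> T \<inter> T' face_of T'"
    using fitted unfolding fitted_mesh_def by (elim conjE)
  then show "T \<in> M \<Longrightarrow> T' \<in> M \<Longrightarrow> T \<inter> T' face_of T" by blast
qed

lemma compact_Union: "compact (\<Union>M)"
  using finite_M tetrahedron.compact_T[OF simplex_M] by (intro compact_Union) auto

text \<open>Each element is the closure of its interior.\<close>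

lemma closure_mesh_domain: "closure (mesh_domain M) = \<Union>M"
proof
  show "closure (mesh_domain M) \<subseteq> \<Union>M"
    unfolding mesh_domain_def using compact_Union
    by (intro closure_minimal interior_subset compact_imp_closed)
  show "\<Union>M \<subseteq> closure (mesh_domain M)"
  proof
    fix x assume "x \<in> \<Union>M"
    then obtain T where T: "T \<in> M" "x \<in> T" by blast
    interpret tetrahedron T using simplex_M[OF T(1)] .
    have "x \<in> closure (interior T)"
      using convex_closure_interior[OF convex_T interior_nonempty] T(2) closure_subset by blast
    moreover have "interior T \<subseteq> mesh_domain M" unfolding mesh_domain_def using T(1) by (intro interior_mono) auto
    ultimately show "x \<in> closure (mesh_domain M)" using closure_mono by blast
  qed
qed

lemma mesh_boundary_iff: "x \<in> mesh_boundary M \<longleftrightarrow> x \<in> \<Union>M \<and> x \<notin> mesh_domain M"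
  unfolding mesh_boundary_def frontier_def closure_mesh_domain by (simp add: mesh_domain_def)

lemma closed_mesh_boundary: "closed (mesh_boundary M)"
  by (simp add: mesh_boundary_def)

lemma interior_subset_mesh_domain: "T \<in> M \<Longrightarrow> interior T \<subseteq> mesh_domain M"
  unfolding mesh_domain_def by (intro interior_mono) auto

lemma interiors_disjoint:
  assumes "T \<in> M" "T' \<in> M" "T \<noteq> T'"
  shows "interior T \<inter> interior T' = {}"
proof (rule ccontr)
  assume "\<not> ?thesis"
  then obtain x where x: "x \<in> interior T" "x \<in> interior T'" by blast
  have xx: "x \<in> T \<inter> T'" using x interior_subset by blast
  have "T \<inter> T' = T"
    using face_of_disjoint_interior[OF conform[OF assms(1,2)]] x(1) xx by blast
  moreover have "T' \<inter> T = T'"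
    using face_of_disjoint_interior[OF conform[OF assms(2,1)]] x(2) xx by blast
  ultimately show False using assms(3) by blast
qed

text \<open>All points of the relative interior of a face see the same elements in the same directions. If \<open>y\<close>, in
  the relative interior, is an interior point of the polyhedron, then the elements that contain \<open>y\<close>
  contain the whole face and cover a ball around \<open>y\<close>; contracting this ball towards a point \<open>x'\<close> of the face
  gives a ball around \<open>x\<close> covered by the same elements.\<close>

lemma boundary_contains_face:
  assumes "T \<in> M" "s face_of T" "x \<in> rel_interior s" "x \<in> mesh_boundary M"
  shows "s \<subseteq> mesh_boundary M"
proof -
  interpret tetrahedron T using simplex_M[OF assms(1)] .
  have convs: "convex s" using assms(2) face_of_imp_convex by blast
  have sT: "s \<subseteq> T" using assms(2) face_of_imp_subset by blast
  have "rel_interior s \<subseteq> mesh_boundary M"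
  proof
    fix y assume y: "y \<in> rel_interior s"
    have yU: "y \<in> \<Union>M" using y rel_interior_subset sT assms(1) by blast
    show "y \<in> mesh_boundary M"
    proof (rule ccontr)
      assume "y \<notin> mesh_boundary M"
      then have yint: "y \<in> interior (\<Union>M)" using yU mesh_boundary_iff by (auto simp: mesh_domain_def)
      define K where "K = {T'\<in>M. y \<in> T'}"
      have sK: "s \<subseteq> T'" if "T' \<in> K" for T'
      proof -
        have "T \<inter> T' face_of T" using conform that assms(1) by (auto simp: K_def)
        moreover have "T \<inter> T' \<inter> rel_interior s \<noteq> {}" using y sT rel_interior_subset that by (auto simp: K_def)
        ultimately show ?thesis using subset_of_face_of[of "T \<inter> T'" T s] sT by blast
      qed
      have "closed (\<Union>(M - K))"
        using finite_M tetrahedron.compact_T[OF simplex_M] compact_imp_closed by (intro closed_Union) auto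
      then have "open (interior (\<Union>M) - \<Union>(M - K))" by (intro open_Diff) auto
      moreover have "y \<in> interior (\<Union>M) - \<Union>(M - K)" using yint by (auto simp: K_def)
      ultimately obtain \<rho> where \<rho>: "\<rho> > 0" "ball y \<rho> \<subseteq> interior (\<Union>M) - \<Union>(M - K)" using openE by blast
      have ballK: "ball y \<rho> \<subseteq> \<Union>K" using \<rho>(2) interior_subset[of "\<Union>M"] by blast
      obtain \<delta> where \<delta>: "\<delta> > 0" "ball x \<delta> \<inter> affine hull s \<subseteq> s"
        using assms(3) unfolding mem_rel_interior_ball by blast
      \<comment> \<open>\<open>x\<close> lies strictly between \<open>y\<close> and a point \<open>x'\<close> of \<open>s\<close>.\<close>
      define t where "t = \<delta> / (2 * (norm (x - y) + 1))"
      have den: "0 < 2 * (norm (x - y) + 1)" by (intro mult_pos_pos add_nonneg_pos) auto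
      have t: "0 < t" unfolding t_def using \<delta>(1) den by simp
      define x' where "x' = x + t *\<^sub>R (x - y)"
      have "norm (t *\<^sub>R (x - y)) < \<delta>"
      proof -
        have "t * norm (x - y) < t * (2 * (norm (x - y) + 1))" using t norm_ge_zero[of "x - y"] by (intro mult_strict_left_mono) (auto simp: add_nonneg_pos)
        also have "\<dots> = \<delta>" unfolding t_def using den by simp
        finally show ?thesis using t by simp
      qed
      then have "x' \<in> ball x \<delta>" by (simp add: x'_def dist_norm)
      moreover have "x' \<in> affine hull s"
      proof -
        have "x \<in> affine hull s" "y \<in> affine hull s"
          using hull_inc[OF subsetD[OF rel_interior_subset]] assms(3) y by auto
        then have "(1 + t) *\<^sub>R x + (- t) *\<^sub>R y \<in> affine hull s"
          by (intro mem_affine affine_affine_hull) auto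
        then show ?thesis by (simp add: x'_def algebra_simps)
      qed
      ultimately have x's: "x' \<in> s" using \<delta>(2) by blast
      define \<mu> where "\<mu> = t / (1 + t)"
      have \<mu>: "0 < \<mu>" "\<mu> < 1" using t by (auto simp: \<mu>_def)
      have x_eq: "x = (1 - \<mu>) *\<^sub>R x' + \<mu> *\<^sub>R y"
      proof -
        have "(1 - \<mu>) * (1 + t) = 1" "(1 - \<mu>) * t = \<mu>" using t by (auto simp: \<mu>_def field_simps)
        moreover have "(1 - \<mu>) *\<^sub>R x' = ((1 - \<mu>) * (1 + t)) *\<^sub>R x - ((1 - \<mu>) * t) *\<^sub>R y"
          by (simp add: x'_def algebra_simps)
        ultimately show ?thesis by simp
      qed
      have "ball x (\<mu> * \<rho>) \<subseteq> \<Union>M"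
      proof
        fix z assume z: "z \<in> ball x (\<mu> * \<rho>)"
        define d where "d = (1 / \<mu>) *\<^sub>R (z - x)"
        have "norm (z - x) < \<mu> * \<rho>" using z by (simp add: dist_norm norm_minus_commute)
        moreover have "norm d = norm (z - x) / \<mu>" using \<mu>(1) by (simp add: d_def)
        ultimately have "norm d < \<rho>" using \<mu>(1) by (simp add: divide_less_eq mult.commute)
        then have "y + d \<in> ball y \<rho>" by (simp add: dist_norm)
        then obtain T' where T': "T' \<in> K" "y + d \<in> T'" using ballK by blast
        have "x' \<in> T'" using sK[OF T'(1)] x's by blast
        moreover have "convex T'" using tetrahedron.convex_T[OF simplex_M] T'(1) by (auto simp: K_def)
        ultimately have "(1 - \<mu>) *\<^sub>R x' + \<mu> *\<^sub>R (y + d) \<in> T'"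
          using T'(2) \<mu> by (intro convexD) auto
        moreover have "(1 - \<mu>) *\<^sub>R x' + \<mu> *\<^sub>R (y + d) = x + \<mu> *\<^sub>R d"
          by (subst x_eq) (simp add: scaleR_add_right)
        moreover have "x + \<mu> *\<^sub>R d = z" using \<mu>(1) by (simp add: d_def)
        ultimately show "z \<in> \<Union>M" using T'(1) by (auto simp: K_def)
      qed
      then have "x \<in> interior (\<Union>M)" using \<mu>(1) \<rho>(1) by (intro interiorI[of "ball x (\<mu> * \<rho>)"]) auto
      then show False using assms(4) mesh_boundary_iff by (auto simp: mesh_domain_def)
    qed
  qed
  then have "closure (rel_interior s) \<subseteq> mesh_boundary M" using closed_mesh_boundary by (rule closure_minimal)
  then show ?thesis using convex_closure_rel_interior[OF convs] closure_subset by blast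
qed

lemma carrier_in_boundary:
  assumes "T \<in> M" "x \<in> T" "x \<in> mesh_boundary M"
  shows "convex hull (tetrahedron.carrier T x) \<subseteq> mesh_boundary M"
  using boundary_contains_face[OF assms(1) _ _ assms(3)] tetrahedron.carrier_face[OF simplex_M[OF assms(1)] assms(2)]
  by blast

lemma vertex_position:
  assumes "T \<in> M" "v \<in> vertices T"
  shows "v \<in> mesh_boundary M \<Longrightarrow> v \<in> frontier \<Omega>" and "v \<notin> mesh_boundary M \<Longrightarrow> v \<in> \<Omega>"
proof -
  have all: "\<forall>T \<in> M. \<forall>v \<in> vertices T. if v \<in> mesh_boundary M then v \<in> frontier \<Omega> else v \<in> \<Omega>"
    using fitted unfolding fitted_mesh_def by (elim conjE)
  have "if v \<in> mesh_boundary M then v \<in> frontier \<Omega> else v \<in> \<Omega>"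
    by (rule bspec[OF bspec[OF all assms(1)] assms(2)])
  then show "v \<in> mesh_boundary M \<Longrightarrow> v \<in> frontier \<Omega>" and "v \<notin> mesh_boundary M \<Longrightarrow> v \<in> \<Omega>"
    by (auto split: if_splits)
qed

lemma S_element_structure:
  assumes "T \<in> S_elements M"
  obtains c p where "card c = 3" "p \<notin> c" "vertices T = insert p c" "boundary_face M T = convex hull c"
    "c \<subseteq> frontier \<Omega>" "p \<in> \<Omega>" "apex \<Omega> T = p"
    "convex hull c \<subseteq> mesh_boundary M"
    "\<And>e. e edge_of T \<Longrightarrow> e \<subseteq> mesh_boundary M \<Longrightarrow> e \<subseteq> convex hull c"
    "\<And>F. F facet_of T \<Longrightarrow> F \<subseteq> mesh_boundary M \<Longrightarrow> F = convex hull c"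
proof -
  have T: "T \<in> M" using assms by (auto simp: S_elements_def)
  interpret tetrahedron T using simplex_M[OF T] .
  let ?A = "{F. F facet_of T \<and> F \<subseteq> mesh_boundary M}"
  have ne: "?A \<noteq> {}" using assms by (auto simp: S_elements_def)
  have "?A = {} \<and> card {e. e edge_of T \<and> e \<subseteq> mesh_boundary M} \<le> 1
      \<or> (\<exists>F. ?A = {F} \<and> (\<forall>e. e edge_of T \<and> e \<subseteq> mesh_boundary M \<longrightarrow> e \<subseteq> F))"
    using fitted unfolding fitted_mesh_def by (elim conjE) (erule bspec[OF _ T])
  then have "\<exists>F. ?A = {F} \<and> (\<forall>e. e edge_of T \<and> e \<subseteq> mesh_boundary M \<longrightarrow> e \<subseteq> F)"
    using ne by (elim disjE conjE) simp_all
  then obtain F where FA: "?A = {F}" and Fe: "\<And>e. e edge_of T \<Longrightarrow> e \<subseteq> mesh_boundary M \<Longrightarrow> e \<subseteq> F"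
    by (elim exE conjE) simp
  have "F \<in> ?A" unfolding FA by simp
  then have F1: "F facet_of T" "F \<subseteq> mesh_boundary M" by simp_all
  have Fu: "F' = F" if "F' facet_of T" "F' \<subseteq> mesh_boundary M" for F'
  proof -
    have "F' \<in> ?A" using that by simp
    then show ?thesis unfolding FA by simp
  qed
  have bf: "boundary_face M T = F" unfolding boundary_face_def
  proof (rule the_equality)
    show "F facet_of T \<and> F \<subseteq> mesh_boundary M" using F1 by simp
    show "F' = F" if "F' facet_of T \<and> F' \<subseteq> mesh_boundary M" for F'
      using Fu that by blast
  qed
  obtain c where c: "c \<subseteq> C" "card c = 3" "F = convex hull c" using F1(1) facet_iff by blast
  have "card (C - c) = 1" using c vertices_props(2,3) finite_subset[OF c(1)] by (simp add: card_Diff_subset)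
  then obtain p where p: "C - c = {p}" using card_1_singletonE by blast
  have Cp: "C = insert p c" "p \<notin> c" using p c(1) by blast+
  have cfr: "c \<subseteq> frontier \<Omega>"
  proof
    fix v assume v: "v \<in> c"
    have "v \<in> mesh_boundary M" using F1(2) c(3) hull_inc[OF v, of convex] by blast
    then show "v \<in> frontier \<Omega>" using vertex_position(1)[OF T] v c(1) by blast
  qed
  have ex1: "\<exists>!v. v \<in> C \<and> v \<notin> frontier \<Omega>"
    using fitted unfolding fitted_mesh_def by (elim conjE) (erule bspec[OF _ assms])
  then obtain v where v: "v \<in> C" "v \<notin> frontier \<Omega>" by (rule ex1E) auto
  then have "v = p" using Cp(1) cfr by (metis insertE subsetD)
  then have pf: "p \<in> C" "p \<notin> frontier \<Omega>" using v by auto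
  have p\<Omega>: "p \<in> \<Omega>" using vertex_position[OF T pf(1)] pf(2) by metis
  have "apex \<Omega> T = p" unfolding apex_def by (rule the1_equality[OF ex1]) (use pf in simp)
  from that[OF c(2) Cp(2,1) _ cfr p\<Omega> this] show ?thesis
    using bf F1(2) Fe Fu unfolding c(3) by blast
qed

lemma vertex_of_neighbour:
  assumes "T \<in> M" "T' \<in> M" "v \<in> vertices T" "v \<in> T'"
  shows "v \<in> vertices T'"
proof -
  have v: "v extreme_point_of T" "v \<in> T" using assms(3) by (auto simp: vertices_def extreme_point_of_def)
  have "v extreme_point_of (T \<inter> T')"
    using extreme_point_of_face[OF conform[OF assms(1,2)]] v assms(4) by blast
  moreover have "T \<inter> T' face_of T'" using conform[OF assms(2,1)] by (simp add: Int_commute)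
  ultimately show ?thesis using extreme_point_of_face[of "T \<inter> T'" T'] by (auto simp: vertices_def)
qed

lemma lattice_neighbour:
  assumes "k > 0" "T \<in> M" "T' \<in> M" "x \<in> lattice_points k T" "x \<in> T'"
  shows "x \<in> lattice_points k T'"
proof -
  interpret A: tetrahedron T using simplex_M[OF assms(2)] .
  interpret B: tetrahedron T' using simplex_M[OF assms(3)] .
  have f': "T \<inter> T' face_of T'" using conform[OF assms(3,2)] by (simp add: Int_commute)
  have "x \<in> lattice_points k (T \<inter> T')"
    using A.lattice_face[OF assms(1) conform[OF assms(2,3)]] assms(4,5) A.lattice_subset[OF assms(1)] by blast
  then show ?thesis using B.lattice_face[OF assms(1) f'] by blast
qed

text \<open>The intersection is a common face, and its own lattice points are common nodes of both elements.\<close>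

lemma polys_agree_on_intersection:
  assumes "k > 0" "T \<in> M" "T' \<in> M" "p \<in> polys k" "q \<in> polys k"
    and "\<And>x. x \<in> lattice_points k T \<Longrightarrow> x \<in> lattice_points k T' \<Longrightarrow> p x = q x"
    and "z \<in> T" "z \<in> T'"
  shows "p z = q z"
proof -
  interpret A: tetrahedron T using simplex_M[OF assms(2)] .
  have "p z - q z = 0"
  proof (rule A.vanish_on_face[OF assms(1) polys_diff[OF assms(4,5)] conform[OF assms(2,3)]])
    show "z \<in> T \<inter> T'" using assms by blast
    fix x assume "x \<in> lattice_points k (T \<inter> T')"
    then have "x \<in> lattice_points k T" "x \<in> T'"
      using A.lattice_face[OF assms(1) conform[OF assms(2,3)]] by auto
    then show "p x - q x = 0" using assms(6) lattice_neighbour[OF assms(1-3)] by simp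
  qed
  then show ?thesis by simp
qed

lemma polys_vanish_on_boundary:
  assumes "k > 0" "T \<in> M" "p \<in> polys k" "\<And>x. x \<in> lattice_points k T \<Longrightarrow> x \<in> mesh_boundary M \<Longrightarrow> p x = 0"
    and "z \<in> T" "z \<in> mesh_boundary M"
  shows "p z = 0"
proof -
  interpret A: tetrahedron T using simplex_M[OF assms(2)] .
  let ?s = "convex hull (A.carrier z)"
  have f: "?s face_of T" by (rule A.carrier_face(1)[OF assms(5)])
  show ?thesis
  proof (rule A.vanish_on_face[OF assms(1,3) f])
    show "z \<in> ?s" by (rule A.mem_carrier_hull[OF assms(5)])
    fix x assume "x \<in> lattice_points k ?s"
    then show "p x = 0"
      using A.lattice_face[OF assms(1) f] carrier_in_boundary[OF assms(2,5,6)] assms(4) by blast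
  qed
qed

end

section \<open>Displaced boundary nodes\<close>

context mesh_in_domain begin

lemma boundary_node_cases:
  assumes k: "k > 0" and T: "T \<in> M" and x: "x \<in> lattice_points k T" "x \<in> mesh_boundary M" "x \<notin> vertices T"
  obtains (edge) a b where "tetrahedron.carrier T x = {a, b}" "a \<noteq> b" "convex hull {a, b} edge_of T"
      "convex hull {a, b} \<subseteq> mesh_boundary M" "T \<in> O_elements M"
    | (face) c where "tetrahedron.carrier T x = c" "card c = 3" "T \<in> S_elements M" "boundary_face M T = convex hull c"
proof -
  interpret tetrahedron T using simplex_M[OF T] .
  have xT: "x \<in> T" using lattice_subset[OF k] x(1) by blast
  let ?s = "carrier x"
  have sC: "?s \<subseteq> C" by (rule carrier_subset)
  have fin: "finite ?s" using sC vertices_props(2) by (rule finite_subset)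
  have sb: "convex hull ?s \<subseteq> mesh_boundary M" by (rule carrier_in_boundary[OF T xT x(2)])
  have "card ?s \<noteq> 0" using carrier_face(3)[OF xT] fin by simp
  moreover have "card ?s \<noteq> 1" using carrier_singleton[OF xT] x(3) by blast
  moreover have "card ?s \<noteq> 4"
  proof
    assume "card ?s = 4"
    then have "?s = C" using card_subset_eq[OF vertices_props(2) sC] vertices_props(3) by simp
    then have "\<forall>v\<in>C. 0 < bary T v x" by (auto simp: carrier_def)
    then have "x \<in> mesh_domain M" using interior_if_bary_pos interior_subset_mesh_domain[OF T] by blast
    then show False using x(2) mesh_boundary_iff by blast
  qed
  moreover have "card ?s \<le> 4" using card_mono[OF vertices_props(2) sC] vertices_props(3) by simp
  ultimately consider "card ?s = 2" | "card ?s = 3" by linarith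
  then show ?thesis
  proof cases
    case 1
    then obtain a b where ab: "?s = {a, b}" "a \<noteq> b" by (auto simp: card_2_iff)
    have e: "convex hull ?s edge_of T" using edge_iff sC 1 by blast
    have "T \<in> O_elements M"
    proof (cases "T \<in> S_elements M")
      case False
      let ?E = "{e. e edge_of T \<and> e \<subseteq> mesh_boundary M}"
      have "{F. F facet_of T \<and> F \<subseteq> mesh_boundary M} = {} \<and> card ?E \<le> 1
          \<or> (\<exists>F. {F. F facet_of T \<and> F \<subseteq> mesh_boundary M} = {F}
              \<and> (\<forall>e. e edge_of T \<and> e \<subseteq> mesh_boundary M \<longrightarrow> e \<subseteq> F))"
        using fitted unfolding fitted_mesh_def by (elim conjE) (erule bspec[OF _ T])
      then have "card ?E \<le> 1"
      proof (elim disjE exE conjE)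
        fix F assume "{F. F facet_of T \<and> F \<subseteq> mesh_boundary M} = {F}"
        then have "F \<in> {F. F facet_of T \<and> F \<subseteq> mesh_boundary M}" by simp
        then have "\<exists>F. F facet_of T \<and> F \<subseteq> mesh_boundary M" by (intro exI[of _ F]) simp
        then have "T \<in> S_elements M" unfolding S_elements_def using T by simp
        then show ?thesis using False by simp
      qed
      moreover have "convex hull ?s \<in> ?E" using e sb by simp
      then have "?E \<noteq> {}" by blast
      then have "0 < card ?E" using finite_edges[of "\<lambda>e. e \<subseteq> mesh_boundary M"] by (simp add: card_gt_0_iff)
      ultimately have "card ?E = 1" by linarith
      then show ?thesis unfolding O_elements_def R_elements_def using T False by simp
    qed (simp add: O_elements_def)
    then show ?thesis using edge[OF ab] e sb unfolding ab by blast
  next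
    case 2
    have F: "convex hull ?s facet_of T" using facet_iff sC 2 by blast
    then have TS: "T \<in> S_elements M" unfolding S_elements_def using T sb by blast
    then obtain c where "boundary_face M T = convex hull c"
      "\<And>F. F facet_of T \<Longrightarrow> F \<subseteq> mesh_boundary M \<Longrightarrow> F = convex hull c"
      using S_element_structure[OF TS] by metis
    then have "boundary_face M T = convex hull ?s" using F sb by metis
    then show ?thesis using face[OF refl 2 TS] by blast
  qed
qed

text \<open>The points to which the interpolation condition on the boundary face applies; \<open>edge_condition\<close> describes
  those to which the condition on the edge \<open>e\<close> applies.\<close>

definition face_condition :: "nat \<Rightarrow> (real^3) set \<Rightarrow> real^3 \<Rightarrow> bool" where
  "face_condition k T x \<longleftrightarrow> T \<in> S_elements M \<and> x \<in> lattice_points k (boundary_face M T)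
     \<and> (\<forall>e. e edge_of boundary_face M T \<longrightarrow> x \<notin> e)"

definition edge_condition :: "nat \<Rightarrow> (real^3) set \<Rightarrow> (real^3) set \<Rightarrow> real^3 \<Rightarrow> bool" where
  "edge_condition k T e x \<longleftrightarrow> T \<in> O_elements M \<and> e edge_of T \<and> e \<subseteq> mesh_boundary M
     \<and> x \<in> lattice_points k e - vertices e"

text \<open>The point at which the value of a trial function is prescribed or shared in place of the node \<open>x\<close>, with
  the bound \<open>\<eta>\<close> on the relative displacement. The set of nearest intersections must be a singleton, since otherwise
  the trial set could impose several conditions at one node.\<close>

definition displaced_node ::
  "nat \<Rightarrow> ((real^3) set \<Rightarrow> (real^3) set) \<Rightarrow> real \<Rightarrow> (real^3) set \<Rightarrow> real^3 \<Rightarrow> real^3 \<Rightarrow> bool" where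
  "displaced_node k Pl \<eta> T x Q \<longleftrightarrow> norm (Q - x) \<le> \<eta> * diameter T \<and>
     (x \<notin> mesh_boundary M \<or> x \<in> vertices T \<longrightarrow> Q = x) \<and>
     (face_condition k T x \<longrightarrow> nearest_intersections \<Omega> (affine hull {apex \<Omega> T, x}) x = {Q}) \<and>
     (\<forall>e. edge_condition k T e x \<longrightarrow> nearest_intersections \<Omega> (orthogonal_line (Pl e) e x) x = {Q})"

lemma O_elements_subset: "T \<in> O_elements M \<Longrightarrow> T \<in> M"
  by (auto simp: O_elements_def S_elements_def R_elements_def)

text \<open>The smallest face of the element that contains such a point is the boundary face itself; for
  \<open>edge_condition\<close> it is the edge. So a node is subject to at most one of these conditions.\<close>

lemma face_condition_D:
  assumes "k > 0" "face_condition k T x"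
  shows "T \<in> M" "x \<in> lattice_points k T" "x \<in> mesh_boundary M" "card (tetrahedron.carrier T x) = 3"
    "x \<notin> vertices T" "boundary_face M T = convex hull (tetrahedron.carrier T x)"
proof -
  have TS: "T \<in> S_elements M" and x: "x \<in> lattice_points k (boundary_face M T)"
    and ne: "\<And>e. e edge_of boundary_face M T \<Longrightarrow> x \<notin> e"
    using assms(2) by (auto simp: face_condition_def)
  show TM: "T \<in> M" using TS by (simp add: S_elements_def)
  interpret tetrahedron T using simplex_M[OF TM] .
  obtain c p where c: "card c = 3" "C = insert p c" "boundary_face M T = convex hull c" "convex hull c \<subseteq> mesh_boundary M"
    using S_element_structure[OF TS] by metis
  have cC: "c \<subseteq> C" using c(2) by blast
  have xc: "x \<in> lattice_points k T" "x \<in> convex hull c"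
    using x lattice_face_hull[OF assms(1) cC] unfolding c(3) by auto
  show "x \<in> lattice_points k T" by (rule xc(1))
  show "x \<in> mesh_boundary M" using xc(2) c(4) by blast
  have xT: "x \<in> T" using xc(1) lattice_subset[OF assms(1)] by blast
  have sub: "carrier x \<subseteq> c" by (rule carrier_minimal[OF cC xc(2)])
  have fc: "finite c" using cC vertices_props(2) by (rule finite_subset)
  have "\<not> card (carrier x) \<le> 2"
  proof
    assume "card (carrier x) \<le> 2"
    then obtain b where b: "carrier x \<subseteq> b" "b \<subseteq> c" "card b = 2"
      using exists_subset_between[of "carrier x" 2 c] sub c(1) fc by auto
    have "x \<in> convex hull b" using mem_carrier_hull[OF xT] hull_mono[OF b(1), of convex] by blast
    moreover have "convex hull b edge_of boundary_face M T"
      unfolding c(3) edge_of_face_iff[OF cC] using b by blast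
    ultimately show False using ne by blast
  qed
  then show car: "card (carrier x) = 3" using card_mono[OF fc sub] c(1) by linarith
  then have "carrier x = c" using card_subset_eq[OF fc sub] c(1) by simp
  then show "boundary_face M T = convex hull (carrier x)" using c(3) by simp
  show "x \<notin> C" using carrier_vertex[of x] car by auto
qed

lemma edge_condition_D:
  assumes "k > 0" "edge_condition k T e x"
  shows "T \<in> M" "x \<in> lattice_points k T" "x \<in> mesh_boundary M" "card (tetrahedron.carrier T x) = 2"
    "x \<notin> vertices T" "e = convex hull (tetrahedron.carrier T x)"
proof -
  have e: "e edge_of T" "e \<subseteq> mesh_boundary M" and x: "x \<in> lattice_points k e" "x \<notin> vertices e"
    using assms(2) by (auto simp: edge_condition_def)
  show TM: "T \<in> M" using assms(2) O_elements_subset by (auto simp: edge_condition_def)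
  interpret tetrahedron T using simplex_M[OF TM] .
  obtain c where c: "c \<subseteq> C" "card c = 2" "e = convex hull c" using e(1) edge_iff by blast
  have xc: "x \<in> lattice_points k T" "x \<in> convex hull c"
    using x lattice_face_hull[OF assms(1) c(1)] unfolding c(3) by auto
  show "x \<in> lattice_points k T" by (rule xc(1))
  show "x \<in> mesh_boundary M" using xc(2) e(2) c(3) by blast
  have xT: "x \<in> T" using xc(1) lattice_subset[OF assms(1)] by blast
  have sub: "carrier x \<subseteq> c" by (rule carrier_minimal[OF c(1) xc(2)])
  have fc: "finite c" using c(1) vertices_props(2) by (rule finite_subset)
  show xC: "x \<notin> C"
  proof
    assume "x \<in> C"
    then have "x \<in> c" using carrier_vertex[of x] sub by auto
    then show False using x(2) vertices_face[OF c(1)] c(3) by simp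
  qed
  have "card (carrier x) \<noteq> 0" using carrier_face(3)[OF xT] finite_subset[OF sub fc] by simp
  moreover have "card (carrier x) \<noteq> 1" using carrier_singleton[OF xT] xC by blast
  ultimately show car: "card (carrier x) = 2" using card_mono[OF fc sub] c(2) by linarith
  then have "carrier x = c" using card_subset_eq[OF fc sub] c(2) by simp
  then show "e = convex hull (carrier x)" using c(3) by simp
qed

lemma boundary_node_condition:
  assumes k: "k > 0" and T: "T \<in> M" and x: "x \<in> lattice_points k T" "x \<in> mesh_boundary M" "x \<notin> vertices T"
  shows "face_condition k T x \<or> (\<exists>e. edge_condition k T e x)"
proof -
  interpret tetrahedron T using simplex_M[OF T] .
  have xT: "x \<in> T" using x(1) lattice_subset[OF k] by blast
  have xh: "x \<in> lattice_points k (convex hull (carrier x))"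
    using lattice_face_hull[OF k carrier_subset] x(1) mem_carrier_hull[OF xT] by blast
  show ?thesis
    using k T x
  proof (cases rule: boundary_node_cases)
    case (edge a b)
    have "vertices (convex hull {a, b}) = {a, b}" using vertices_face[OF carrier_subset[of x]] edge(1) by simp
    moreover have "x \<notin> {a, b}" using carrier_subset[of x] edge(1) x(3) by auto
    ultimately have "edge_condition k T (convex hull {a, b}) x"
      unfolding edge_condition_def using edge xh by simp
    then show ?thesis by blast
  next
    case (face c)
    have cC: "c \<subseteq> C" using carrier_subset face(1) by blast
    have "x \<notin> e" if e: "e edge_of convex hull c" for e
    proof
      assume "x \<in> e"
      obtain b where b: "b \<subseteq> c" "card b = 2" "e = convex hull b" using e edge_of_face_iff[OF cC] by blast
      have "carrier x \<subseteq> b" using carrier_minimal[of b x] b cC \<open>x \<in> e\<close> by blast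
      then show False using face(1,2) b(2) card_mono[of b "carrier x"] b(1) finite_subset[OF _ vertices_props(2)] cC
        by (metis Suc_1 eval_nat_numeral(3) not_less_eq_eq order_refl subset_trans)
    qed
    then have "face_condition k T x" unfolding face_condition_def using face xh by simp
    then show ?thesis by blast
  qed
qed

lemma diameter_le_mesh_size: "T \<in> M \<Longrightarrow> diameter T \<le> mesh_size M"
  unfolding mesh_size_def using finite_M by (intro Max_ge) auto

lemma face_node:
  assumes k: "k > 0" and reg: "\<And>T. T \<in> M \<Longrightarrow> shape_regular_tetrahedron T \<sigma>"
    and flat: "\<And>x. x \<in> frontier \<Omega> \<Longrightarrow> \<exists>n. flat_at \<Omega> \<epsilon> r x n"
    and \<epsilon>: "0 < \<epsilon>" "16 * \<epsilon> * \<sigma> \<le> 1" and size: "2 * mesh_size M < r"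
    and fc: "face_condition k T x"
  shows "\<exists>Q. nearest_intersections \<Omega> (affine hull {apex \<Omega> T, x}) x = {Q} \<and> norm (Q - x) \<le> 16 * \<sigma> * \<epsilon> * diameter T"
proof -
  have TM: "T \<in> M" using face_condition_D(1)[OF k fc] .
  have TS: "T \<in> S_elements M" using fc by (simp add: face_condition_def)
  interpret shape_regular_tetrahedron T \<sigma> using reg[OF TM] .
  obtain c p where c: "card c = 3" "p \<notin> c" "C = insert p c" "boundary_face M T = convex hull c" "c \<subseteq> frontier \<Omega>" "p \<in> \<Omega>" "apex \<Omega> T = p"
    using S_element_structure[OF TS] by metis
  obtain a where a: "a \<in> c" using c(1) by fastforce
  obtain n where n: "flat_at \<Omega> \<epsilon> r a n" using flat a c(5) by blast
  have hr: "2 * h < r" using diameter_le_mesh_size[OF TM] size by linarith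
  have Cp: "C - {p} = c" using c(2,3) by blast
  have "x \<in> convex hull c"
    using fc c(4) lattice_face_hull[OF k, of c] c(3) unfolding face_condition_def by auto
  then have xh: "x \<in> convex hull (C - {p})" by (simp only: Cp)
  show ?thesis
    unfolding c(7)
    by (rule face_node_displacement[OF n op _ _ _ c(6) _ hr \<epsilon> xh]) (use a c in auto)
qed

lemma edge_node:
  assumes k: "k > 0" and reg: "\<And>T. T \<in> M \<Longrightarrow> shape_regular_tetrahedron T \<sigma>"
    and flat: "\<And>x. x \<in> frontier \<Omega> \<Longrightarrow> \<exists>n. flat_at \<Omega> \<epsilon> r x n"
    and \<theta>: "0 < cos \<theta>" and \<epsilon>: "0 < \<epsilon>" "\<epsilon> \<le> cos \<theta> / (256 * \<sigma> ^ 3)" and size: "2 * mesh_size M < r"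
    and pl: "edge_planes \<theta> M Pl" and ec: "edge_condition k T e x"
  shows "\<exists>Q. nearest_intersections \<Omega> (orthogonal_line (Pl e) e x) x = {Q}
           \<and> norm (Q - x) \<le> 256 * \<sigma>\<^sup>2 / cos \<theta> * \<epsilon> * diameter T"
proof -
  have TM: "T \<in> M" using edge_condition_D(1)[OF k ec] .
  interpret A: shape_regular_tetrahedron T \<sigma> using reg[OF TM] .
  have "e \<in> mesh_boundary_edges M"
    using ec TM by (auto simp: edge_condition_def mesh_boundary_edges_def)
  note eP = bspec[OF pl[unfolded edge_planes_def] this]
  have P1: "affine (Pl e)" using eP by (elim conjE)
  have P2: "aff_dim (Pl e) = 2" using eP by (elim conjE)
  have P3: "e \<subseteq> Pl e" using eP by (elim conjE)
  note P = P1 P2 P3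
  have
    "\<exists>T1 \<in> S_elements M. \<exists>T2 \<in> S_elements M. T1 \<noteq> T2 \<and>
           e edge_of boundary_face M T1 \<and> e edge_of boundary_face M T2 \<and>
           near_bisector \<theta> e (boundary_face M T1) (boundary_face M T2) (Pl e)"
    using eP by (elim conjE)
  then obtain T1 T2 where T12: "T1 \<in> S_elements M" "T2 \<in> S_elements M" "T1 \<noteq> T2"
    "e edge_of boundary_face M T1" "e edge_of boundary_face M T2"
    "near_bisector \<theta> e (boundary_face M T1) (boundary_face M T2) (Pl e)"
    by (elim bexE conjE)
  have TM1: "T1 \<in> M" and TM2: "T2 \<in> M" using T12(1,2) by (auto simp: S_elements_def)
  interpret A1: shape_regular_tetrahedron T1 \<sigma> using reg[OF TM1] .
  interpret A2: shape_regular_tetrahedron T2 \<sigma> using reg[OF TM2] .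
  obtain d1 p1 where d1: "card d1 = 3" "vertices T1 = insert p1 d1" "boundary_face M T1 = convex hull d1" "d1 \<subseteq> frontier \<Omega>" "p1 \<in> \<Omega>"
    using S_element_structure[OF T12(1)] by metis
  obtain d2 p2 where d2: "card d2 = 3" "vertices T2 = insert p2 d2" "boundary_face M T2 = convex hull d2" "d2 \<subseteq> frontier \<Omega>" "p2 \<in> \<Omega>"
    using S_element_structure[OF T12(2)] by metis
  have dC: "d1 \<subseteq> A1.C" "d2 \<subseteq> A2.C" using d1(2) d2(2) by blast+
  obtain b1 where b1: "b1 \<subseteq> d1" "card b1 = 2" "e = convex hull b1"
    using T12(4) A1.edge_of_face_iff[OF dC(1)] unfolding d1(3) by blast
  obtain b2 where b2: "b2 \<subseteq> d2" "card b2 = 2" "e = convex hull b2"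
    using T12(5) A2.edge_of_face_iff[OF dC(2)] unfolding d2(3) by blast
  have "b1 \<subseteq> A1.C" "b2 \<subseteq> A2.C" using b1(1) b2(1) dC by auto
  then have "vertices e = b1" "vertices e = b2"
    using A1.vertices_face A2.vertices_face b1(3) b2(3) by metis+
  then have b12: "b2 = b1" by simp
  obtain a b where ab: "b1 = {a, b}" "a \<noteq> b" using b1(2) by (auto simp: card_2_iff)
  have e_ab: "e = convex hull {a, b}" using b1(3) ab(1) by simp
  have third: "\<exists>c. d = {a, b, c}" if d: "{a, b} \<subseteq> d" "card d = 3" for d
  proof -
    have "finite d" using d(2) by (metis card.infinite zero_neq_numeral)
    then have "card (d - {a, b}) = 1" using d ab(2) by (simp add: card_Diff_subset)
    then obtain c where "d - {a, b} = {c}" by (rule card_1_singletonE)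
    then have "d = {a, b, c}" using d(1) by blast
    then show ?thesis by blast
  qed
  obtain c1 where c1: "d1 = {a, b, c1}" using third[of d1] b1(1) d1(1) ab(1) by blast
  obtain c2 where c2: "d2 = {a, b, c2}" using third[of d2] b2(1) d2(1) ab(1) b12 by blast
  have C1: "A1.C = {a, b, c1, p1}" using d1(2) c1 by auto
  have C2: "A2.C = {a, b, c2, p2}" using d2(2) c2 by auto
  have "a \<in> frontier \<Omega>" using d1(4) c1 by blast
  then obtain n where n: "flat_at \<Omega> \<epsilon> r a n" using flat by blast
  have hr: "2 * diameter T1 < r" "2 * diameter T2 < r"
    using diameter_le_mesh_size[OF TM1] diameter_le_mesh_size[OF TM2] size by linarith+
  have xe: "x \<in> convex hull {a, b}"
    using edge_condition_D(2,6)[OF k ec] A.lattice_subset[OF k] A.mem_carrier_hull e_ab by blast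
  have disj: "interior T1 \<inter> interior T2 = {}" by (rule interiors_disjoint[OF TM1 TM2 T12(3)])
  have fr: "{a, b, c1, c2} \<subseteq> frontier \<Omega>" using d1(4) d2(4) c1 c2 by blast
  have ap: "{p1, p2} \<subseteq> \<Omega>" using d1(5) d2(5) by blast
  obtain Q where Q: "nearest_intersections \<Omega> (orthogonal_line (Pl e) e x) x = {Q}"
      "norm (Q - x) \<le> 256 * \<sigma>\<^sup>2 / cos \<theta> * \<epsilon> * norm (b - a)"
    using edge_node_displacement[OF A1.shape_regular_tetrahedron_axioms A2.shape_regular_tetrahedron_axioms C1 C2
       T12(6)[unfolded e_ab d1(3) d2(3) c1 c2] P[unfolded e_ab] n op fr ap hr \<theta> \<epsilon> disj xe]
    unfolding e_ab by blast
  have "{a, b} \<subseteq> T"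
    using ec A.edge_iff hull_subset[of "{a, b}" convex] e_ab edge_of_imp_subset[of e T] unfolding edge_condition_def by blast
  then have "norm (b - a) \<le> diameter T" using A.dist_le_diameter by blast
  moreover have "0 \<le> 256 * \<sigma>\<^sup>2 / cos \<theta> * \<epsilon>" using \<theta> \<epsilon>(1) by simp
  ultimately have "256 * \<sigma>\<^sup>2 / cos \<theta> * \<epsilon> * norm (b - a) \<le> 256 * \<sigma>\<^sup>2 / cos \<theta> * \<epsilon> * diameter T"
    by (rule mult_left_mono)
  then show ?thesis using Q by (meson order_trans)
qed

lemma displaced_nodes_exist:
  assumes k: "k > 0" and \<sigma>1: "1 \<le> \<sigma>" and reg: "\<And>T. T \<in> M \<Longrightarrow> shape_regular_tetrahedron T \<sigma>"
    and flat: "\<And>x. x \<in> frontier \<Omega> \<Longrightarrow> \<exists>n. flat_at \<Omega> \<epsilon> r x n"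
    and \<theta>: "0 < cos \<theta>" and \<epsilon>: "0 < \<epsilon>" "\<epsilon> \<le> cos \<theta> / (256 * \<sigma> ^ 3)" and size: "2 * mesh_size M < r"
    and pl: "edge_planes \<theta> M Pl"
  shows "\<exists>pt. \<forall>T\<in>M. \<forall>x\<in>lattice_points k T. displaced_node k Pl (256 * \<sigma>\<^sup>2 / cos \<theta> * \<epsilon>) T x (pt T x)"
proof -
  let ?\<eta> = "256 * \<sigma>\<^sup>2 / cos \<theta> * \<epsilon>"
  have \<eta>0: "0 < ?\<eta>" using \<theta> \<epsilon>(1) \<sigma>1 by simp
  have \<epsilon>\<sigma>3: "256 * (\<epsilon> * \<sigma> ^ 3) \<le> cos \<theta>" using \<epsilon>(2) \<sigma>1 by (simp add: field_simps)
  have "\<sigma> ^ 1 \<le> \<sigma> ^ 3" using \<sigma>1 by (intro power_increasing) auto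
  then have "\<epsilon> * \<sigma> \<le> \<epsilon> * \<sigma> ^ 3" using \<epsilon>(1) by simp
  then have \<epsilon>\<sigma>: "16 * \<epsilon> * \<sigma> \<le> 1"
    using \<epsilon>\<sigma>3 cos_le_one[of \<theta>] mult_pos_pos[OF \<epsilon>(1), of \<sigma>] \<sigma>1 unfolding mult.assoc by linarith
  have \<eta>16: "16 * \<sigma> * \<epsilon> \<le> ?\<eta>"
  proof -
    have "16 * \<sigma> * \<epsilon> * cos \<theta> \<le> 16 * \<sigma> * \<epsilon> * 1" using \<sigma>1 \<epsilon>(1) by (intro mult_left_mono) auto
    also have "\<dots> \<le> 256 * \<sigma>\<^sup>2 * \<epsilon>"
    proof -
      have "16 * \<sigma> * 1 \<le> 256 * \<sigma> * \<sigma>" using \<sigma>1 by (intro mult_mono) auto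
      then show ?thesis using \<epsilon>(1) by (simp add: power2_eq_square)
    qed
    finally show ?thesis using \<theta> by (simp add: pos_le_divide_eq)
  qed
  have "\<exists>Q. displaced_node k Pl ?\<eta> T x Q" if T: "T \<in> M" and x: "x \<in> lattice_points k T" for T x
  proof -
    interpret tetrahedron T using simplex_M[OF T] .
    show ?thesis
    proof (cases "x \<notin> mesh_boundary M \<or> x \<in> C")
      case True
      then have "\<not> face_condition k T x" "\<And>e. \<not> edge_condition k T e x"
        using face_condition_D(3,5)[OF k] edge_condition_D(3,5)[OF k] by blast+
      then show ?thesis unfolding displaced_node_def
        using mult_nonneg_nonneg[OF less_imp_le[OF \<eta>0] less_imp_le[OF diameter_pos]]
        by (intro exI[of _ x]) simp
    next
      case False
      then have nb: "\<not> (x \<notin> mesh_boundary M \<or> x \<in> C)" .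
      from boundary_node_condition[OF k T x] False consider (f) "face_condition k T x" | (e) e where "edge_condition k T e x"
        by blast
      then show ?thesis
      proof cases
        case f
        have ne: "\<not> edge_condition k T e x" for e
          using face_condition_D(4)[OF k f] edge_condition_D(4)[OF k, of T e x] by auto
        obtain Q where Q: "nearest_intersections \<Omega> (affine hull {apex \<Omega> T, x}) x = {Q}" "norm (Q - x) \<le> 16 * \<sigma> * \<epsilon> * diameter T"
          using face_node[OF k reg flat \<epsilon>(1) \<epsilon>\<sigma> size f] by blast
        have "16 * \<sigma> * \<epsilon> * diameter T \<le> ?\<eta> * diameter T"
          by (rule mult_right_mono[OF \<eta>16 less_imp_le[OF diameter_pos]])
        then show ?thesis unfolding displaced_node_def using Q nb ne by (intro exI[of _ Q]) auto
      next
        case e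
        have nf: "\<not> face_condition k T x"
          using edge_condition_D(4)[OF k e] face_condition_D(4)[OF k, of T x] by auto
        have eu: "e' = e" if "edge_condition k T e' x" for e'
          using edge_condition_D(6)[OF k e] edge_condition_D(6)[OF k that] by simp
        obtain Q where Q: "nearest_intersections \<Omega> (orthogonal_line (Pl e) e x) x = {Q}" "norm (Q - x) \<le> ?\<eta> * diameter T"
          using edge_node[OF k reg flat \<theta> \<epsilon> size pl e] by blast
        show ?thesis unfolding displaced_node_def using Q nb nf eu by (intro exI[of _ Q]) blast
      qed
    qed
  qed
  then show ?thesis by metis
qed

text \<open>Each node contributes exactly one condition on each element that contains it: a boundary value at the
  displaced node, or agreement with a common value \<open>c x\<close>.\<close>

lemma W_space_iff:
  assumes k: "k > 0" and pt: "\<And>T x. T \<in> M \<Longrightarrow> x \<in> lattice_points k T \<Longrightarrow> displaced_node k Pl \<eta> T x (pt T x)"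
  shows "w \<in> W_space k \<Omega> M Pl g \<longleftrightarrow> w \<in> M \<rightarrow>\<^sub>E polys k \<and>
     (\<exists>c. \<forall>T\<in>M. \<forall>x\<in>lattice_points k T. w T (pt T x) = (if x \<in> mesh_boundary M then g (pt T x) else c x))"
    (is "?L \<longleftrightarrow> ?R")
proof
  have pt_id: "pt T x = x" if "T \<in> M" "x \<in> lattice_points k T" "x \<notin> mesh_boundary M \<or> x \<in> vertices T" for T x
    using pt[OF that(1,2)] that(3) by (auto simp: displaced_node_def)
  {
    assume L: ?L
    note W = L[unfolded W_space_def mem_Collect_eq]
    have wp: "w \<in> M \<rightarrow>\<^sub>E polys k" using W by (elim conjE)
    have W2: "\<forall>T \<in> M. \<forall>T' \<in> M. \<forall>x \<in> lattice_points k T \<inter> lattice_points k T'.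
        x \<notin> mesh_boundary M \<or> x \<in> vertices T \<longrightarrow> w T x = w T' x" using W by (elim conjE)
    have W3: "\<forall>T \<in> M. \<forall>x \<in> vertices T \<inter> mesh_boundary M. w T x = g x" using W by (elim conjE)
    have W4: "\<forall>T \<in> S_elements M. \<forall>x \<in> lattice_points k (boundary_face M T).
        (\<forall>e. e edge_of boundary_face M T \<longrightarrow> x \<notin> e) \<longrightarrow>
        (\<forall>P \<in> nearest_intersections \<Omega> (affine hull {apex \<Omega> T, x}) x. w T P = g P)" using W by (elim conjE)
    have W5: "\<forall>T \<in> O_elements M. \<forall>e. e edge_of T \<and> e \<subseteq> mesh_boundary M \<longrightarrow>
        (\<forall>x \<in> lattice_points k e - vertices e.
           \<forall>Q \<in> nearest_intersections \<Omega> (orthogonal_line (Pl e) e x) x. w T Q = g Q)" using W by (elim conjE)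
    have sv: "w T x = w T' x" if "T \<in> M" "T' \<in> M" "x \<in> lattice_points k T" "x \<in> lattice_points k T'"
        "x \<notin> mesh_boundary M" for T T' x
      using W2 that by blast
    have vx: "w T x = g x" if "T \<in> M" "x \<in> vertices T" "x \<in> mesh_boundary M" for T x
      using W3 that by blast
    have fc: "w T P = g P" if "face_condition k T x" "P \<in> nearest_intersections \<Omega> (affine hull {apex \<Omega> T, x}) x" for T x P
      using W4 that unfolding face_condition_def by blast
    have ec: "w T Q = g Q" if "edge_condition k T e x" "Q \<in> nearest_intersections \<Omega> (orthogonal_line (Pl e) e x) x" for T e x Q
      using W5 that unfolding edge_condition_def by blast
    define c where "c x = w (SOME T. T \<in> M \<and> x \<in> lattice_points k T) x" for x
    have "w T (pt T x) = (if x \<in> mesh_boundary M then g (pt T x) else c x)" if T: "T \<in> M" and x: "x \<in> lattice_points k T" for T x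
    proof (cases "x \<in> mesh_boundary M")
      case False
      let ?T = "SOME T. T \<in> M \<and> x \<in> lattice_points k T"
      have "?T \<in> M \<and> x \<in> lattice_points k ?T" by (rule someI[of _ T]) (use T x in simp)
      then have "w T x = c x" unfolding c_def using sv[OF T _ x _ False] by blast
      then show ?thesis using False pt_id[OF T x] by simp
    next
      case True
      have "w T (pt T x) = g (pt T x)"
      proof (cases "x \<in> vertices T")
        case True then show ?thesis using vx[OF T True \<open>x \<in> mesh_boundary M\<close>] pt_id[OF T x] by simp
      next
        case False
        from boundary_node_condition[OF k T x True False]
        consider (f) "face_condition k T x" | (e) e where "edge_condition k T e x" by blast
        then show ?thesis
        proof cases
          case f
          then show ?thesis using fc[OF f, of "pt T x"] pt[OF T x] by (simp add: displaced_node_def)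
        next
          case e
          then show ?thesis using ec[OF e, of "pt T x"] pt[OF T x] by (simp add: displaced_node_def)
        qed
      qed
      then show ?thesis using True by simp
    qed
    then show ?R using wp by blast
  }
  {
    assume R: ?R
    then obtain c where wp: "w \<in> M \<rightarrow>\<^sub>E polys k"
      and c: "\<And>T x. T \<in> M \<Longrightarrow> x \<in> lattice_points k T \<Longrightarrow> w T (pt T x) = (if x \<in> mesh_boundary M then g (pt T x) else c x)"
      by blast
    have vx: "w T x = g x" if T: "T \<in> M" and x: "x \<in> vertices T" "x \<in> mesh_boundary M" for T x
    proof -
      have xl: "x \<in> lattice_points k T" using tetrahedron.vertices_lattice[OF simplex_M[OF T] k] x(1) by blast
      show ?thesis using c[OF T xl] pt_id[OF T xl] x by simp
    qed
    have sv: "w T x = w T' x" if "T \<in> M" "T' \<in> M" "x \<in> lattice_points k T" "x \<in> lattice_points k T'"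
      "x \<notin> mesh_boundary M \<or> x \<in> vertices T" for T T' x
    proof (cases "x \<in> mesh_boundary M")
      case False
      then show ?thesis using c[OF that(1,3)] c[OF that(2,4)] pt_id[OF that(1,3)] pt_id[OF that(2,4)] by simp
    next
      case True
      then have v: "x \<in> vertices T" using that(5) by blast
      have "x \<in> T'" using tetrahedron.lattice_subset[OF simplex_M[OF that(2)] k] that(4) by blast
      then have "x \<in> vertices T'" by (rule vertex_of_neighbour[OF that(1,2) v])
      then show ?thesis using vx[OF that(1) v True] vx[OF that(2) _ True] by simp
    qed
    have fc: "w T P = g P" if "face_condition k T x" "P \<in> nearest_intersections \<Omega> (affine hull {apex \<Omega> T, x}) x" for T x P
    proof -
      note D = face_condition_D[OF k that(1)]
      have "P = pt T x" using pt[OF D(1,2)] that by (simp add: displaced_node_def)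
      then show ?thesis using c[OF D(1,2)] D(3) by simp
    qed
    have ec: "w T Q = g Q" if "edge_condition k T e x" "Q \<in> nearest_intersections \<Omega> (orthogonal_line (Pl e) e x) x" for T e x Q
    proof -
      note D = edge_condition_D[OF k that(1)]
      have "Q = pt T x" using pt[OF D(1,2)] that by (auto simp: displaced_node_def)
      then show ?thesis using c[OF D(1,2)] D(3) by simp
    qed
    show ?L
      unfolding W_space_def
    proof (intro CollectI conjI ballI allI impI, goal_cases)
      case 1 show ?case by (rule wp)
    next
      case (2 T T' x) then show ?case using sv by blast
    next
      case (3 T x) then show ?case using vx by blast
    next
      case (4 T x P) then show ?case using fc[of T x P] unfolding face_condition_def by blast
    next
      case (5 T e x Q) then show ?case using ec[of T e x Q] unfolding edge_condition_def by blast
    qed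
  }
qed

end

section \<open>The discrete problem as a linear system\<close>

lemma grad_eq_on_open:
  assumes "open S" "x \<in> S" "\<And>y. y \<in> S \<Longrightarrow> f y = p y" "C1_fun p"
  shows "grad f x = grad p x"
proof (rule grad_eqI)
  have "(p has_derivative (\<lambda>h. h \<bullet> grad p x)) (at x)"
    using C1_fun_gderiv[OF assms(4)] by (simp add: gderiv_def)
  then show "GDERIV f x :> grad p x"
    unfolding gderiv_def by (rule has_derivative_transform_within_open[OF _ assms(1,2)]) (simp add: assms(3))
qed

lemma energy_add_left:
  assumes "compact T" "C1_fun p" "C1_fun q" "C1_fun r"
  shows "energy T (\<lambda>z. p z + q z) r = energy T p r + energy T q r"
  unfolding energy_def C1_fun_add(2)[OF assms(2,3)] inner_add_left
  by (rule set_integral_add(2)) (intro energy_integrable assms)+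

lemma energy_sum:
  fixes p q :: "'i \<Rightarrow> real^3 \<Rightarrow> real"
  assumes T: "compact T" and p: "\<And>i. i \<in> I \<Longrightarrow> C1_fun (p i)" and q: "\<And>j. j \<in> J \<Longrightarrow> C1_fun (q j)"
  shows "energy T (\<lambda>z. \<Sum>i\<in>I. c i * p i z) (\<lambda>z. \<Sum>j\<in>J. d j * q j z)
       = (\<Sum>j\<in>J. d j * (\<Sum>i\<in>I. energy T (p i) (q j) * c i))"
proof -
  have gp: "grad (\<lambda>z. \<Sum>i\<in>I. c i * p i z) = (\<lambda>z. \<Sum>i\<in>I. c i *\<^sub>R grad (p i) z)"
    using C1_fun_sum[of I p c] p by simp
  have gq: "grad (\<lambda>z. \<Sum>j\<in>J. d j * q j z) = (\<lambda>z. \<Sum>j\<in>J. d j *\<^sub>R grad (q j) z)"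
    using C1_fun_sum[of J q d] q by simp
  have int: "set_integrable lebesgue (interior T) (\<lambda>z. grad (p i) z \<bullet> grad (q j) z)" if "i \<in> I" "j \<in> J" for i j
    using that by (intro energy_integrable T p q)
  have "energy T (\<lambda>z. \<Sum>i\<in>I. c i * p i z) (\<lambda>z. \<Sum>j\<in>J. d j * q j z)
      = (LINT z|lebesgue. (\<Sum>j\<in>J. \<Sum>i\<in>I. (d j * c i) * (indicator (interior T) z *\<^sub>R (grad (p i) z \<bullet> grad (q j) z))))"
    unfolding energy_def gp gq set_lebesgue_integral_def
    by (rule Bochner_Integration.integral_cong)
       (auto simp: inner_sum_left inner_sum_right sum_distrib_left mult_ac intro: sum.swap)
  also have "\<dots> = (\<Sum>j\<in>J. LINT z|lebesgue. (\<Sum>i\<in>I. (d j * c i) * (indicator (interior T) z *\<^sub>R (grad (p i) z \<bullet> grad (q j) z))))"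
    using int unfolding set_integrable_def
    by (intro Bochner_Integration.integral_sum Bochner_Integration.integrable_sum integrable_mult_right) auto
  also have "\<dots> = (\<Sum>j\<in>J. \<Sum>i\<in>I. LINT z|lebesgue. (d j * c i) * (indicator (interior T) z *\<^sub>R (grad (p i) z \<bullet> grad (q j) z)))"
    using int unfolding set_integrable_def
    by (intro sum.cong refl Bochner_Integration.integral_sum integrable_mult_right) auto
  also have "\<dots> = (\<Sum>j\<in>J. \<Sum>i\<in>I. (d j * c i) * energy T (p i) (q j))"
    unfolding energy_def set_lebesgue_integral_def by simp
  also have "\<dots> = (\<Sum>j\<in>J. d j * (\<Sum>i\<in>I. energy T (p i) (q j) * c i))"
    by (simp add: sum_distrib_left mult_ac)
  finally show ?thesis .
qed

context mesh_in_domain begin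

text \<open>The broken gradient is zero off the interiors of the elements, so the integrands agree at every
  point.\<close>

lemma a_form_eq_sum_energy:
  assumes "\<And>T. T \<in> M \<Longrightarrow> C1_fun (w T)" "\<And>T. T \<in> M \<Longrightarrow> C1_fun (p T)"
    and v: "\<And>T x. T \<in> M \<Longrightarrow> x \<in> T \<Longrightarrow> v x = p T x"
  shows "a_form M w v = (\<Sum>T\<in>M. energy T (w T) (p T))"
proof -
  have int: "set_integrable lebesgue (interior T) (\<lambda>z. grad (w T) z \<bullet> grad (p T) z)" if "T \<in> M" for T
    using that assms tetrahedron.compact_T[OF simplex_M] by (intro energy_integrable) auto
  have "a_form M w v = (LINT x|lebesgue. (\<Sum>T\<in>M. indicator (interior T) x *\<^sub>R (grad (w T) x \<bullet> grad (p T) x)))"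
    unfolding a_form_def set_lebesgue_integral_def
  proof (rule Bochner_Integration.integral_cong[OF refl])
    fix x
    have "broken_grad M w x \<bullet> grad v x = (\<Sum>T | T \<in> M \<and> x \<in> interior T. grad (w T) x \<bullet> grad v x)"
      unfolding broken_grad_def by (rule inner_sum_left)
    also have "\<dots> = (\<Sum>T | T \<in> M \<and> x \<in> interior T. grad (w T) x \<bullet> grad (p T) x)"
    proof (rule sum.cong[OF refl])
      fix T assume T: "T \<in> {T. T \<in> M \<and> x \<in> interior T}"
      then have "grad v x = grad (p T) x"
        using v interior_subset assms(2) by (intro grad_eq_on_open[of "interior T"]) auto
      then show "grad (w T) x \<bullet> grad v x = grad (w T) x \<bullet> grad (p T) x" by simp
    qed
    also have "\<dots> = (\<Sum>T\<in>M. indicator (interior T) x *\<^sub>R (grad (w T) x \<bullet> grad (p T) x))"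
      using finite_M by (intro sum.mono_neutral_cong_left) (auto simp: indicator_def)
    finally have *: "broken_grad M w x \<bullet> grad v x = (\<Sum>T\<in>M. indicator (interior T) x *\<^sub>R (grad (w T) x \<bullet> grad (p T) x))" .
    show "indicator (mesh_domain M) x *\<^sub>R (broken_grad M w x \<bullet> grad v x)
        = (\<Sum>T\<in>M. indicator (interior T) x *\<^sub>R (grad (w T) x \<bullet> grad (p T) x))"
    proof (cases "x \<in> mesh_domain M")
      case True then show ?thesis using * by simp
    next
      case False
      then have "(\<Sum>T\<in>M. indicator (interior T) x *\<^sub>R (grad (w T) x \<bullet> grad (p T) x)) = 0"
        using interior_subset_mesh_domain by (intro sum.neutral ballI) (auto simp: indicator_def)
      then show ?thesis using False by simp
    qed
  qed
  also have "\<dots> = (\<Sum>T\<in>M. energy T (w T) (p T))"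
    unfolding energy_def set_lebesgue_integral_def
    using int unfolding set_integrable_def by (intro Bochner_Integration.integral_sum)
  finally show ?thesis .
qed

text \<open>A square integrable function on a bounded set is integrable, by \<open>\<bar>t\<bar> \<le> 1 + t\<^sup>2\<close>, and the test function is
  bounded.\<close>

lemma load_integrable:
  assumes "bounded \<Omega>" "square_integrable \<Omega> f" "v \<in> V_space k M"
  shows "set_integrable lebesgue (mesh_domain M) (\<lambda>x. (if x \<in> \<Omega> then f x else 0) * v x)"
proof -
  have fm: "f \<in> borel_measurable (lebesgue_on \<Omega>)" and f2: "integrable (lebesgue_on \<Omega>) (\<lambda>x. (f x)\<^sup>2)"
    using assms(2) by (auto simp: square_integrable_def)
  have \<Omega>m: "\<Omega> \<in> lmeasurable" using op assms(1) by (intro lmeasurable_open)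
  then have "integrable (lebesgue_on \<Omega>) (\<lambda>x. 1 + (f x)\<^sup>2)"
    using f2 finite_measure.integrable_const[OF finite_measure_lebesgue_on]
    by (intro Bochner_Integration.integrable_add) auto
  then have "integrable (lebesgue_on \<Omega>) f"
  proof (rule Bochner_Integration.integrable_bound)
    have "\<bar>t\<bar> \<le> 1 + t\<^sup>2" for t :: real
      using zero_le_power2[of "\<bar>t\<bar> - 1"] by (simp add: power2_diff) 
    then show "AE x in lebesgue_on \<Omega>. norm (f x) \<le> norm (1 + (f x)\<^sup>2)"
      by (intro AE_I2) (simp add: abs_of_nonneg)
  qed (rule fm)
  then have "integrable lebesgue (\<lambda>x. indicator \<Omega> x *\<^sub>R f x)"
    using \<Omega>m by (subst (asm) integrable_restrict_space) (auto simp: fmeasurable_def)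
  then have F: "integrable lebesgue (\<lambda>x. if x \<in> \<Omega> then f x else 0)"
    by (rule back_subst[of "integrable lebesgue"]) (auto simp: indicator_def)
  have vc: "continuous_on (\<Union>M) v" using assms(3) closure_mesh_domain by (simp add: V_space_def)
  obtain K where K: "\<And>x. x \<in> \<Union>M \<Longrightarrow> norm (v x) \<le> K"
    using compact_imp_bounded[OF compact_continuous_image[OF vc compact_Union]] unfolding bounded_iff by auto
  have sub: "mesh_domain M \<subseteq> \<Union>M" by (simp add: mesh_domain_def interior_subset)
  have dm: "open (mesh_domain M)" by (simp add: mesh_domain_def)
  have vm: "(\<lambda>x. indicator (mesh_domain M) x *\<^sub>R v x) \<in> borel_measurable lebesgue"
    using borel_measurable_continuous_on_indicator[of "mesh_domain M" v] continuous_on_subset[OF vc sub] dm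
    by (intro measurable_completion) auto
  have "integrable lebesgue (\<lambda>x. (if x \<in> \<Omega> then f x else 0) * \<bar>K\<bar>)" using F by simp
  then show ?thesis
    unfolding set_integrable_def
  proof (rule Bochner_Integration.integrable_bound)
    have "(\<lambda>x. (if x \<in> \<Omega> then f x else 0) * (indicator (mesh_domain M) x *\<^sub>R v x)) \<in> borel_measurable lebesgue"
      by (intro borel_measurable_times borel_measurable_integrable[OF F] vm)
    then show "(\<lambda>x. indicator (mesh_domain M) x *\<^sub>R ((if x \<in> \<Omega> then f x else 0) * v x)) \<in> borel_measurable lebesgue"
      by (simp add: mult_ac)
    have "\<bar>v x\<bar> \<le> \<bar>K\<bar>" if "x \<in> mesh_domain M" for x
    proof -
      have "norm (v x) \<le> K" using K sub that by blast
      then show ?thesis unfolding real_norm_def by linarith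
    qed
    then show "AE x in lebesgue. norm (indicator (mesh_domain M) x *\<^sub>R ((if x \<in> \<Omega> then f x else 0) * v x))
        \<le> norm ((if x \<in> \<Omega> then f x else 0) * \<bar>K\<bar>)"
      by (intro AE_I2) (auto simp: indicator_def abs_mult intro!: mult_left_mono)
  qed
qed

lemma L_form_sum:
  assumes "bounded \<Omega>" "square_integrable \<Omega> f" "\<And>y. y \<in> N \<Longrightarrow> \<phi> y \<in> V_space k M"
    and "\<And>x. x \<in> mesh_domain M \<Longrightarrow> v x = (\<Sum>y\<in>N. d y * \<phi> y x)"
  shows "L_form \<Omega> M f v = (\<Sum>y\<in>N. d y * L_form \<Omega> M f (\<phi> y))"
proof -
  let ?F = "\<lambda>x. if x \<in> \<Omega> then f x else 0"
  have int: "integrable lebesgue (\<lambda>x. indicator (mesh_domain M) x *\<^sub>R (?F x * \<phi> y x))" if "y \<in> N" for y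
    using load_integrable[OF assms(1,2) assms(3)[OF that]] by (simp add: set_integrable_def)
  have "L_form \<Omega> M f v = (LINT x|lebesgue. (\<Sum>y\<in>N. d y * (indicator (mesh_domain M) x *\<^sub>R (?F x * \<phi> y x))))"
    unfolding L_form_def set_lebesgue_integral_def
  proof (rule Bochner_Integration.integral_cong[OF refl])
    fix x
    show "indicator (mesh_domain M) x *\<^sub>R (?F x * v x) = (\<Sum>y\<in>N. d y * (indicator (mesh_domain M) x *\<^sub>R (?F x * \<phi> y x)))"
      using assms(4)[of x] by (cases "x \<in> mesh_domain M") (auto simp: sum_distrib_left mult_ac)
  qed
  also have "\<dots> = (\<Sum>y\<in>N. d y * L_form \<Omega> M f (\<phi> y))"
    unfolding L_form_def set_lebesgue_integral_def using int
    by (subst Bochner_Integration.integral_sum) auto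
  finally show ?thesis .
qed

text \<open>A nodal function that is constant on each element and zero on the boundary vanishes: the
  elements with a given nonzero value would fill a set that is both open and compact.\<close>

lemma locally_constant_nodal_zero:
  assumes k: "k > 0" and bd: "\<And>x. x \<in> mesh_boundary M \<Longrightarrow> b x = (0::real)"
    and const: "\<And>T x y. \<lbrakk>T \<in> M; x \<in> lattice_points k T; y \<in> lattice_points k T\<rbrakk> \<Longrightarrow> b x = b y"
    and T0: "T0 \<in> M" "x0 \<in> lattice_points k T0"
  shows "b x0 = 0"
proof (rule ccontr)
  assume nz: "b x0 \<noteq> 0"
  have V: "\<exists>v. v \<in> vertices T" if "T \<in> M" for T
    using tetrahedron.vertices_props(3)[OF simplex_M[OF that]] by (metis card.empty ex_in_conv zero_neq_numeral)
  have VL: "vertices T \<subseteq> lattice_points k T" if "T \<in> M" for T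
    using tetrahedron.vertices_lattice[OF simplex_M[OF that] k] .
  define MK where "MK = {T\<in>M. \<forall>x\<in>lattice_points k T. b x = b x0}"
  let ?K = "\<Union>MK" and ?K' = "\<Union>(M - MK)"
  have disj: "T \<inter> T' = {}" if "T \<in> MK" "T' \<in> M - MK" for T T'
  proof (rule ccontr)
    assume ne: "T \<inter> T' \<noteq> {}"
    have TM: "T \<in> M" "T' \<in> M" using that by (auto simp: MK_def)
    interpret tetrahedron T using simplex_M[OF TM(1)] .
    obtain c where c: "c \<subseteq> C" "T \<inter> T' = convex hull c"
      using conform[OF TM] face_of_iff by blast
    then obtain v where v: "v \<in> c" using ne by fastforce
    then have "v \<in> T'" using c(2) hull_inc[of v c convex] by blast
    then have vv: "v \<in> vertices T" "v \<in> vertices T'" using vertex_of_neighbour[OF TM] v c(1) by auto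
    have "b v = b x0" using that(1) vv(1) VL[OF TM(1)] by (auto simp: MK_def)
    moreover have "b x = b v" if "x \<in> lattice_points k T'" for x
      using const[OF TM(2) that] vv(2) VL[OF TM(2)] by blast
    ultimately have "T' \<in> MK" using TM(2) by (simp add: MK_def)
    then show False using that(2) by blast
  qed
  have offb: "x \<notin> mesh_boundary M" if TK: "T \<in> MK" and xT: "x \<in> T" for T x
  proof
    assume x: "x \<in> mesh_boundary M"
    have TM: "T \<in> M" using TK by (auto simp: MK_def)
    interpret tetrahedron T using simplex_M[OF TM] .
    obtain v where v: "v \<in> carrier x" using carrier_face(3)[OF xT] by blast
    have "v \<in> mesh_boundary M"
      using carrier_in_boundary[OF TM xT x] hull_inc[OF v, of convex] by blast
    then have "b v = 0" by (rule bd)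
    moreover have "b v = b x0" using TK v carrier_subset VL[OF TM] by (auto simp: MK_def)
    ultimately show False using nz by simp
  qed
  have MKM: "MK \<subseteq> M" by (auto simp: MK_def)
  have cl: "closed ?K" "closed ?K'"
    using finite_M MKM tetrahedron.compact_T[OF simplex_M] compact_imp_closed finite_subset
    by (auto intro!: closed_Union)
  have "?K = mesh_domain M - ?K'"
  proof (intro equalityI subsetI)
    fix x assume "x \<in> ?K"
    then obtain T where T: "T \<in> MK" "x \<in> T" by blast
    have "x \<in> mesh_domain M" using offb[OF T] T MKM mesh_boundary_iff by blast
    moreover have "x \<notin> ?K'" using disj[OF T(1)] T(2) by blast
    ultimately show "x \<in> mesh_domain M - ?K'" by blast
  next
    fix x assume x: "x \<in> mesh_domain M - ?K'"
    then have "x \<in> \<Union>M" using interior_subset unfolding mesh_domain_def by blast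
    then show "x \<in> ?K" using x by blast
  qed
  then have "open ?K" using cl(2) by (simp add: mesh_domain_def open_Diff)
  moreover have "T0 \<in> MK" using const[OF T0(1) _ T0(2)] T0(1) by (simp add: MK_def)
  then have "?K \<noteq> {}" using T0 tetrahedron.T_nonempty[OF simplex_M[OF T0(1)]] by blast
  ultimately have "?K = UNIV" using clopen[of ?K] cl(1) by blast
  moreover have "bounded ?K" using compact_imp_bounded[OF compact_Union] MKM by (meson Union_mono bounded_subset)
  ultimately show False using not_bounded_UNIV by metis
qed

end

text \<open>A mesh with a choice \<open>pt\<close> of displaced nodes and the dual bases \<open>B\<close> on the elements. The parameters of the discrete
  problem are the values at \<open>nodes\<close>; \<open>trial c\<close> and \<open>test_fun c\<close> are the trial and the test function with
  the values \<open>c\<close>. The part \<open>lift\<close> of the trial functions carries the boundary values, and \<open>trial0 c\<close> is the linear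
  part.\<close>

locale displaced_mesh = mesh_in_domain +
  fixes k :: nat and \<sigma> \<eta> :: real and Pl :: "(real^3) set \<Rightarrow> (real^3) set"
    and pt :: "(real^3) set \<Rightarrow> real^3 \<Rightarrow> real^3" and B :: "(real^3) set \<Rightarrow> real^3 \<Rightarrow> real^3 \<Rightarrow> real"
    and g :: "real^3 \<Rightarrow> real"
  assumes k: "k > 0"
    and reg: "T \<in> M \<Longrightarrow> shape_regular_tetrahedron T \<sigma>"
    and pt: "T \<in> M \<Longrightarrow> x \<in> lattice_points k T \<Longrightarrow> displaced_node k Pl \<eta> T x (pt T x)"
    and \<eta>: "\<eta> \<le> node_tol k \<sigma>"
    and B: "T \<in> M \<Longrightarrow> nodal_basis k (lattice_points k T) (pt T) (B T)"
begin

definition nodes :: "(real^3) set" where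
  "nodes = (\<Union>T\<in>M. lattice_points k T) - mesh_boundary M"

definition test_part :: "(real^3) set \<Rightarrow> real^3 \<Rightarrow> real^3 \<Rightarrow> real" where
  "test_part T y = (if y \<in> lattice_points k T then tetrahedron.lagrange T k y else (\<lambda>z. 0))"

definition trial_part :: "(real^3) set \<Rightarrow> real^3 \<Rightarrow> real^3 \<Rightarrow> real" where
  "trial_part T y = (if y \<in> lattice_points k T then B T y else (\<lambda>z. 0))"

definition lift :: "(real^3) set \<Rightarrow> real^3 \<Rightarrow> real" where
  "lift T z = (\<Sum>x\<in>lattice_points k T \<inter> mesh_boundary M. g (pt T x) * B T x z)"

definition test :: "(real^3 \<Rightarrow> real) \<Rightarrow> (real^3) set \<Rightarrow> real^3 \<Rightarrow> real" where
  "test c T = (\<lambda>z. \<Sum>y\<in>nodes. c y * test_part T y z)"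

definition trial0 :: "(real^3 \<Rightarrow> real) \<Rightarrow> (real^3) set \<Rightarrow> real^3 \<Rightarrow> real" where
  "trial0 c T = (\<lambda>z. \<Sum>y\<in>nodes. c y * trial_part T y z)"

definition trial :: "(real^3 \<Rightarrow> real) \<Rightarrow> (real^3) set \<Rightarrow> real^3 \<Rightarrow> real" where
  "trial c = (\<lambda>T\<in>M. \<lambda>z. lift T z + trial0 c T z)"

definition test_fun :: "(real^3 \<Rightarrow> real) \<Rightarrow> real^3 \<Rightarrow> real" where
  "test_fun c x = (if x \<in> \<Union>M then test c (SOME T. T \<in> M \<and> x \<in> T) x else 0)"

definition stiffness :: "real^3 \<Rightarrow> real^3 \<Rightarrow> real" where
  "stiffness y z = (\<Sum>T\<in>M. energy T (trial_part T z) (test_part T y))"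

lemma finite_lattice: "T \<in> M \<Longrightarrow> finite (lattice_points k T)"
  using tetrahedron.lattice_finite(1)[OF simplex_M k] .

lemma finite_nodes: "finite nodes"
  unfolding nodes_def using finite_M finite_lattice by blast

lemma compact_M: "T \<in> M \<Longrightarrow> compact T"
  using tetrahedron.compact_T[OF simplex_M] .

lemma B_props:
  assumes "T \<in> M" "x \<in> lattice_points k T"
  shows "B T x \<in> polys k" "y \<in> lattice_points k T \<Longrightarrow> B T x (pt T y) = (if x = y then 1 else 0)"
  using B[OF assms(1)] assms(2) unfolding nodal_basis_def by auto

lemma B_expansion:
  assumes "T \<in> M" "p \<in> polys k"
  shows "p z = (\<Sum>x\<in>lattice_points k T. p (pt T x) * B T x z)"
proof -
  have "\<forall>p\<in>polys k. p = (\<lambda>z. \<Sum>x\<in>lattice_points k T. p (pt T x) * B T x z)"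
    using B[OF assms(1)] unfolding nodal_basis_def by (elim conjE)
  then show ?thesis using assms(2) by (metis (no_types, lifting))
qed

lemma test_part_polys: "T \<in> M \<Longrightarrow> test_part T y \<in> polys k"
  unfolding test_part_def using tetrahedron.lagrange_in_polys[OF simplex_M k] by (auto intro: polys_const)

lemma trial_part_polys: "T \<in> M \<Longrightarrow> trial_part T y \<in> polys k"
  unfolding trial_part_def using B_props(1) by (auto intro: polys_const)

lemma test_polys: "T \<in> M \<Longrightarrow> test c T \<in> polys k"
  unfolding test_def by (intro polys_sum test_part_polys)

lemma trial0_polys: "T \<in> M \<Longrightarrow> trial0 c T \<in> polys k"
  unfolding trial0_def by (intro polys_sum trial_part_polys)

lemma lift_polys: "T \<in> M \<Longrightarrow> lift T \<in> polys k"
  unfolding lift_def[abs_def] by (intro polys_sum B_props(1)) auto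

lemma test_node:
  assumes "T \<in> M" "x \<in> lattice_points k T"
  shows "test c T x = (if x \<in> mesh_boundary M then 0 else c x)"
proof -
  have "test c T x = (\<Sum>y\<in>nodes. if y = x then c x else 0)"
    unfolding test_def
    by (intro sum.cong refl) (use assms(2) in \<open>auto simp: test_part_def tetrahedron.lagrange_node[OF simplex_M[OF assms(1)] k]\<close>)
  then show ?thesis using finite_nodes assms by (auto simp: nodes_def)
qed

lemma trial0_node:
  assumes "T \<in> M" "x \<in> lattice_points k T"
  shows "trial0 c T (pt T x) = (if x \<in> mesh_boundary M then 0 else c x)"
proof -
  have "trial0 c T (pt T x) = (\<Sum>y\<in>nodes. if y = x then c x else 0)"
    unfolding trial0_def
    by (intro sum.cong refl) (use assms in \<open>auto simp: trial_part_def B_props(2)\<close>)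
  then show ?thesis using finite_nodes assms by (auto simp: nodes_def)
qed

lemma lift_node:
  assumes "T \<in> M" "x \<in> lattice_points k T"
  shows "lift T (pt T x) = (if x \<in> mesh_boundary M then g (pt T x) else 0)"
proof -
  have "lift T (pt T x) = (\<Sum>y\<in>lattice_points k T \<inter> mesh_boundary M. if y = x then g (pt T x) else 0)"
    unfolding lift_def by (intro sum.cong refl) (use assms in \<open>auto simp: B_props(2)\<close>)
  then show ?thesis using finite_lattice[OF assms(1)] assms by auto
qed

lemma W_space_eq_trial: "w \<in> W_space k \<Omega> M Pl g \<longleftrightarrow> (\<exists>c. w = trial c)"
proof -
  have iff: "w \<in> W_space k \<Omega> M Pl g \<longleftrightarrow> w \<in> M \<rightarrow>\<^sub>E polys k \<and>
     (\<exists>c. \<forall>T\<in>M. \<forall>x\<in>lattice_points k T. w T (pt T x) = (if x \<in> mesh_boundary M then g (pt T x) else c x))"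
    by (rule W_space_iff[OF k pt])
  show ?thesis
  proof
    assume "w \<in> W_space k \<Omega> M Pl g"
    then have "w \<in> M \<rightarrow>\<^sub>E polys k \<and>
       (\<exists>c. \<forall>T\<in>M. \<forall>x\<in>lattice_points k T. w T (pt T x) = (if x \<in> mesh_boundary M then g (pt T x) else c x))"
      by (rule iff[THEN iffD1])
    then obtain c where w: "w \<in> M \<rightarrow>\<^sub>E polys k"
      and c: "\<And>T x. T \<in> M \<Longrightarrow> x \<in> lattice_points k T \<Longrightarrow> w T (pt T x) = (if x \<in> mesh_boundary M then g (pt T x) else c x)"
      by blast
    have "w T = trial c T" for T
    proof (cases "T \<in> M")
      case False
      then show ?thesis using PiE_arb[OF w] by (simp add: trial_def)
    next
      case True
      then have wp: "w T \<in> polys k" using w by blast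
      have p: "(\<lambda>z. lift T z + trial0 c T z) \<in> polys k" using True by (intro polys_add lift_polys trial0_polys)
      show ?thesis
      proof
        fix z
        have "w T z = (\<Sum>x\<in>lattice_points k T. (lift T (pt T x) + trial0 c T (pt T x)) * B T x z)"
          unfolding B_expansion[OF True wp, of z]
          by (intro sum.cong refl) (simp add: c[OF True] lift_node[OF True] trial0_node[OF True])
        also have "\<dots> = lift T z + trial0 c T z"
          using B_expansion[OF True p, of z] by simp
        finally show "w T z = trial c T z" using True by (simp add: trial_def)
      qed
    qed
    then show "\<exists>c. w = trial c" by blast
  next
    assume "\<exists>c. w = trial c"
    then obtain c where w: "w = trial c" by blast
    have "w \<in> M \<rightarrow>\<^sub>E polys k"
      unfolding w trial_def by (auto intro!: polys_add lift_polys trial0_polys)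
    moreover have "w T (pt T x) = (if x \<in> mesh_boundary M then g (pt T x) else c x)"
      if "T \<in> M" "x \<in> lattice_points k T" for T x
      using that by (simp add: w trial_def lift_node trial0_node)
    ultimately show "w \<in> W_space k \<Omega> M Pl g"
      by (intro iff[THEN iffD2]) blast
  qed
qed

lemma test_fun_eq:
  assumes "T \<in> M" "z \<in> T"
  shows "test_fun c z = test c T z"
proof -
  let ?T = "SOME T. T \<in> M \<and> z \<in> T"
  have T: "?T \<in> M" "z \<in> ?T" using someI[of "\<lambda>T. T \<in> M \<and> z \<in> T" T] assms by auto
  have "test c ?T z = test c T z"
  proof (rule polys_agree_on_intersection[OF k T(1) assms(1) test_polys[OF T(1)] test_polys[OF assms(1)] _ T(2) assms(2)])
    fix x assume "x \<in> lattice_points k ?T" "x \<in> lattice_points k T"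
    then show "test c ?T x = test c T x" by (simp only: test_node[OF T(1)] test_node[OF assms(1)])
  qed
  then show ?thesis using assms by (auto simp: test_fun_def)
qed

text \<open>Two elements share the nodes of their intersection, so the pieces agree there; on a boundary face all nodes
  have the value 0.\<close>

lemma test_fun_in_V: "test_fun c \<in> V_space k M"
proof -
  have "continuous_on (\<Union>T\<in>M. T) (test_fun c)"
  proof (rule continuous_on_closed_Union[OF finite_M])
    fix T assume T: "T \<in> M"
    show "closed T" using compact_M[OF T] by (rule compact_imp_closed)
    have "continuous_on UNIV (test c T)"
      using C1_fun_polys[OF test_polys[OF T]] unfolding C1_fun_def gderiv_def
      by (meson has_derivative_continuous continuous_at_imp_continuous_on)
    then show "continuous_on T (test_fun c)"
      by (subst continuous_on_cong[OF refl test_fun_eq[OF T]]) (auto intro: continuous_on_subset)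
  qed
  moreover have "test_fun c x = 0" if x: "x \<in> mesh_boundary M" for x
  proof -
    obtain T where T: "T \<in> M" "x \<in> T" using x mesh_boundary_iff by blast
    have "test c T x = 0"
      by (rule polys_vanish_on_boundary[OF k T(1) test_polys[OF T(1)] _ T(2) x]) (simp add: test_node[OF T(1)])
    then show ?thesis using test_fun_eq[OF T] by simp
  qed
  moreover have "\<exists>p\<in>polys k. \<forall>x\<in>T. test_fun c x = p x" if "T \<in> M" for T
    using test_fun_eq[OF that] test_polys[OF that] by blast
  ultimately show ?thesis
    unfolding V_space_def closure_mesh_domain by simp
qed

lemma V_space_test:
  assumes v: "v \<in> V_space k M" and T: "T \<in> M" "z \<in> T"
  shows "v z = test v T z"
proof -
  obtain p where p: "p \<in> polys k" "\<And>x. x \<in> T \<Longrightarrow> v x = p x" using v T(1) unfolding V_space_def by blast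
  have v0: "v x = 0" if "x \<in> mesh_boundary M" for x using v that unfolding V_space_def by blast
  interpret tetrahedron T using simplex_M[OF T(1)] .
  have "p z - test v T z = 0"
  proof (rule vanish_on_face[OF k polys_diff[OF p(1) test_polys[OF T(1)]] face_of_refl[OF convex_T] _ T(2)])
    fix x assume x: "x \<in> lattice_points k T"
    have "p x = v x" using p(2) x lattice_subset[OF k] by fastforce
    then show "p x - test v T x = 0" using v0[of x] test_node[OF T(1) x, of v] by simp
  qed
  then show ?thesis using p(2)[OF T(2)] by simp
qed

lemma a_form_trial:
  assumes v: "v \<in> V_space k M"
  shows "a_form M (trial c) v = (\<Sum>y\<in>nodes. v y * ((\<Sum>T\<in>M. energy T (lift T) (test_part T y)) + (\<Sum>z\<in>nodes. stiffness y z * c z)))"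
proof -
  have "a_form M (trial c) v = (\<Sum>T\<in>M. energy T (trial c T) (test v T))"
  proof (rule a_form_eq_sum_energy)
    show "C1_fun (trial c T)" if "T \<in> M" for T
      using that by (auto simp: trial_def intro!: C1_fun_polys[of _ k] polys_add lift_polys trial0_polys)
    show "C1_fun (test v T)" if "T \<in> M" for T using C1_fun_polys[OF test_polys[OF that]] .
    show "v x = test v T x" if "T \<in> M" "x \<in> T" for T x by (rule V_space_test[OF v that])
  qed
  also have "\<dots> = (\<Sum>T\<in>M. \<Sum>y\<in>nodes. v y * (energy T (lift T) (test_part T y) + (\<Sum>z\<in>nodes. energy T (trial_part T z) (test_part T y) * c z)))"
  proof (rule sum.cong[OF refl])
    fix T assume T: "T \<in> M"
    have C1: "C1_fun (lift T)" "C1_fun (trial0 c T)" "C1_fun (test v T)"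
      using C1_fun_polys lift_polys[OF T] trial0_polys[OF T] test_polys[OF T] by blast+
    have "energy T (trial c T) (test v T) = energy T (lift T) (test v T) + energy T (trial0 c T) (test v T)"
      using energy_add_left[OF compact_M[OF T] C1] T by (simp add: trial_def)
    also have "energy T (trial0 c T) (test v T) = (\<Sum>y\<in>nodes. v y * (\<Sum>z\<in>nodes. energy T (trial_part T z) (test_part T y) * c z))"
      unfolding trial0_def test_def
      by (rule energy_sum[OF compact_M[OF T]]) (auto intro: C1_fun_polys test_part_polys[OF T] trial_part_polys[OF T])
    also have "energy T (lift T) (test v T) = (\<Sum>y\<in>nodes. v y * energy T (lift T) (test_part T y))"
    proof -
      have "energy T (\<lambda>z. \<Sum>i\<in>{0::real^3}. 1 * lift T z) (test v T) = (\<Sum>y\<in>nodes. v y * (\<Sum>i\<in>{0::real^3}. energy T (lift T) (test_part T y) * 1))"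
        unfolding test_def
        by (rule energy_sum[OF compact_M[OF T]]) (auto intro: C1 C1_fun_polys test_part_polys[OF T])
      then show ?thesis by simp
    qed
    finally show "energy T (trial c T) (test v T) = (\<Sum>y\<in>nodes. v y * (energy T (lift T) (test_part T y) + (\<Sum>z\<in>nodes. energy T (trial_part T z) (test_part T y) * c z)))"
      by (simp add: sum.distrib distrib_left)
  qed
  also have "\<dots> = (\<Sum>y\<in>nodes. v y * (\<Sum>T\<in>M. energy T (lift T) (test_part T y) + (\<Sum>z\<in>nodes. energy T (trial_part T z) (test_part T y) * c z)))"
    by (subst sum.swap) (simp add: sum_distrib_left)
  also have "\<dots> = (\<Sum>y\<in>nodes. v y * ((\<Sum>T\<in>M. energy T (lift T) (test_part T y)) + (\<Sum>z\<in>nodes. stiffness y z * c z)))"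
  proof -
    have "(\<Sum>T\<in>M. \<Sum>z\<in>nodes. energy T (trial_part T z) (test_part T y) * c z) = (\<Sum>z\<in>nodes. stiffness y z * c z)" for y
      by (subst sum.swap) (simp add: stiffness_def sum_distrib_right)
    then show ?thesis by (simp add: sum.distrib)
  qed
  finally show ?thesis .
qed

text \<open>On each element \<open>trial0 c\<close> has at the displaced nodes the values of \<open>test c\<close> at the nodes, so
  \<open>energy_lower_bound\<close> applies.\<close>

lemma stiffness_pos_def:
  assumes "\<exists>x\<in>nodes. c x \<noteq> 0"
  shows "0 < (\<Sum>y\<in>nodes. c y * (\<Sum>z\<in>nodes. stiffness y z * c z))"
proof -
  have en: "(\<Sum>y\<in>nodes. c y * (\<Sum>z\<in>nodes. stiffness y z * c z)) = (\<Sum>T\<in>M. energy T (trial0 c T) (test c T))"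
  proof -
    have "(\<Sum>T\<in>M. energy T (trial0 c T) (test c T)) = (\<Sum>T\<in>M. \<Sum>y\<in>nodes. c y * (\<Sum>z\<in>nodes. energy T (trial_part T z) (test_part T y) * c z))"
      unfolding trial0_def test_def
      by (intro sum.cong refl energy_sum compact_M) (auto intro: C1_fun_polys test_part_polys trial_part_polys)
    also have "\<dots> = (\<Sum>y\<in>nodes. c y * (\<Sum>T\<in>M. \<Sum>z\<in>nodes. energy T (trial_part T z) (test_part T y) * c z))"
      by (subst sum.swap) (simp add: sum_distrib_left)
    also have "\<dots> = (\<Sum>y\<in>nodes. c y * (\<Sum>z\<in>nodes. stiffness y z * c z))"
    proof -
      have "(\<Sum>T\<in>M. \<Sum>z\<in>nodes. energy T (trial_part T z) (test_part T y) * c z) = (\<Sum>z\<in>nodes. stiffness y z * c z)" for y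
        by (subst sum.swap) (simp add: stiffness_def sum_distrib_right)
      then show ?thesis by simp
    qed
    finally show ?thesis ..
  qed
  have ptn: "norm (pt T x - x) \<le> node_tol k \<sigma> * diameter T" if T: "T \<in> M" and x: "x \<in> lattice_points k T" for T x
  proof -
    have "norm (pt T x - x) \<le> \<eta> * diameter T" using pt[OF T x] by (simp add: displaced_node_def)
    also have "\<dots> \<le> node_tol k \<sigma> * diameter T"
      using \<eta> tetrahedron.diameter_pos[OF simplex_M[OF T]] by (intro mult_right_mono) auto
    finally show ?thesis .
  qed
  have match: "trial0 c T (pt T x) = test c T x" if "T \<in> M" "x \<in> lattice_points k T" for T x
    using that by (simp add: trial0_node test_node)
  have nonneg: "0 \<le> energy T (trial0 c T) (test c T)" if T: "T \<in> M" for T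
    by (rule shape_regular_tetrahedron.energy_lower_bound(1)[OF reg[OF T] k ptn[OF T] test_polys[OF T] trial0_polys[OF T] match[OF T]])
  have "(\<Sum>T\<in>M. energy T (trial0 c T) (test c T)) \<noteq> 0"
  proof
    assume "(\<Sum>T\<in>M. energy T (trial0 c T) (test c T)) = 0"
    then have z: "energy T (trial0 c T) (test c T) = 0" if "T \<in> M" for T
      using sum_nonneg_eq_0_iff[OF finite_M, of "\<lambda>T. energy T (trial0 c T) (test c T)"] nonneg that by simp
    define b where "b x = (if x \<in> mesh_boundary M then 0 else c x)" for x
    have const: "b x = b y" if T: "T \<in> M" and xy: "x \<in> lattice_points k T" "y \<in> lattice_points k T" for T x y
    proof -
      have "test c T x = test c T y"
        by (rule shape_regular_tetrahedron.energy_lower_bound(2)[OF reg[OF T] k ptn[OF T] test_polys[OF T]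
              trial0_polys[OF T] match[OF T] z[OF T] xy])
      then show ?thesis using test_node[OF T xy(1)] test_node[OF T xy(2)] by (simp add: b_def)
    qed
    obtain x where x: "x \<in> nodes" "c x \<noteq> 0" using assms by blast
    then obtain T where T: "T \<in> M" "x \<in> lattice_points k T" "x \<notin> mesh_boundary M" by (auto simp: nodes_def)
    have "b x = 0"
    proof (rule locally_constant_nodal_zero[OF k _ _ T(1,2)])
      show "b y = 0" if "y \<in> mesh_boundary M" for y using that by (simp add: b_def)
      show "b y = b z" if "T' \<in> M" "y \<in> lattice_points k T'" "z \<in> lattice_points k T'" for T' y z
        using const that .
    qed
    then show False using x(2) T(3) by (simp add: b_def)
  qed
  moreover have "0 \<le> (\<Sum>T\<in>M. energy T (trial0 c T) (test c T))" using nonneg by (rule sum_nonneg)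
  ultimately show ?thesis unfolding en by linarith
qed

lemma trial_cong: "(\<And>x. x \<in> nodes \<Longrightarrow> c x = d x) \<Longrightarrow> trial c = trial d"
  unfolding trial_def trial0_def by (auto intro!: ext sum.cong restrict_ext)

theorem discrete_problem_unique_solution:
  assumes "bounded \<Omega>" "square_integrable \<Omega> f"
  shows "\<exists>!u. u \<in> W_space k \<Omega> M Pl g \<and> (\<forall>v \<in> V_space k M. a_form M u v = L_form \<Omega> M f v)"
proof -
  define e where "e y = test_fun (\<lambda>x. if x = y then 1 else 0)" for y
  define b where "b y = L_form \<Omega> M f (e y) - (\<Sum>T\<in>M. energy T (lift T) (test_part T y))" for y
  have eV: "e y \<in> V_space k M" for y unfolding e_def by (rule test_fun_in_V)
  have e_on: "e y z = test_part T y z" if "T \<in> M" "z \<in> T" "y \<in> nodes" for T y z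
    unfolding e_def test_fun_eq[OF that(1,2)] test_def using finite_nodes that(3)
    by (simp add: if_distrib[of "\<lambda>t. t * _"] cong: if_cong)
  have L: "L_form \<Omega> M f v = (\<Sum>y\<in>nodes. v y * L_form \<Omega> M f (e y))" if v: "v \<in> V_space k M" for v
  proof (rule L_form_sum[OF assms eV])
    fix x assume "x \<in> mesh_domain M"
    then obtain T where T: "T \<in> M" "x \<in> T" using interior_subset unfolding mesh_domain_def by blast
    show "v x = (\<Sum>y\<in>nodes. v y * e y x)"
      unfolding V_space_test[OF v T] test_def using e_on[OF T] by (intro sum.cong) auto
  qed
  have e_node: "e y x = (if x = y then 1 else 0)" if x: "x \<in> nodes" for x y
  proof -
    obtain T where T: "T \<in> M" "x \<in> lattice_points k T" "x \<notin> mesh_boundary M" using x by (auto simp: nodes_def)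
    have "x \<in> T" using tetrahedron.lattice_subset[OF simplex_M[OF T(1)] k] T(2) by blast
    then show ?thesis unfolding e_def test_fun_eq[OF T(1) \<open>x \<in> T\<close>] test_node[OF T(1,2)] using T(3) by simp
  qed
  have solves: "(\<forall>v \<in> V_space k M. a_form M (trial c) v = L_form \<Omega> M f v)
      \<longleftrightarrow> (\<forall>y\<in>nodes. (\<Sum>z\<in>nodes. stiffness y z * c z) = b y)" for c
  proof
    assume a: "\<forall>v \<in> V_space k M. a_form M (trial c) v = L_form \<Omega> M f v"
    show "\<forall>y\<in>nodes. (\<Sum>z\<in>nodes. stiffness y z * c z) = b y"
    proof
      fix y assume y: "y \<in> nodes"
      have sift: "(\<Sum>x\<in>nodes. e y x * F x) = F y" for F :: "real^3 \<Rightarrow> real"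
      proof -
        have "(\<Sum>x\<in>nodes. e y x * F x) = (\<Sum>x\<in>nodes. if x = y then F x else 0)"
          using e_node by (intro sum.cong) auto
        then show ?thesis using finite_nodes y by simp
      qed
      have "a_form M (trial c) (e y) = (\<Sum>T\<in>M. energy T (lift T) (test_part T y)) + (\<Sum>z\<in>nodes. stiffness y z * c z)"
        unfolding a_form_trial[OF eV] by (rule sift)
      then show "(\<Sum>z\<in>nodes. stiffness y z * c z) = b y"
        using bspec[OF a eV, of y] unfolding b_def by linarith
    qed
  next
    assume s: "\<forall>y\<in>nodes. (\<Sum>z\<in>nodes. stiffness y z * c z) = b y"
    show "\<forall>v \<in> V_space k M. a_form M (trial c) v = L_form \<Omega> M f v"
    proof
      fix v assume v: "v \<in> V_space k M"
      show "a_form M (trial c) v = L_form \<Omega> M f v"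
        unfolding a_form_trial[OF v] L[OF v] using s by (intro sum.cong) (auto simp: b_def)
    qed
  qed
  obtain c where c: "\<forall>y\<in>nodes. (\<Sum>z\<in>nodes. stiffness y z * c z) = b y"
    using pos_def_solvable[OF finite_nodes stiffness_pos_def] by blast
  show ?thesis
  proof (rule ex1I[of _ "trial c"])
    show "trial c \<in> W_space k \<Omega> M Pl g \<and> (\<forall>v \<in> V_space k M. a_form M (trial c) v = L_form \<Omega> M f v)"
      using W_space_eq_trial solves c by blast
  next
    fix u assume u: "u \<in> W_space k \<Omega> M Pl g \<and> (\<forall>v \<in> V_space k M. a_form M u v = L_form \<Omega> M f v)"
    then obtain d where d: "u = trial d" using W_space_eq_trial by blast
    then have ds: "\<forall>y\<in>nodes. (\<Sum>z\<in>nodes. stiffness y z * d z) = b y" using u solves by blast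
    have "(\<Sum>z\<in>nodes. stiffness y z * (d z - c z)) = 0" if "y \<in> nodes" for y
      using c ds that by (simp add: right_diff_distrib sum_subtractf)
    then have "(\<Sum>y\<in>nodes. (d y - c y) * (\<Sum>z\<in>nodes. stiffness y z * (d z - c z))) = 0" by simp
    then have "\<forall>x\<in>nodes. d x - c x = 0" using stiffness_pos_def[of "\<lambda>x. d x - c x"] by fastforce
    then show "u = trial c" unfolding d by (intro trial_cong) auto
  qed
qed

end

section \<open>Unique solvability on fine meshes\<close>

theorem proposition4p2:
  fixes \<Omega> :: "(real^3) set"
    and f g :: "real^3 \<Rightarrow> real"
    and k :: nat
    and M :: "'i \<Rightarrow> (real^3) set set"
    and Pl :: "'i \<Rightarrow> (real^3) set \<Rightarrow> (real^3) set"
  assumes "open \<Omega>" and "connected \<Omega>" and "bounded \<Omega>" and "\<Omega> \<noteq> {}"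
    and "C1_boundary_with_curvatures \<Omega>"
    and "k \<ge> 2"
    and "sobolev (k - 1) \<Omega> f"
    and "sobolev_boundary k \<Omega> g"
    and "\<exists>u. dirichlet_solution \<Omega> f g u \<and> sobolev (k + 1) \<Omega> u"
    and "\<exists>u0. dirichlet_solution \<Omega> (\<lambda>x. 0) g u0 \<and> sobolev (k + 1) \<Omega> u0"
    and "\<And>i. fitted_mesh \<Omega> (M i)"
    and "regular_family M"
    and "edge_planes_family M Pl"
  shows "\<exists>h0>0. \<forall>i. mesh_size (M i) < h0 \<longrightarrow>
           (\<exists>!u. u \<in> W_space k \<Omega> (M i) (Pl i) g \<and>
                 (\<forall>v \<in> V_space k (M i). a_form (M i) u v = L_form \<Omega> (M i) f v))"
proof -
  have k: "k > 0" using assms(6) by simp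
  have f: "square_integrable \<Omega> f" using assms(7) by (simp add: sobolev_def)
  obtain \<sigma>0 where \<sigma>0: "0 < \<sigma>0" "\<And>i T. T \<in> M i \<Longrightarrow> diameter T \<le> \<sigma>0 * inball_diameter T"
    using assms(12) unfolding regular_family_def by blast
  obtain \<theta> where \<theta>: "0 \<le> \<theta>" "\<theta> < pi / 2" "\<And>i. edge_planes \<theta> (M i) (Pl i)"
    using assms(13) unfolding edge_planes_family_def by blast
  \<comment> \<open>A larger shape parameter is admissible because the inscribed diameter is positive.\<close>
  define \<sigma> where "\<sigma> = max \<sigma>0 1"
  have \<sigma>: "1 \<le> \<sigma>" by (simp add: \<sigma>_def)
  have cos: "0 < cos \<theta>" using \<theta>(1,2) by (intro cos_gt_zero_pi) (auto intro: less_le_trans[of _ 0])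
  have mesh: "mesh_in_domain \<Omega> (M i)" for i
    using assms(1,11) by (simp add: mesh_in_domain_def)
  have reg: "shape_regular_tetrahedron T \<sigma>" if "T \<in> M i" for T i
  proof -
    interpret mesh_in_domain \<Omega> "M i" by (rule mesh)
    interpret tetrahedron T by (rule simplex_M[OF that])
    have "0 < \<sigma>0 * inball_diameter T" using \<sigma>0(2)[OF that] diameter_pos by linarith
    then have "0 < inball_diameter T" using \<sigma>0(1) by (simp add: zero_less_mult_iff)
    then have "\<sigma>0 * inball_diameter T \<le> \<sigma> * inball_diameter T"
      by (intro mult_right_mono) (auto simp: \<sigma>_def)
    then show ?thesis
      using \<sigma>0(2)[OF that] \<sigma> by unfold_locales auto
  qed
  \<comment> \<open>The first bound makes the lines transversal, the second one keeps the displacements within \<open>node_tol\<close>.\<close>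
  define \<epsilon> where "\<epsilon> = min (cos \<theta> / (256 * \<sigma> ^ 3)) (node_tol k \<sigma> * cos \<theta> / (256 * \<sigma>\<^sup>2))"
  have tol: "0 < node_tol k \<sigma>" using tolerance_bounds(5)[OF k, of \<sigma>] \<sigma> by simp
  have \<epsilon>: "0 < \<epsilon>" "\<epsilon> \<le> cos \<theta> / (256 * \<sigma> ^ 3)" using \<sigma> cos tol by (auto simp: \<epsilon>_def)
  define \<eta> where "\<eta> = 256 * \<sigma>\<^sup>2 / cos \<theta> * \<epsilon>"
  have \<eta>: "\<eta> \<le> node_tol k \<sigma>"
  proof -
    have "\<epsilon> \<le> node_tol k \<sigma> * cos \<theta> / (256 * \<sigma>\<^sup>2)" by (simp add: \<epsilon>_def)
    then have "\<eta> \<le> 256 * \<sigma>\<^sup>2 / cos \<theta> * (node_tol k \<sigma> * cos \<theta> / (256 * \<sigma>\<^sup>2))"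
      unfolding \<eta>_def using cos by (intro mult_left_mono) auto
    then show ?thesis using cos \<sigma> by simp
  qed
  obtain r where r: "r > 0" "\<And>x. x \<in> frontier \<Omega> \<Longrightarrow> \<exists>n. flat_at \<Omega> \<epsilon> r x n"
    using uniformly_flat[OF assms(1,3,5) \<epsilon>(1)] by blast
  show ?thesis
  proof (intro exI[of _ "r / 2"] conjI allI impI)
    show "0 < r / 2" using r(1) by simp
    fix i assume "mesh_size (M i) < r / 2"
    then have size: "2 * mesh_size (M i) < r" by simp
    interpret mesh_in_domain \<Omega> "M i" by (rule mesh)
    have ex: "\<exists>pt. \<forall>T\<in>M i. \<forall>x\<in>lattice_points k T. displaced_node k (Pl i) \<eta> T x (pt T x)"
      unfolding \<eta>_def by (rule displaced_nodes_exist[OF k \<sigma> reg r(2) cos \<epsilon> size \<theta>(3)])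
    obtain pt where pt: "\<And>T x. T \<in> M i \<Longrightarrow> x \<in> lattice_points k T \<Longrightarrow> displaced_node k (Pl i) \<eta> T x (pt T x)"
      using ex by blast
    have "\<exists>B. nodal_basis k (lattice_points k T) (pt T) B" if T: "T \<in> M i" for T
    proof -
      interpret shape_regular_tetrahedron T \<sigma> by (rule reg[OF T])
      show ?thesis
      proof (rule displaced_nodal_basis[OF k])
        fix x assume "x \<in> lattice_points k T"
        then have "norm (pt T x - x) \<le> \<eta> * h" using pt[OF T] by (simp add: displaced_node_def)
        also have "\<dots> \<le> node_tol k \<sigma> * h" using \<eta> diameter_pos by (intro mult_right_mono) auto
        finally show "norm (pt T x - x) \<le> node_tol k \<sigma> * h" .
      qed
    qed
    then obtain B where B: "\<And>T. T \<in> M i \<Longrightarrow> nodal_basis k (lattice_points k T) (pt T) (B T)"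
      by metis
    interpret displaced_mesh \<Omega> "M i" k \<sigma> \<eta> "Pl i" pt B g
      by (rule displaced_mesh.intro[OF mesh displaced_mesh_axioms.intro]) (use k reg pt \<eta> B in blast)+
    show "\<exists>!u. u \<in> W_space k \<Omega> (M i) (Pl i) g \<and>
                 (\<forall>v \<in> V_space k (M i). a_form (M i) u v = L_form \<Omega> (M i) f v)"
      by (rule discrete_problem_unique_solution[OF assms(3) f])
  qed
qed

end
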